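(* Let $\mathbb{P}$ be a rider piece with basic move set $\mathbf{M}$ on the square board, and write $u_{\mathbb P}(q;n)=\gamma_0(n)n^{2q}+\gamma_1(n)n^{2q-1}+\cdots+\gamma_{2q}(n)n^0$. The coefficients $\gamma_i$ for $i\le 2$ are independent of $n$. The coefficient $q!\gamma_i$ of $n^{2q-i}$ in $o_{\mathbb P}(q;n)$ is a polynomial in $q$, of degree $2i$, which depends periodically on $n$. The leading coefficients are $$q!\gamma_0=1,\qquad q!\gamma_1=-(q)_2\,\frac{a_{10}}{2},$$ and for $i\ge 1$ the coefficients are $$q!\gamma_i=(q)_{2i}\bar\theta_{i,2i}+(q)_{2i-1}\bar\theta_{i,2i-1}+\cdots+(q)_2\bar\theta_{i,2} =\sum_{\kappa=2}^{2i}(q)_\kappa\sum_{\nu=\lceil\kappa/2\rceil}^{\min(i,2\kappa-2)}\ \sum_{[\mathcal U_\kappa^\nu]}\mu(\hat0,\mathcal U_\kappa^\nu)\,\frac{1}{|\operatorname{Aut}(\mathcal U_\kappa^\nu)|}\,\bar\gamma_{i-\nu}(\mathcal U_\kappa^\nu),$$ where $\bar\theta_{i,\kappa}$ denotes the coefficient of $(q)_\kappa$ in the right-hand sum, the inner sum ranges over all types $[\mathcal U_\kappa^\nu]$ of intersection subspaces $\mathcal U_\kappa^\nu\in\mathscr L(\mathscr A_{\mathbb P}^q)$ that involve exactly $\kappa$ pieces and have codimension $\nu$. Moreover $\bar\theta_{i,2i}=(-a_{10}/2)^i/i!$ and $$\bar\theta_{i,2}=\begin{cases}-a_{10}/2&\text{for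 } i=1,\\ (|\mathbf M|-1)/2&\text{for } i=2,\\ -a_{12}/2&\text{for } i=3,\\ -a_{13}/2&\text{for } i=4,\\ 0&\text{for } i>4.\end{cases}$$ The period of $\gamma_i$ (in $n$) is a divisor of the least common multiple of the periods of all counting quasipolynomials $\alpha(\mathcal U;n)$ for $\mathcal U\in\mathscr L(\mathscr A_{\mathbb P}^q)$ such that $\operatorname{codim}\mathcal U\le i$.
   Context: A rider piece $\mathbb P$ is given by a nonempty finite set $\mathbf M\subset\mathbb Z^2$ of nonzero, pairwise non-parallel vectors $m=(c,d)$ with $c,d$ relatively prime (the basic moves). The $n\times n$ board is $[n]^2=\{1,\dots,n\}^2$. Two pieces at positions $z,z'\in[n]^2$ attack each other if $z'-z$ is an integer multiple (possibly zero) of some $m\in\mathbf M$. $o_{\mathbb P}(q;n)$ is the number of placements of $q$ labelled copies of $\mathbb P$ on $[n]^2$ with no two attacking, and $u_{\mathbb P}(q;n)=o_{\mathbb P}(q;n)/q!$ is the number for unlabelled copies. For fixed $q$ these are quasipolynomial functions of $n$ of degree $2q$ (that is, given by a cyclically repeating sequence of polynomials, the constituents), so the coefficients $\gamma_i=\gamma_i(n)$ are periodic functions of $n$. "Period" means smallest period in $n$. For $(c,d)\in\mathbf M$ and $1\le i<j\le q$, with $z_i=(x_i,y_i)$, let $\mathcal H_{ij}^{d/c}=\{(z_1,\dots,z_q)\in\mathbb R^{2q}: d(x_j-x_i)=c(y_j-y_i)\}$. $\mathscr A_{\mathbb P}^q$ is the arrangement of all these hyperplanes; $\mathscr L(\mathscr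 A_{\mathbb P}^q)$ is the lattice of all intersections of subsets of it (including $\mathbb R^{2q}$, the empty intersection), ordered by reverse inclusion, with Möbius function $\mu$ and bottom element $\hat0=\mathbb R^{2q}$. For $\mathcal U\in\mathscr L(\mathscr A_{\mathbb P}^q)$, $\kappa$ is the number of pieces (indices $i$) involved in the equations determining $\mathcal U$, $\widetilde{\mathcal U}\subseteq\mathbb R^{2\kappa}$ is the subspace (in the coordinates of those $\kappa$ pieces) defined by the same equations, $\nu=\operatorname{codim}\mathcal U$, and $\alpha(\mathcal U;n)$ is the number of integer points in $(n+1)\big((0,1)^{2\kappa}\cap\widetilde{\mathcal U}\big)$, a quasipolynomial in $n$, written $\alpha(\mathcal U;n)=\sum_{j=0}^{2\kappa-\nu}\bar\gamma_j(\mathcal U)\,n^{2\kappa-\nu-j}$, where each $\bar\gamma_j(\mathcal U)$ is periodic in $n$ (and $\bar\gamma_j(\mathcal U)=0$ for $j>2\kappa-\nu$). Two subspaces are isomorphic if one becomes the other by relabelling the pieces; the type $[\mathcal U]$ is the isomorphism class; $\operatorname{Aut}(\mathcal U)$ is the group of permutations of the $\kappa$ involved pieces that preserve $\mathcal U$. $(q)_\kappa=q(q-1)\cdots(q-\kappa+1)$. For $(c,d)\in\mathbf M$ put $\hat c=\min(|c|,|d|)$, $\hat d=\max(|c|,|d|)$, $\bar n=(n\bmod\hat d)\in\{0,\dots,\hat d-1\}$, and $$a_{10}=\sum_{(c,d)\in\mathbf M}\frac{3\hat d-\hat c}{3\hat d^2},\quad a_{12}=\sum_{(c,d)\in\mathbf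 M}\frac{\hat c\hat d^2+3(\hat d-\hat c)\bar n(\hat d-\bar n)}{3\hat d^2},\quad a_{13}=-\sum_{(c,d)\in\mathbf M}\frac{\hat c}{3\hat d^2}\bar n(\hat d-\bar n)(\hat d-2\bar n).$$ *)

theory Defs
  imports
    "HOL-Analysis.Analysis"
    "HOL-Library.Function_Algebras"
    "HOL-Combinatorics.Permutations"
    "HOL-Computational_Algebra.Polynomial"
begin

section \<open>Quasipolynomials\<close>

text \<open>A quasipolynomial is given by a cyclically repeating sequence of polynomials, its
  constituents; \<open>p n\<close> is the constituent that applies at \<open>n\<close>. Board sizes are positive, so the
  values are only required to agree for \<open>n \<ge> 1\<close>; this already determines the constituents.\<close>

definition has_constituents :: "(nat \<Rightarrow> real) \<Rightarrow> (nat \<Rightarrow> real poly) \<Rightarrow> bool" where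
  "has_constituents f p \<longleftrightarrow>
     (\<exists>T>0. \<forall>n. p (n + T) = p n) \<and> (\<forall>n\<ge>1. f n = poly (p n) (real n))"

definition constituents :: "(nat \<Rightarrow> real) \<Rightarrow> nat \<Rightarrow> real poly" where
  "constituents f = (THE p. has_constituents f p)"

definition min_period :: "(nat \<Rightarrow> 'a) \<Rightarrow> nat" where
  "min_period g = (LEAST T. T > 0 \<and> (\<forall>n. g (n + T) = g n))"

text \<open>With \<open>f = (\<Sum>j\<le>D. c\<^sub>j n\<^bsup>D-j\<^esup>)\<close>, this is the periodic coefficient \<open>c\<^sub>j(n)\<close>,
  with \<open>c\<^sub>j = 0\<close> for \<open>j > D\<close>.\<close>

definition qp_coeff :: "(nat \<Rightarrow> real) \<Rightarrow> nat \<Rightarrow> nat \<Rightarrow> nat \<Rightarrow> real" where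
  "qp_coeff f D j n = (if j \<le> D then coeff (constituents f n) (D - j) else 0)"

section \<open>Rider pieces and nonattacking placements\<close>

definition rider_moves :: "(int \<times> int) set \<Rightarrow> bool" where
  "rider_moves M \<longleftrightarrow> finite M \<and> M \<noteq> {} \<and>
     (\<forall>(c, d)\<in>M. (c, d) \<noteq> (0, 0) \<and> coprime c d) \<and>
     (\<forall>(c, d)\<in>M. \<forall>(c', d')\<in>M. (c, d) \<noteq> (c', d') \<longrightarrow> c * d' \<noteq> d * c')"

definition board :: "nat \<Rightarrow> (int \<times> int) set" where
  "board n = {1..int n} \<times> {1..int n}"

definition attack :: "(int \<times> int) set \<Rightarrow> int \<times> int \<Rightarrow> int \<times> int \<Rightarrow> bool" where
  "attack M z z' \<longleftrightarrow> (\<exists>(c, d)\<in>M. \<exists>k::int. z' - z = (k * c, k * d))"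

definition o_count :: "(int \<times> int) set \<Rightarrow> nat \<Rightarrow> nat \<Rightarrow> nat" where
  "o_count M q n =
     card {z \<in> {1..q} \<rightarrow>\<^sub>E board n. \<forall>i\<in>{1..q}. \<forall>j\<in>{1..q}. i \<noteq> j \<longrightarrow> \<not> attack M (z i) (z j)}"

definition u_count :: "(int \<times> int) set \<Rightarrow> nat \<Rightarrow> nat \<Rightarrow> real" where
  "u_count M q n = real (o_count M q n) / fact q"

definition gamma :: "(int \<times> int) set \<Rightarrow> nat \<Rightarrow> nat \<Rightarrow> nat \<Rightarrow> real" where
  "gamma M q i n = qp_coeff (u_count M q) (2 * q) i n"

section \<open>The move arrangement and its intersection lattice\<close>

text \<open>For a finite set \<open>I\<close> of pieces, \<open>\<real>\<^bsup>2|I|\<^esup>\<close> is rendered as the space of all maps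
  \<open>z :: nat \<Rightarrow> real \<times> real\<close>, \<open>z i = (x\<^sub>i, y\<^sub>i)\<close>, that vanish outside \<open>I\<close>. This makes it a
  subspace of one fixed real vector space while the number of pieces varies.\<close>

type_synonym config = "nat \<Rightarrow> real \<times> real"

definition config_space :: "nat set \<Rightarrow> config set" where
  "config_space I = {z. \<forall>i. i \<notin> I \<longrightarrow> z i = 0}"

definition cscale :: "real \<Rightarrow> config \<Rightarrow> config" where
  "cscale r z = (\<lambda>i. r *\<^sub>R z i)"

global_interpretation config: vector_space cscale
  by unfold_locales (auto simp: cscale_def fun_eq_iff scaleR_add_right scaleR_add_left)

definition on_hyperplane :: "int \<times> int \<Rightarrow> nat \<Rightarrow> nat \<Rightarrow> config \<Rightarrow> bool" where
  "on_hyperplane m i j z \<longleftrightarrow>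
     of_int (snd m) * (fst (z j) - fst (z i)) = of_int (fst m) * (snd (z j) - snd (z i))"

definition hyperplane :: "nat \<Rightarrow> int \<times> int \<Rightarrow> nat \<Rightarrow> nat \<Rightarrow> config set" where
  "hyperplane q m i j = {z \<in> config_space {1..q}. on_hyperplane m i j z}"

definition arrangement :: "(int \<times> int) set \<Rightarrow> nat \<Rightarrow> config set set" where
  "arrangement M q = {hyperplane q m i j | m i j. m \<in> M \<and> 1 \<le> i \<and> i < j \<and> j \<le> q}"

definition int_lattice :: "(int \<times> int) set \<Rightarrow> nat \<Rightarrow> config set set" where
  "int_lattice M q = (\<lambda>S. config_space {1..q} \<inter> \<Inter> S) ` Pow (arrangement M q)"

text \<open>The Moebius function \<open>\<mu>(V, U)\<close> of a finite family \<open>L\<close> of sets ordered by reverse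
  inclusion, by \<open>\<mu>(V, V) = 1\<close> and \<open>\<mu>(V, U) = - (\<Sum>V \<le> W < U. \<mu>(V, W))\<close>.\<close>

function moebius :: "'a set set \<Rightarrow> 'a set \<Rightarrow> 'a set \<Rightarrow> int" where
  "moebius L V U =
     (if finite L \<and> V \<in> L \<and> U \<in> L \<and> U \<subseteq> V then
        (if U = V then 1 else - (\<Sum>W\<in>{W\<in>L. U \<subset> W \<and> W \<subseteq> V}. moebius L V W))
      else 0)"
  by auto
termination
proof (relation "Wellfounded.measure (\<lambda>(L, V, U). card {W\<in>L. U \<subset> W})", goal_cases)
  case 1
  then show ?case by simp
next
  case (2 L V U W)
  then show ?case by (auto intro!: psubset_card_mono)
qed

declare moebius.simps [simp del]

definition codim :: "nat \<Rightarrow> config set \<Rightarrow> nat" where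
  "codim q U = 2 * q - config.dim U"

text \<open>The equations determining \<open>U\<close> are taken to be those of all hyperplanes of the arrangement
  that contain \<open>U\<close>. Any subset of hyperplanes with intersection \<open>U\<close> involves the same pieces.\<close>

definition equations :: "(int \<times> int) set \<Rightarrow> nat \<Rightarrow> config set \<Rightarrow> ((int \<times> int) \<times> nat \<times> nat) set" where
  "equations M q U = {(m, i, j). m \<in> M \<and> 1 \<le> i \<and> i < j \<and> j \<le> q \<and> U \<subseteq> hyperplane q m i j}"

definition pieces :: "(int \<times> int) set \<Rightarrow> nat \<Rightarrow> config set \<Rightarrow> nat set" where
  "pieces M q U = (\<Union>(m, i, j)\<in>equations M q U. {i, j})"

definition essential_part :: "(int \<times> int) set \<Rightarrow> nat \<Rightarrow> config set \<Rightarrow> config set" where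
  "essential_part M q U =
     {z \<in> config_space (pieces M q U). \<forall>(m, i, j)\<in>equations M q U. on_hyperplane m i j z}"

definition open_cube :: "nat set \<Rightarrow> config set" where
  "open_cube I = {z \<in> config_space I. \<forall>i\<in>I. z i \<in> {0<..<1} \<times> {0<..<1}}"

definition integer_points :: "config set" where
  "integer_points = {z. \<forall>i. z i \<in> \<int> \<times> \<int>}"

definition alpha :: "(int \<times> int) set \<Rightarrow> nat \<Rightarrow> config set \<Rightarrow> nat \<Rightarrow> real" where
  "alpha M q U n = real (card (integer_points \<inter>
     cscale (real n + 1) ` (open_cube (pieces M q U) \<inter> essential_part M q U)))"

definition gamma_bar :: "(int \<times> int) set \<Rightarrow> nat \<Rightarrow> config set \<Rightarrow> nat \<Rightarrow> nat \<Rightarrow> real" where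
  "gamma_bar M q U j n = qp_coeff (alpha M q U) (2 * card (pieces M q U) - codim q U) j n"

section \<open>Isomorphism types\<close>

definition relabel :: "(nat \<Rightarrow> nat) \<Rightarrow> config set \<Rightarrow> config set" where
  "relabel \<sigma> U = (\<lambda>z. z \<circ> \<sigma>) ` U"

definition iso_rel :: "(int \<times> int) set \<Rightarrow> nat \<Rightarrow> (config set \<times> config set) set" where
  "iso_rel M q = {(U, V). U \<in> int_lattice M q \<and> V \<in> int_lattice M q \<and>
     (\<exists>\<sigma>. \<sigma> permutes {1..q} \<and> V = relabel \<sigma> U)}"

definition types :: "(int \<times> int) set \<Rightarrow> nat \<Rightarrow> nat \<Rightarrow> nat \<Rightarrow> config set set set" where
  "types M q \<kappa> \<nu> =
     {U \<in> int_lattice M q. card (pieces M q U) = \<kappa> \<and> codim q U = \<nu>} // iso_rel M q"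

definition representative :: "config set set \<Rightarrow> config set" where
  "representative t = (SOME U. U \<in> t)"

definition Aut :: "(int \<times> int) set \<Rightarrow> nat \<Rightarrow> config set \<Rightarrow> (nat \<Rightarrow> nat) set" where
  "Aut M q U = {\<sigma>. \<sigma> permutes pieces M q U \<and> relabel \<sigma> U = U}"

text \<open>The falling factorial \<open>(q)\<^sub>\<kappa>\<close>; it is \<open>0\<close> for \<open>\<kappa> > q\<close>.\<close>

definition falling :: "nat \<Rightarrow> nat \<Rightarrow> real" where
  "falling q \<kappa> = (\<Prod>j<\<kappa>. real q - real j)"

text \<open>The coefficient of \<open>(q)\<^sub>\<kappa>\<close> in the expansion of \<open>q! \<gamma>\<^sub>i\<close>, computed from the types found in
  the lattice for \<open>q\<close> pieces. All types with \<open>\<kappa>\<close> pieces occur there once \<open>q \<ge> \<kappa>\<close>.\<close>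

definition theta_bar :: "(int \<times> int) set \<Rightarrow> nat \<Rightarrow> nat \<Rightarrow> nat \<Rightarrow> nat \<Rightarrow> real" where
  "theta_bar M q i \<kappa> n =
     (\<Sum>\<nu> = nat \<lceil>real \<kappa> / 2\<rceil>..min i (2 * \<kappa> - 2). \<Sum>t\<in>types M q \<kappa> \<nu>.
        let U = representative t in
          of_int (moebius (int_lattice M q) (config_space {1..q}) U)
            * (1 / real (card (Aut M q U))) * gamma_bar M q U (i - \<nu>) n)"

section \<open>The explicit constants\<close>

definition c_hat :: "int \<times> int \<Rightarrow> int" where
  "c_hat m = min \<bar>fst m\<bar> \<bar>snd m\<bar>"

definition d_hat :: "int \<times> int \<Rightarrow> int" where
  "d_hat m = max \<bar>fst m\<bar> \<bar>snd m\<bar>"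

definition n_bar :: "int \<times> int \<Rightarrow> nat \<Rightarrow> int" where
  "n_bar m n = int n mod d_hat m"

definition a10 :: "(int \<times> int) set \<Rightarrow> real" where
  "a10 M = (\<Sum>m\<in>M. of_int (3 * d_hat m - c_hat m) / of_int (3 * (d_hat m)\<^sup>2))"

definition a12 :: "(int \<times> int) set \<Rightarrow> nat \<Rightarrow> real" where
  "a12 M n = (\<Sum>m\<in>M.
     of_int (c_hat m * (d_hat m)\<^sup>2 + 3 * (d_hat m - c_hat m) * n_bar m n * (d_hat m - n_bar m n))
       / of_int (3 * (d_hat m)\<^sup>2))"

definition a13 :: "(int \<times> int) set \<Rightarrow> nat \<Rightarrow> real" where
  "a13 M n = - (\<Sum>m\<in>M. of_int (c_hat m) / of_int (3 * (d_hat m)\<^sup>2)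
     * of_int (n_bar m n * (d_hat m - n_bar m n) * (d_hat m - 2 * n_bar m n)))"

end

theory Submission
  imports Defs
begin

text \<open>Two pieces attack each other iff their configuration lies on a hyperplane of the arrangement
  (\<open>attack_iff\<close>; this uses that the moves are primitive vectors). Inclusion and exclusion over the sets \<open>S\<close>
  of such equations counts the nonattacking configurations. By Whitney's theorem (\<open>moebius_whitney\<close>) the signs
  \<open>(-1)\<^bsup>|S|\<^esup>\<close> of the systems \<open>S\<close> of equations for one subspace \<open>U\<close> add up to \<open>\<mu>(0, U)\<close>, so that
  \<open>o(q; n) = \<Sum>\<^sub>U \<mu>(0, U) N(U; n)\<close>, where \<open>N(U; n) = \<alpha>(U; n) n\<^bsup>2(q - \<kappa>)\<^esup>\<close> counts the points of \<open>U\<close> on the board.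

  The functions \<open>N(U; n)\<close> are quasipolynomials for all \<open>n \<ge> 1\<close>: the coordinates are summed out one at a time
  within a class of functions that are quasipolynomial on homogeneous polyhedral pieces (\<open>pqp_sum_variable\<close>,
  \<open>quasipoly_homogeneous_system\<close>). Slicing \<open>U\<close> by coordinate hyperplanes bounds \<open>N(U; n)\<close> by \<open>n\<^bsup>dim U\<^esup>\<close>, and
  \<open>N(U; n + 1) - N(U; n)\<close> by a multiple of \<open>(n + 1)\<^bsup>dim U - 1\<^esup>\<close>. The first bound limits the degree, so only
  subspaces of codimension at most \<open>i\<close> contribute to \<open>\<gamma>\<^sub>i\<close>, which also yields the statement on periods. The
  second one makes the leading coefficient independent of \<open>n\<close>.

  Twice the codimension of \<open>U\<close> is at least the number \<open>\<kappa>\<close> of pieces involved, because each independent equation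
  brings in at most two new pieces (\<open>excess_mono\<close>); thus \<open>\<kappa> \<le> 2 i\<close> in \<open>\<gamma>\<^sub>i\<close>. Orbit counting under
  relabelling turns the sum over subspaces into the sum over types with weights \<open>(q)\<^sub>\<kappa> / |Aut U|\<close> (\<open>sum_types\<close>).
  The coefficient of \<open>(q)\<^sub>\<kappa>\<close> is \<open>1 / \<kappa>!\<close> times a sum over the systems of equations that involve all of the pieces
  \<open>1, \<dots>, \<kappa>\<close> (\<open>theta_bar_spanning\<close>), so it does not depend on \<open>q\<close>, and \<open>q! \<gamma>\<^sub>i\<close> is a polynomial in \<open>q\<close>.

  For \<open>\<kappa> = 2 i\<close> equality must hold in \<open>\<kappa> \<le> 2 codim U\<close>. This happens exactly for perfect matchings of the pieces
  by \<open>i\<close> equations; each equation carries the leading coefficient of the number of pairs on a line, and the sum over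
  the \<open>(2 i)! / (2\<^sup>i i!)\<close> matchings, divided by \<open>(2 i)!\<close>, is \<open>(- a10 / 2)\<^sup>i / i!\<close>. For \<open>\<kappa> = 2\<close> only a single line and coinciding pieces
  occur, and the pairs on a line are counted explicitly (\<open>has_constituents_pair\<close>).\<close>

section \<open>Quasipolynomials\<close>

definition quasipoly :: "(nat \<Rightarrow> real) \<Rightarrow> bool" where
  "quasipoly f \<longleftrightarrow> (\<exists>p. has_constituents f p)"

lemma has_constituentsI:
  assumes "T > 0" "\<And>n. p (n + T) = p n" "\<And>n. n \<ge> 1 \<Longrightarrow> f n = poly (p n) (real n)"
  shows "has_constituents f p"
  using assms unfolding has_constituents_def by blast

lemma periodic_mult:
  fixes g :: "nat \<Rightarrow> 'a"
  assumes "\<And>n. g (n + T) = g n"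
  shows "g (n + k * T) = g n"
proof (induction k)
  case (Suc k)
  have "g (n + Suc k * T) = g ((n + k * T) + T)" by (simp add: algebra_simps)
  then show ?case using assms Suc by simp
qed simp

text \<open>Two constituents for the same residue class agree at the infinitely many arguments of that class,
  so they are equal. Hence \<open>constituents f\<close> is the family of constituents whenever one exists, and a
  coefficient of a sum or product may be computed from any family that represents it.\<close>

lemma has_constituents_unique:
  assumes "has_constituents f p" "has_constituents f p'"
  shows "p = p'"
proof
  fix n
  obtain T where T: "T > 0" "\<And>n. p (n + T) = p n" "\<And>n. n \<ge> 1 \<Longrightarrow> f n = poly (p n) (real n)"
    using assms(1) unfolding has_constituents_def by blast
  obtain T' where T': "T' > 0" "\<And>n. p' (n + T') = p' n" "\<And>n. n \<ge> 1 \<Longrightarrow> f n = poly (p' n) (real n)"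
    using assms(2) unfolding has_constituents_def by blast
  have eq: "poly (p n - p' n) (real (n + Suc k * (T * T'))) = 0" for k
  proof -
    let ?m = "n + Suc k * (T * T')"
    have "p ?m = p n" using periodic_mult[of p T n "Suc k * T'"] T(2) by (simp only: mult_ac)
    moreover have "p' ?m = p' n"
      using periodic_mult[of p' T' n "Suc k * T"] T'(2) by (simp only: mult_ac)
    moreover have "?m \<ge> 1" using T(1) T'(1) by (simp add: Suc_le_eq)
    ultimately show ?thesis using T(3)[of ?m] T'(3)[of ?m] by simp
  qed
  have "inj (\<lambda>k. real (n + Suc k * (T * T')))"
    using T(1) T'(1) by (auto simp: inj_def)
  then have "infinite (range (\<lambda>k. real (n + Suc k * (T * T'))))"
    using finite_imageD by blast
  moreover have "range (\<lambda>k. real (n + Suc k * (T * T'))) \<subseteq> {x. poly (p n - p' n) x = 0}"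
    using eq by auto
  ultimately have "p n - p' n = 0"
    using poly_roots_finite finite_subset by metis
  then show "p n = p' n" by simp
qed

lemma constituents_eq: "has_constituents f p \<Longrightarrow> constituents f = p"
  unfolding constituents_def using has_constituents_unique by blast

lemma has_constituents_constituents: "quasipoly f \<Longrightarrow> has_constituents f (constituents f)"
  unfolding quasipoly_def using constituents_eq by metis

lemma has_constituents_cong:
  "(\<And>n. n \<ge> 1 \<Longrightarrow> f n = g n) \<Longrightarrow> has_constituents f = has_constituents g"
  unfolding has_constituents_def by (auto simp: fun_eq_iff)

lemma constituents_cong:
  "(\<And>n. n \<ge> 1 \<Longrightarrow> f n = g n) \<Longrightarrow> constituents f = constituents g"
  unfolding constituents_def using has_constituents_cong[of f g] by simp

lemma quasipoly_cong:
  "(\<And>n. n \<ge> 1 \<Longrightarrow> f n = g n) \<Longrightarrow> quasipoly f \<longleftrightarrow> quasipoly g"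
  unfolding quasipoly_def using has_constituents_cong[of f g] by simp

lemma has_constituents_poly: "has_constituents (\<lambda>n. poly P (real n)) (\<lambda>_. P)"
  by (rule has_constituentsI[of 1]) auto

lemma has_constituents_binop:
  assumes "has_constituents f p" "has_constituents g p'"
    and "\<And>P P' x. poly (F P P') x = G (poly P x) (poly P' x)"
  shows "has_constituents (\<lambda>n. G (f n) (g n)) (\<lambda>n. F (p n) (p' n))"
proof -
  obtain T where T: "T > 0" "\<And>n. p (n + T) = p n" "\<And>n. n \<ge> 1 \<Longrightarrow> f n = poly (p n) (real n)"
    using assms(1) unfolding has_constituents_def by blast
  obtain T' where T': "T' > 0" "\<And>n. p' (n + T') = p' n" "\<And>n. n \<ge> 1 \<Longrightarrow> g n = poly (p' n) (real n)"
    using assms(2) unfolding has_constituents_def by blast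
  show ?thesis
  proof (rule has_constituentsI)
    show "T * T' > 0" using T T' by simp
    show "F (p (n + T * T')) (p' (n + T * T')) = F (p n) (p' n)" for n
      using periodic_mult[of p T n T'] periodic_mult[of p' T' n T] T(2) T'(2)
      by (simp add: mult.commute)
  qed (simp add: T T' assms(3))
qed

lemma has_constituents_add:
  "has_constituents f p \<Longrightarrow> has_constituents g p' \<Longrightarrow>
   has_constituents (\<lambda>n. f n + g n) (\<lambda>n. p n + p' n)"
  by (rule has_constituents_binop) simp_all

lemma has_constituents_mult:
  "has_constituents f p \<Longrightarrow> has_constituents g p' \<Longrightarrow>
   has_constituents (\<lambda>n. f n * g n) (\<lambda>n. p n * p' n)"
  by (rule has_constituents_binop) simp_all

lemma has_constituents_cmult:
  "has_constituents f p \<Longrightarrow> has_constituents (\<lambda>n. c * f n) (\<lambda>n. smult c (p n))"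
  using has_constituents_mult[OF has_constituents_poly[of "[:c:]"]] by simp

lemma has_constituents_sum:
  assumes "finite A" "\<And>a. a \<in> A \<Longrightarrow> has_constituents (f a) (p a)"
  shows "has_constituents (\<lambda>n. \<Sum>a\<in>A. f a n) (\<lambda>n. \<Sum>a\<in>A. p a n)"
  using assms
proof (induction A)
  case empty
  then show ?case using has_constituents_poly[of 0] by simp
next
  case (insert a A)
  then show ?case using has_constituents_add[of "f a" "p a"] by simp
qed

lemma constituents_sum:
  assumes "finite A" "\<And>a. a \<in> A \<Longrightarrow> quasipoly (f a)"
  shows "constituents (\<lambda>n. \<Sum>a\<in>A. c a * f a n) = (\<lambda>n. \<Sum>a\<in>A. smult (c a) (constituents (f a) n))"
    and "quasipoly (\<lambda>n. \<Sum>a\<in>A. c a * f a n)"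
proof -
  have *: "has_constituents (\<lambda>n. \<Sum>a\<in>A. c a * f a n)
      (\<lambda>n. \<Sum>a\<in>A. smult (c a) (constituents (f a) n))"
    using assms by (intro has_constituents_sum has_constituents_cmult has_constituents_constituents)
  show "constituents (\<lambda>n. \<Sum>a\<in>A. c a * f a n) = (\<lambda>n. \<Sum>a\<in>A. smult (c a) (constituents (f a) n))"
    using constituents_eq[OF *] .
  show "quasipoly (\<lambda>n. \<Sum>a\<in>A. c a * f a n)" using * unfolding quasipoly_def by blast
qed

lemma qp_coeff_sum:
  assumes "finite A" "\<And>a. a \<in> A \<Longrightarrow> quasipoly (f a)"
  shows "qp_coeff (\<lambda>n. \<Sum>a\<in>A. c a * f a n) D j n = (\<Sum>a\<in>A. c a * qp_coeff (f a) D j n)"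
  by (simp add: qp_coeff_def constituents_sum[OF assms] coeff_sum)

lemma constituents_mult_power:
  assumes "quasipoly f"
  shows "constituents (\<lambda>n. f n * real n ^ k) = (\<lambda>n. constituents f n * monom 1 k)"
    and "quasipoly (\<lambda>n. f n * real n ^ k)"
proof -
  have *: "has_constituents (\<lambda>n. f n * real n ^ k) (\<lambda>n. constituents f n * monom 1 k)"
    using has_constituents_mult[OF has_constituents_constituents[OF assms] has_constituents_poly[of "monom 1 k"]]
    by (simp add: poly_monom)
  show "constituents (\<lambda>n. f n * real n ^ k) = (\<lambda>n. constituents f n * monom 1 k)"
    using constituents_eq[OF *] .
  show "quasipoly (\<lambda>n. f n * real n ^ k)" using * unfolding quasipoly_def by blast
qed

text \<open>Multiplication by \<open>n\<^sup>k\<close> shifts exponents and leaves the coefficient counted from the top alone.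
  This is how a subspace gives the same coefficient whether or not the free pieces are counted.\<close>

lemma qp_coeff_mult_power:
  assumes "quasipoly f" "\<And>n. n \<ge> 1 \<Longrightarrow> g n = f n * real n ^ k"
  shows "qp_coeff g (D + k) j n = qp_coeff f D j n"
proof -
  have g: "constituents g n = monom 1 k * constituents f n"
    using constituents_cong[of g "\<lambda>n. f n * real n ^ k"] constituents_mult_power[OF assms(1)] assms(2)
    by (simp add: mult.commute)
  show ?thesis
    by (auto simp: qp_coeff_def g coeff_monom_mult)
qed

subsection \<open>Growth\<close>

lemma poly_asymptotics:
  fixes P :: "real poly"
  assumes "degree P \<le> D"
  shows "((\<lambda>x. poly P x / x ^ D) \<longlongrightarrow> coeff P D) at_top"
proof -
  have poly: "poly P x = (\<Sum>i\<le>D. coeff P i * x ^ i)" for x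
    unfolding poly_altdef using assms
    by (intro sum.mono_neutral_left) (auto simp: coeff_eq_0)
  have monomial: "((\<lambda>x. coeff P i * x ^ i / x ^ D) \<longlongrightarrow> (if i = D then coeff P D else 0)) at_top"
    if "i \<le> D" for i
  proof (cases "i = D")
    case True
    have "eventually (\<lambda>x::real. coeff P D * x ^ D / x ^ D = coeff P D) at_top"
      using eventually_gt_at_top[of 0] by eventually_elim simp
    then have "((\<lambda>x. coeff P D * x ^ D / x ^ D) \<longlongrightarrow> coeff P D) at_top"
      by (intro tendsto_eventually) (auto elim: eventually_mono)
    then show ?thesis using True by simp
  next
    case False
    have "filterlim (\<lambda>x::real. x ^ (D - i)) at_infinity at_top"
      using False that
      by (intro filterlim_at_top_imp_at_infinity filterlim_pow_at_top filterlim_ident) auto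
    then have "((\<lambda>x. coeff P i / x ^ (D - i)) \<longlongrightarrow> 0) at_top"
      by (intro tendsto_divide_0[OF tendsto_const])
    moreover have "eventually (\<lambda>x. coeff P i / x ^ (D - i) = coeff P i * x ^ i / x ^ D) at_top"
      using eventually_gt_at_top[of 0]
    proof eventually_elim
      case (elim x)
      have "x ^ D = x ^ i * x ^ (D - i)" using that by (simp flip: power_add)
      then show ?case using elim by simp
    qed
    ultimately have "((\<lambda>x. coeff P i * x ^ i / x ^ D) \<longlongrightarrow> 0) at_top"
      by (rule Lim_transform_eventually)
    then show ?thesis using False by simp
  qed
  have "((\<lambda>x. \<Sum>i\<le>D. coeff P i * x ^ i / x ^ D) \<longlongrightarrow> (\<Sum>i\<le>D. if i = D then coeff P D else 0)) at_top"
    by (intro tendsto_sum monomial) simp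
  then show ?thesis
    by (simp add: poly sum_divide_distrib)
qed

lemma filterlim_arith_progression:
  assumes "T > 0"
  shows "filterlim (\<lambda>k. real (n + k * T)) at_top sequentially"
proof -
  have "filterlim (\<lambda>k::nat. n + k * T) at_top sequentially"
    using assms by (intro filterlim_subseq) (auto simp: strict_mono_def)
  then show ?thesis by (rule filterlim_compose[OF filterlim_real_sequentially])
qed

lemma constituents_asymptotics:
  assumes "has_constituents f p" "degree (p n) \<le> D"
  obtains T where "T > 0" "\<And>n. p (n + T) = p n"
    "(\<lambda>k. f (n + k * T) / real (n + k * T) ^ D) \<longlonglongrightarrow> coeff (p n) D"
proof -
  obtain T where T: "T > 0" "\<And>n. p (n + T) = p n" "\<And>n. n \<ge> 1 \<Longrightarrow> f n = poly (p n) (real n)"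
    using assms(1) unfolding has_constituents_def by blast
  have "(\<lambda>k. poly (p n) (real (n + k * T)) / real (n + k * T) ^ D) \<longlonglongrightarrow> coeff (p n) D"
    using filterlim_compose[OF poly_asymptotics[OF assms(2)] filterlim_arith_progression[OF T(1), of n]] .
  moreover have "eventually (\<lambda>k. poly (p n) (real (n + k * T)) / real (n + k * T) ^ D =
      f (n + k * T) / real (n + k * T) ^ D) sequentially"
    using eventually_ge_at_top[of 1]
  proof eventually_elim
    case (elim k)
    then have "n + k * T \<ge> 1" using T(1) by (simp add: Suc_le_eq)
    then show ?case using T(3)[of "n + k * T"] periodic_mult[of p T n k] T(2) by simp
  qed
  ultimately have "(\<lambda>k. f (n + k * T) / real (n + k * T) ^ D) \<longlonglongrightarrow> coeff (p n) D"
    by (rule Lim_transform_eventually)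
  then show ?thesis using that T by blast
qed

lemma tendsto_const_over_nat:
  assumes "T > 0"
  shows "(\<lambda>k. C / real (n + k * T)) \<longlonglongrightarrow> 0"
  by (intro tendsto_divide_0[OF tendsto_const] filterlim_at_top_imp_at_infinity
        filterlim_arith_progression assms)

text \<open>Along its residue class a constituent of larger degree would outgrow the bound.\<close>

lemma degree_constituents_le:
  assumes "has_constituents f p" "\<And>n. n \<ge> 1 \<Longrightarrow> \<bar>f n\<bar> \<le> C * real n ^ D"
  shows "degree (p n) \<le> D"
proof (rule ccontr)
  assume "\<not> degree (p n) \<le> D"
  then obtain e where e: "degree (p n) = Suc (D + e)"
    by (metis add_Suc_right less_iff_Suc_add not_le)
  obtain T where T: "T > 0"
    "(\<lambda>k. f (n + k * T) / real (n + k * T) ^ degree (p n)) \<longlonglongrightarrow> coeff (p n) (degree (p n))"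
    using constituents_asymptotics[OF assms(1)] by (metis order_refl)
  have "(\<lambda>k. f (n + k * T) / real (n + k * T) ^ degree (p n)) \<longlonglongrightarrow> 0"
  proof (rule Lim_null_comparison[OF _ tendsto_const_over_nat[OF T(1), of C n]])
    show "eventually (\<lambda>k. norm (f (n + k * T) / real (n + k * T) ^ degree (p n))
        \<le> C / real (n + k * T)) sequentially"
      using eventually_ge_at_top[of 1]
    proof eventually_elim
      case (elim k)
      define m where "m = n + k * T"
      have m: "m \<ge> 1" using elim T(1) by (simp add: m_def Suc_le_eq)
      have "\<bar>f 1\<bar> \<le> C" using assms(2)[of 1] by simp
      then have C: "C \<ge> 0" by linarith
      have "\<bar>f m\<bar> * real m \<le> C * real m ^ D * real m"
        using assms(2)[OF m] by (intro mult_right_mono) auto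
      also have "\<dots> \<le> C * real m ^ degree (p n)"
        using m C power_increasing[of "Suc D" "degree (p n)" "real m"] e
        by (simp add: mult.assoc mult_left_mono)
      finally have "\<bar>f m\<bar> / real m ^ degree (p n) \<le> C / real m"
        using m by (simp add: field_simps)
      then show ?case by (simp only: m_def real_norm_def abs_divide power_abs abs_of_nat)
    qed
  qed
  then have "lead_coeff (p n) = 0" using T(2) LIMSEQ_unique by blast
  then show False using e by (metis degree_0 leading_coeff_0_iff nat.distinct(1))
qed

text \<open>The limits of \<open>f n / n\<^bsup>D+1\<^esup>\<close> along two neighbouring residue classes are the leading
  coefficients of the two constituents; these quotients differ by terms \<open>O(1/n)\<close>.\<close>

lemma leading_coeff_constituents_const:
  assumes p: "has_constituents f p" and deg: "\<And>n. degree (p n) \<le> Suc D"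
    and diff: "\<And>n. \<bar>f (Suc n) - f n\<bar> \<le> C * real (Suc n) ^ D"
  shows "coeff (p n) (Suc D) = coeff (p n') (Suc D)"
proof -
  have step: "coeff (p (Suc n)) (Suc D) = coeff (p n) (Suc D)" for n
  proof -
    obtain T where T: "T > 0" "\<And>n. p (n + T) = p n"
      "(\<lambda>k. f (n + k * T) / real (n + k * T) ^ Suc D) \<longlonglongrightarrow> coeff (p n) (Suc D)"
      by (rule constituents_asymptotics[OF p deg[of n]]) blast
    obtain T' where T': "T' > 0" "\<And>n. p (n + T') = p n"
      "(\<lambda>k. f (Suc n + k * T') / real (Suc n + k * T') ^ Suc D) \<longlonglongrightarrow> coeff (p (Suc n)) (Suc D)"
      by (rule constituents_asymptotics[OF p deg[of "Suc n"]]) blast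
    define m where "m k = n + k * (T * T')" for k
    have sub: "strict_mono (\<lambda>k. k * T)" "strict_mono (\<lambda>k. k * T')"
      using T(1) T'(1) by (auto simp: strict_mono_def)
    have l1: "(\<lambda>k. f (m k) / real (m k) ^ Suc D) \<longlonglongrightarrow> coeff (p n) (Suc D)"
      using LIMSEQ_subseq_LIMSEQ[OF T(3) sub(2)] by (simp add: m_def o_def mult_ac)
    have l2: "(\<lambda>k. f (Suc (m k)) / real (Suc (m k)) ^ Suc D) \<longlonglongrightarrow> coeff (p (Suc n)) (Suc D)"
      using LIMSEQ_subseq_LIMSEQ[OF T'(3) sub(1)] by (simp add: m_def o_def mult_ac)
    have TT: "T * T' > 0" using T T' by simp
    have r: "(\<lambda>k. real (Suc (m k)) / real (m k)) \<longlonglongrightarrow> 1"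
    proof (rule Lim_transform_eventually)
      show "(\<lambda>k. 1 + 1 / real (m k)) \<longlonglongrightarrow> 1"
        using tendsto_add[OF tendsto_const[of 1] tendsto_const_over_nat[OF TT, of 1 n]]
        by (simp add: m_def)
      show "eventually (\<lambda>k. 1 + 1 / real (m k) = real (Suc (m k)) / real (m k)) sequentially"
        using eventually_ge_at_top[of 1]
      proof eventually_elim
        case (elim k)
        then have "m k > 0" using TT by (simp add: m_def)
        then show ?case by (simp add: add_divide_distrib)
      qed
    qed
    have l3: "(\<lambda>k. f (Suc (m k)) / real (m k) ^ Suc D) \<longlonglongrightarrow> coeff (p (Suc n)) (Suc D)"
    proof (rule Lim_transform_eventually)
      show "(\<lambda>k. f (Suc (m k)) / real (Suc (m k)) ^ Suc D * (real (Suc (m k)) / real (m k)) ^ Suc D)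
          \<longlonglongrightarrow> coeff (p (Suc n)) (Suc D)"
        using tendsto_mult[OF l2 tendsto_power[OF r, of "Suc D"]] by simp
      show "eventually (\<lambda>k. f (Suc (m k)) / real (Suc (m k)) ^ Suc D * (real (Suc (m k)) / real (m k)) ^ Suc D
          = f (Suc (m k)) / real (m k) ^ Suc D) sequentially"
        by (simp add: power_divide del: power_Suc of_nat_Suc)
    qed
    have "(\<lambda>k. f (Suc (m k)) / real (m k) ^ Suc D - f (m k) / real (m k) ^ Suc D) \<longlonglongrightarrow> 0"
    proof (rule Lim_null_comparison)
      show "(\<lambda>k. C / real (m k) * (real (Suc (m k)) / real (m k)) ^ D) \<longlonglongrightarrow> 0"
        using tendsto_mult[OF tendsto_const_over_nat[OF TT, of C n] tendsto_power[OF r, of D]]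
        by (simp add: m_def)
      show "eventually (\<lambda>k. norm (f (Suc (m k)) / real (m k) ^ Suc D - f (m k) / real (m k) ^ Suc D)
          \<le> C / real (m k) * (real (Suc (m k)) / real (m k)) ^ D) sequentially"
      proof (rule always_eventually, rule allI)
        fix k
        have "\<bar>f (Suc (m k)) - f (m k)\<bar> / real (m k) ^ Suc D \<le> C * real (Suc (m k)) ^ D / real (m k) ^ Suc D"
          using diff by (intro divide_right_mono) auto
        then show "norm (f (Suc (m k)) / real (m k) ^ Suc D - f (m k) / real (m k) ^ Suc D)
          \<le> C / real (m k) * (real (Suc (m k)) / real (m k)) ^ D"
          by (simp add: diff_divide_distrib[symmetric] power_divide abs_divide mult.assoc del: of_nat_Suc)
      qed
    qed
    then have "coeff (p (Suc n)) (Suc D) - coeff (p n) (Suc D) = 0"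
      using tendsto_diff[OF l3 l1] LIMSEQ_unique by blast
    then show ?thesis by simp
  qed
  have "coeff (p n) (Suc D) = coeff (p 0) (Suc D)" for n
    by (induction n) (simp_all add: step)
  then show ?thesis by metis
qed

subsection \<open>Periods\<close>

text \<open>The remainder of a period modulo the smallest one would again be a period.\<close>

lemma min_period_dvd:
  fixes g :: "nat \<Rightarrow> 'a"
  assumes "T > 0" "\<And>n. g (n + T) = g n"
  shows "min_period g dvd T"
proof -
  define P where "P T \<longleftrightarrow> T > 0 \<and> (\<forall>n. g (n + T) = g n)" for T
  have m: "P (min_period g)" "\<And>T. P T \<Longrightarrow> min_period g \<le> T"
    unfolding min_period_def P_def[symmetric]
    using LeastI[of P T] Least_le[of P] assms P_def by auto
  let ?s = "min_period g"
  have "g (n + T mod ?s) = g n" for n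
  proof -
    have "g (n + T mod ?s) = g ((n + T mod ?s) + (T div ?s) * ?s)"
      using periodic_mult[of g ?s] m(1) P_def by metis
    also have "\<dots> = g (n + T)" by (simp add: add.assoc)
    finally show ?thesis using assms by simp
  qed
  then have "T mod ?s = 0"
    using m P_def by (metis gr0I mod_less_divisor not_le)
  then show ?thesis by auto
qed

lemma min_period_periodic:
  fixes g :: "nat \<Rightarrow> 'a"
  assumes "T > 0" "\<And>n. g (n + T) = g n"
  shows "min_period g > 0" "g (n + min_period g) = g n"
proof -
  have "min_period g > 0 \<and> (\<forall>n. g (n + min_period g) = g n)"
    unfolding min_period_def by (rule LeastI[of _ T]) (use assms in auto)
  then show "min_period g > 0" "g (n + min_period g) = g n" by auto
qed

lemma common_period:
  assumes "finite A" "\<forall>a\<in>A. \<exists>T>0. \<forall>n. g a (n + T) = g a (n :: nat)"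
  shows "\<exists>T>0. \<forall>a\<in>A. \<forall>n. g a (n + T) = g a n"
  using assms
proof induction
  case (insert b A)
  then obtain T T' where T: "T > 0" "\<forall>a\<in>A. \<forall>n. g a (n + T) = g a n" "T' > 0" "\<forall>n. g b (n + T') = g b n"
    by auto
  have "g a (n + T * T') = g a n" if "a \<in> insert b A" for a n
  proof (cases "a = b")
    case True
    then show ?thesis using periodic_mult[of "g b" T' n T] T(4) by simp
  next
    case False
    then show ?thesis using periodic_mult[of "g a" T n T'] T(2) that by (simp add: mult.commute)
  qed
  then show ?case using T(1,3) by (intro exI[of _ "T * T'"]) simp
qed (auto intro: exI[of _ 1])

section \<open>Counting lattice points of rational cones\<close>

subsection \<open>Quasipolynomials of an integer argument\<close>

definition int_quasipoly :: "(int \<Rightarrow> real) \<Rightarrow> bool" where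
  "int_quasipoly g \<longleftrightarrow> (\<exists>N>0. \<exists>p. \<forall>m. g m = poly (p (m mod N)) (of_int m))"

lemma int_quasipolyI:
  "N > 0 \<Longrightarrow> (\<And>m. g m = poly (p (m mod N)) (of_int m)) \<Longrightarrow> int_quasipoly g"
  unfolding int_quasipoly_def by blast

lemma int_quasipoly_poly: "int_quasipoly (\<lambda>m. poly P (of_int m))"
  by (rule int_quasipolyI[of 1 _ "\<lambda>_. P"]) auto

lemma int_quasipoly_const: "int_quasipoly (\<lambda>_. c)"
  using int_quasipoly_poly[of "[:c:]"] by simp

lemma int_quasipoly_of_int: "int_quasipoly of_int"
  using int_quasipoly_poly[of "[:0, 1:]"] by simp

lemma int_quasipoly_residue:
  assumes "N > 0"
  shows "int_quasipoly (\<lambda>m. of_bool (m mod N = r))"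
  by (rule int_quasipolyI[OF assms, of _ "\<lambda>s. [:of_bool (s = r):]"]) auto

lemma int_quasipoly_binop:
  assumes "int_quasipoly f" "int_quasipoly g"
    and "\<And>P P' x. poly (F P P') x = G (poly P x) (poly P' x)"
  shows "int_quasipoly (\<lambda>m. G (f m) (g m))"
proof -
  obtain N p where p: "N > 0" "\<And>m. f m = poly (p (m mod N)) (of_int m)"
    using assms(1) unfolding int_quasipoly_def by blast
  obtain N' p' where p': "N' > 0" "\<And>m. g m = poly (p' (m mod N')) (of_int m)"
    using assms(2) unfolding int_quasipoly_def by blast
  show ?thesis
  proof (rule int_quasipolyI)
    show "N * N' > 0" using p p' by simp
    show "G (f m) (g m) = poly (F (p (m mod (N * N') mod N)) (p' (m mod (N * N') mod N'))) (of_int m)" for m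
      by (simp add: p(2) p'(2) assms(3) mod_mod_cancel)
  qed
qed

lemma int_quasipoly_add: "int_quasipoly f \<Longrightarrow> int_quasipoly g \<Longrightarrow> int_quasipoly (\<lambda>m. f m + g m)"
  by (rule int_quasipoly_binop[where F = "(+)"]) simp_all

lemma int_quasipoly_mult: "int_quasipoly f \<Longrightarrow> int_quasipoly g \<Longrightarrow> int_quasipoly (\<lambda>m. f m * g m)"
  by (rule int_quasipoly_binop[where F = "(*)"]) simp_all

lemma int_quasipoly_sum:
  "finite A \<Longrightarrow> (\<And>a. a \<in> A \<Longrightarrow> int_quasipoly (f a)) \<Longrightarrow> int_quasipoly (\<lambda>m. \<Sum>a\<in>A. f a m)"
  by (induction A rule: finite_induct) (auto intro: int_quasipoly_const int_quasipoly_add)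

lemma int_quasipoly_scaled:
  assumes "int_quasipoly g"
  shows "int_quasipoly (\<lambda>m. g (b * m))"
proof -
  obtain N p where p: "N > 0" "\<And>m. g m = poly (p (m mod N)) (of_int m)"
    using assms unfolding int_quasipoly_def by blast
  show ?thesis
    by (rule int_quasipolyI[OF p(1), of _ "\<lambda>s. pcompose (p (b * s mod N)) [:0, of_int b:]"])
      (simp add: p(2) poly_pcompose mod_mult_right_eq mult.commute)
qed

text \<open>On a residue class of \<open>m\<close> modulo \<open>b N\<close> the quotient is an affine function of \<open>m\<close> and has a constant
  residue modulo \<open>N\<close>. Bounds of summation ranges are rounded quotients of linear forms, and this lemma
  lets them be substituted into a quasipolynomial.\<close>

lemma int_quasipoly_div:
  assumes "int_quasipoly g" "b > 0"
  shows "int_quasipoly (\<lambda>m. g ((m - c) div b))"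
proof -
  obtain N p where p: "N > 0" "\<And>m. g m = poly (p (m mod N)) (of_int m)"
    using assms unfolding int_quasipoly_def by blast
  define p' where "p' s = pcompose (p ((s - c) div b mod N))
    [:- ((of_int c + of_int ((s - c) mod b)) / of_int b), 1 / of_int b:]" for s
  show ?thesis
  proof (rule int_quasipolyI)
    show "b * N > 0" using p assms by simp
    fix m
    define s where "s = m mod (b * N)"
    define k where "k = m div (b * N)"
    have "m = b * N * k + s" by (simp add: s_def k_def)
    then have ms: "m - c = b * (N * k) + (s - c)" by simp
    have d: "(m - c) div b = N * k + (s - c) div b" and r: "(m - c) mod b = (s - c) mod b"
      using assms(2) unfolding ms by simp_all
    have "b * ((m - c) div b) = m - c - (m - c) mod b"
      by (metis minus_mod_eq_mult_div)
    then have "real_of_int b * of_int ((m - c) div b) = of_int m - of_int c - of_int ((s - c) mod b)"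
      unfolding r[symmetric] by (metis of_int_diff of_int_mult)
    then have "real_of_int ((m - c) div b)
        = - ((of_int c + of_int ((s - c) mod b)) / of_int b) + of_int m * (1 / of_int b)"
      using assms(2) by (simp add: field_simps)
    moreover have "(m - c) div b mod N = (s - c) div b mod N" by (simp add: d)
    ultimately show "g ((m - c) div b) = poly (p' (m mod (b * N))) (of_int m)"
      by (simp add: p'_def poly_pcompose p(2) s_def[symmetric])
  qed
qed

text \<open>By induction on the exponent: up to lower powers, \<open>x\<^sup>n\<close> is the difference of \<open>x\<^bsup>n+1\<^esup>/(n+1)\<close>.\<close>

lemma poly_antidifference: "\<exists>R :: real poly. \<forall>x. poly R x - poly R (x - 1) = poly P x"
proof -
  have monom: "\<exists>R :: real poly. \<forall>x. poly R x - poly R (x - 1) = x ^ n" for n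
  proof (induction n rule: less_induct)
    case (less n)
    then have "\<exists>R :: nat \<Rightarrow> real poly. \<forall>k<n. \<forall>x. poly (R k) x - poly (R k) (x - 1) = x ^ k"
      by metis
    then obtain R :: "nat \<Rightarrow> real poly" where R: "\<And>k x. k < n \<Longrightarrow> poly (R k) x - poly (R k) (x - 1) = x ^ k"
      by blast
    define c :: "nat \<Rightarrow> real" where "c k = real (Suc n choose k) * (-1) ^ (Suc n - k)" for k
    define S where "S = smult (1 / real (Suc n)) (monom 1 (Suc n) + (\<Sum>k<n. smult (c k) (R k)))"
    have "poly S x - poly S (x - 1) = x ^ n" for x
    proof -
      have "(x - 1) ^ Suc n = (\<Sum>k\<le>Suc n. c k * x ^ k)"
        using binomial_ring[of x "-1" "Suc n"] by (simp add: c_def mult_ac)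
      also have "\<dots> = (\<Sum>k<n. c k * x ^ k) + c n * x ^ n + c (Suc n) * x ^ Suc n"
        by (simp add: lessThan_Suc_atMost[symmetric])
      finally have "x ^ Suc n - (x - 1) ^ Suc n + (\<Sum>k<n. c k * x ^ k) = real (Suc n) * x ^ n"
        by (simp add: c_def algebra_simps)
      moreover have "(\<Sum>k<n. c k * poly (R k) x) - (\<Sum>k<n. c k * poly (R k) (x - 1)) = (\<Sum>k<n. c k * x ^ k)"
        by (simp add: sum_subtractf[symmetric] right_diff_distrib[symmetric] R)
      moreover have "poly S x - poly S (x - 1) = (x ^ Suc n - (x - 1) ^ Suc n +
          ((\<Sum>k<n. c k * poly (R k) x) - (\<Sum>k<n. c k * poly (R k) (x - 1)))) / real (Suc n)"
        unfolding S_def by (simp add: poly_monom poly_sum field_simps del: power_Suc of_nat_Suc)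
      ultimately show ?thesis by simp
    qed
    then show ?case by blast
  qed
  then obtain R :: "nat \<Rightarrow> real poly" where R: "\<And>n x. poly (R n) x - poly (R n) (x - 1) = x ^ n"
    by metis
  show ?thesis
  proof (intro exI[of _ "\<Sum>i\<le>degree P. smult (coeff P i) (R i)"] allI)
    fix x
    show "poly (\<Sum>i\<le>degree P. smult (coeff P i) (R i)) x - poly (\<Sum>i\<le>degree P. smult (coeff P i) (R i)) (x - 1) = poly P x"
      by (simp add: poly_sum sum_subtractf[symmetric] right_diff_distrib[symmetric] R poly_altdef[of P])
  qed
qed

text \<open>It is enough to sum over one residue class \<open>r + N \<int>\<close> at a time, and there the sum up to \<open>m\<close> is a
  polynomial in the number \<open>(m - r) div N\<close> of steps taken.\<close>

lemma int_quasipoly_antidifference: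
  assumes "int_quasipoly h"
  obtains F where "int_quasipoly F" "\<And>m. F m - F (m - 1) = h m"
proof -
  obtain N p where p: "N > 0" "\<And>m. h m = poly (p (m mod N)) (of_int m)"
    using assms unfolding int_quasipoly_def by blast
  obtain R where R: "\<And>r x. poly (R r) x - poly (R r) (x - 1)
      = poly (pcompose (p r) [:of_int r, of_int N:]) x"
    using poly_antidifference[of "pcompose (p r) [:of_int r, of_int N:]" for r] by metis
  define F where "F m = (\<Sum>r\<in>{0..<N}. poly (R r) (of_int ((m - r) div N)))" for m
  have "int_quasipoly F"
    unfolding F_def
    by (intro int_quasipoly_sum int_quasipoly_div[where g = "\<lambda>m. poly P (of_int m)" for P] int_quasipoly_poly p) simp
  moreover have "F m - F (m - 1) = h m" for m
  proof -
    have step: "poly (R r) (of_int ((m - r) div N)) - poly (R r) (of_int ((m - 1 - r) div N)) =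
        (if r = m mod N then h m else 0)" if r: "r \<in> {0..<N}" for r
    proof (cases "r = m mod N")
      case True
      define k where "k = m div N"
      have m: "m = N * k + r" by (simp add: k_def True)
      have e0: "(m - r) div N = k" using p(1) m by simp
      have e1: "(m - 1 - r) div N = k - 1"
      proof -
        have e: "m - 1 - r = N * (k - 1) + (N - 1)" by (simp add: m algebra_simps)
        show ?thesis unfolding e using p(1) by (simp add: div_pos_pos_trivial)
      qed
      have "h m = poly (p r) (of_int N * of_int k + of_int r)"
        using p(2)[of m] True m by (metis of_int_add of_int_mult)
      then show ?thesis unfolding e0 e1 of_int_diff of_int_1 R using True
        by (simp add: poly_pcompose algebra_simps)
    next
      case False
      have "(m - r) div N = (m - 1 - r) div N"
      proof -
        define k where "k = (m - r) div N"
        define s where "s = (m - r) mod N"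
        have s: "0 \<le> s" "s < N" "m - r = N * k + s" using p(1) by (simp_all add: s_def k_def)
        have "s \<noteq> 0"
        proof
          assume "s = 0"
          then have "m = r + N * k" using s by simp
          then have "m mod N = r" using r by simp
          then show False using False by simp
        qed
        then have e: "m - 1 - r = N * k + (s - 1)" "0 \<le> s - 1" "s - 1 < N" using s by auto
        have "(m - 1 - r) div N = k" unfolding e(1) using e p(1) by simp
        then show ?thesis by (simp add: k_def)
      qed
      then show ?thesis using False by simp
    qed
    have "F m - F (m - 1) = (\<Sum>r\<in>{0..<N}. if r = m mod N then h m else 0)"
      unfolding F_def sum_subtractf[symmetric] by (intro sum.cong refl step)
    then show ?thesis using p(1) by simp
  qed
  ultimately show ?thesis using that by blast
qed

lemma sum_telescope_int:
  fixes F :: "int \<Rightarrow> real"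
  assumes "\<And>m. F m - F (m - 1) = h m" "a \<le> b"
  shows "(\<Sum>x\<in>{a<..b}. h x) = F b - F a"
  using assms(2)
proof (induction rule: int_ge_induct)
  case (step i)
  have "{a<..i + 1} = insert (i + 1) {a<..i}" using step by auto
  then show ?case using step assms(1)[of "i + 1"] by simp
qed simp

subsection \<open>Piecewise quasipolynomial functions\<close>

inductive_set linear_forms :: "(('v \<Rightarrow> int) \<Rightarrow> int) set" where
  zero: "(\<lambda>e. 0) \<in> linear_forms"
| var: "(\<lambda>e. e v) \<in> linear_forms"
| add: "L \<in> linear_forms \<Longrightarrow> L' \<in> linear_forms \<Longrightarrow> (\<lambda>e. L e + L' e) \<in> linear_forms"
| scale: "L \<in> linear_forms \<Longrightarrow> (\<lambda>e. c * L e) \<in> linear_forms"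

lemma linear_forms_diff:
  "L \<in> linear_forms \<Longrightarrow> L' \<in> linear_forms \<Longrightarrow> (\<lambda>e. L e - L' e) \<in> linear_forms"
  using linear_forms.add[of L "\<lambda>e. (-1) * L' e"] linear_forms.scale[of L' "-1"] by simp

text \<open>Sums of products of quasipolynomials and indicators of homogeneous half-spaces in finitely many
  integer variables. Only homogeneous conditions occur, so a function of a single positive variable
  in this class has no exceptional initial values; this is what makes the counting functions
  quasipolynomials for all \<open>n \<ge> 1\<close> and not just for large \<open>n\<close>.\<close>

inductive_set pqp :: "(('v \<Rightarrow> int) \<Rightarrow> real) set" where
  qp: "L \<in> linear_forms \<Longrightarrow> int_quasipoly g \<Longrightarrow> (\<lambda>e. g (L e)) \<in> pqp"
| nonneg: "L \<in> linear_forms \<Longrightarrow> (\<lambda>e. of_bool (0 \<le> L e)) \<in> pqp"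
| add: "f \<in> pqp \<Longrightarrow> g \<in> pqp \<Longrightarrow> (\<lambda>e. f e + g e) \<in> pqp"
| mult: "f \<in> pqp \<Longrightarrow> g \<in> pqp \<Longrightarrow> (\<lambda>e. f e * g e) \<in> pqp"

lemma pqp_const: "(\<lambda>e. c) \<in> pqp"
  using pqp.qp[OF linear_forms.zero int_quasipoly_const[of c]] .

lemma pqp_diff: "f \<in> pqp \<Longrightarrow> g \<in> pqp \<Longrightarrow> (\<lambda>e. f e - g e) \<in> pqp"
  using pqp.add[of f "\<lambda>e. (-1) * g e"] pqp.mult[OF pqp_const[of "-1"], of g] by simp

lemma pqp_not: "(\<lambda>e. of_bool (C e)) \<in> pqp \<Longrightarrow> (\<lambda>e. of_bool (\<not> C e)) \<in> pqp"
  using pqp_diff[OF pqp_const[of 1], of "\<lambda>e. of_bool (C e)"] by (simp add: of_bool_not_iff)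

lemma pqp_conj:
  "(\<lambda>e. of_bool (C e)) \<in> pqp \<Longrightarrow> (\<lambda>e. of_bool (D e)) \<in> pqp \<Longrightarrow> (\<lambda>e. of_bool (C e \<and> D e)) \<in> pqp"
  using pqp.mult[of "\<lambda>e. of_bool (C e)" "\<lambda>e. of_bool (D e)"] by (simp add: of_bool_conj)

lemma pqp_le: "L \<in> linear_forms \<Longrightarrow> L' \<in> linear_forms \<Longrightarrow> (\<lambda>e. of_bool (L e \<le> L' e)) \<in> pqp"
  using pqp.nonneg[OF linear_forms_diff[of L' L]] by simp

lemma pqp_less: "L \<in> linear_forms \<Longrightarrow> L' \<in> linear_forms \<Longrightarrow> (\<lambda>e. of_bool (L e < L' e)) \<in> pqp"
  using pqp_not[OF pqp_le[of L' L]] by (simp add: not_le)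

lemma pqp_eq: "L \<in> linear_forms \<Longrightarrow> L' \<in> linear_forms \<Longrightarrow> (\<lambda>e. of_bool (L e = L' e)) \<in> pqp"
  using pqp_conj[OF pqp_le[of L L'] pqp_le[of L' L]] by (simp add: order_eq_iff)

lemma pqp_prod: "finite A \<Longrightarrow> (\<And>a. a \<in> A \<Longrightarrow> f a \<in> pqp) \<Longrightarrow> (\<lambda>e. \<Prod>a\<in>A. f a e) \<in> pqp"
  by (induction A rule: finite_induct) (auto intro: pqp_const pqp.mult)


subsection \<open>Summation over one variable\<close>

definition indep :: "'v \<Rightarrow> (('v \<Rightarrow> int) \<Rightarrow> 'a) \<Rightarrow> bool" where
  "indep k f \<longleftrightarrow> (\<forall>e x. f (e(k := x)) = f e)"

lemma linear_form_split:
  assumes "L \<in> linear_forms"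
  obtains b L0 where "L0 \<in> linear_forms" "indep k L0" "\<And>e. L e = b * e k + L0 e"
proof -
  from assms have "\<exists>b L0. L0 \<in> linear_forms \<and> indep k L0 \<and> (\<forall>e. L e = b * e k + L0 e)"
  proof induction
    case zero
    show ?case by (rule exI[of _ 0], rule exI[of _ "\<lambda>_. 0"]) (simp add: linear_forms.zero indep_def)
  next
    case (var v)
    show ?case
    proof (cases "v = k")
      case True
      then show ?thesis
        by (intro exI[of _ 1] exI[of _ "\<lambda>_. 0"]) (simp add: linear_forms.zero indep_def)
    next
      case False
      then show ?thesis
        by (intro exI[of _ 0] exI[of _ "\<lambda>e. e v"]) (simp add: linear_forms.var indep_def)
    qed
  next
    case (add L L')
    then obtain b L0 b' L0' where "L0 \<in> linear_forms" "indep k L0" "\<And>e. L e = b * e k + L0 e"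
      "L0' \<in> linear_forms" "indep k L0'" "\<And>e. L' e = b' * e k + L0' e" by blast
    then show ?case
      by (intro exI[of _ "b + b'"] exI[of _ "\<lambda>e. L0 e + L0' e"])
        (simp add: linear_forms.add indep_def algebra_simps)
  next
    case (scale L c)
    then obtain b L0 where "L0 \<in> linear_forms" "indep k L0" "\<And>e. L e = b * e k + L0 e" by blast
    then show ?case
      by (intro exI[of _ "c * b"] exI[of _ "\<lambda>e. c * L0 e"])
        (simp add: linear_forms.scale indep_def algebra_simps)
  qed
  then show ?thesis using that by blast
qed

text \<open>The ways in which a half-space can bound a variable \<open>x\<close> from below, or no bound. Upper bounds are complements.
  Strict and weak bounds are kept apart, since turning \<open><\<close> into \<open>\<le>\<close> by adding \<open>1\<close> would not be homogeneous.\<close>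

inductive lower_bound :: "'v \<Rightarrow> (('v \<Rightarrow> int) \<Rightarrow> int \<Rightarrow> bool) \<Rightarrow> bool" for k where
  trivial: "lower_bound k (\<lambda>e x. True)"
| bound: "L \<in> linear_forms \<Longrightarrow> indep k L \<Longrightarrow> b > 0 \<Longrightarrow>
    lower_bound k (\<lambda>e x. if strict then L e < b * x else L e \<le> b * x)"

text \<open>Of two lower bounds on \<open>x\<close> one implies the other, and which one does is decided by comparing two linear
  forms in the remaining variables. So products of indicators of lower bounds reduce to a single one.\<close>

lemma lower_bounds_conj:
  assumes "lower_bound k B" "lower_bound k B'"
  obtains C where "(\<lambda>e. of_bool (C e)) \<in> pqp" "indep k C"
    "\<And>e x. (B e x \<and> B' e x) = (if C e then B e x else B' e x)"
  using assms(1)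
proof (cases rule: lower_bound.cases)
  case trivial
  show ?thesis using that[of "\<lambda>_. False"] by (simp add: trivial indep_def pqp_const)
next
  case B: (bound L b s)
  show ?thesis using assms(2)
  proof (cases rule: lower_bound.cases)
    case trivial
    show ?thesis using that[of "\<lambda>_. True"] by (simp add: trivial indep_def pqp_const)
  next
    case B': (bound L' b' s')
    have bL: "(\<lambda>e. b' * L e) \<in> linear_forms" "(\<lambda>e. b * L' e) \<in> linear_forms"
      using B B' by (auto intro: linear_forms.scale)
    have bb: "b * x * b' = b' * x * b" for x by simp
    show ?thesis
    proof (cases s)
      case True
      have "(L e < b * x \<and> (if s' then L' e < b' * x else L' e \<le> b' * x)) =
        (if b * L' e \<le> b' * L e then L e < b * x else (if s' then L' e < b' * x else L' e \<le> b' * x))" for e x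
      proof (cases "b * L' e \<le> b' * L e")
        case le: True
        have "L' e < b' * x" if "L e < b * x"
        proof -
          have "b' * L e < b' * (b * x)" using that B'(4) by simp
          then have "b * L' e < b * (b' * x)" using le by (simp add: mult_ac)
          then show ?thesis using B(4) by simp
        qed
        then show ?thesis using le by auto
      next
        case lt: False
        have "L e < b * x" if "L' e \<le> b' * x"
        proof -
          have "b * L' e \<le> b * (b' * x)" using that B(4) by simp
          then have "b' * L e < b' * (b * x)" using lt by (simp add: mult_ac)
          then show ?thesis using B'(4) by simp
        qed
        then show ?thesis using lt by auto
      qed
      then show ?thesis
        using that[of "\<lambda>e. b * L' e \<le> b' * L e"] pqp_le[OF bL(2,1)] B B' True by (simp add: indep_def)
    next
      case False
      have "(L e \<le> b * x \<and> (if s' then L' e < b' * x else L' e \<le> b' * x)) =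
        (if b * L' e < b' * L e then L e \<le> b * x else (if s' then L' e < b' * x else L' e \<le> b' * x))" for e x
      proof (cases "b * L' e < b' * L e")
        case lt: True
        have "L' e < b' * x" if "L e \<le> b * x"
        proof -
          have "b' * L e \<le> b' * (b * x)" using that B'(4) by simp
          then have "b * L' e < b * (b' * x)" using lt by (simp add: mult_ac)
          then show ?thesis using B(4) by simp
        qed
        then show ?thesis using lt by auto
      next
        case le: False
        have "L e \<le> b * x" if "L' e \<le> b' * x"
        proof -
          have "b * L' e \<le> b * (b' * x)" using that B(4) by simp
          then have "b' * L e \<le> b' * (b * x)" using le by (simp add: mult_ac)
          then show ?thesis using B'(4) by simp
        qed
        then show ?thesis using le by auto
      qed
      then show ?thesis
        using that[of "\<lambda>e. b * L' e < b' * L e"] pqp_less[OF bL(2,1)] B B' False by (simp add: indep_def)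
    qed
  qed
qed

inductive_set normal_forms :: "'v \<Rightarrow> (('v \<Rightarrow> int) \<Rightarrow> real) set" for k where
  product: "P \<in> pqp \<Longrightarrow> indep k P \<Longrightarrow> int_quasipoly h \<Longrightarrow> lower_bound k B \<Longrightarrow>
    (\<lambda>e. P e * h (e k) * of_bool (B e (e k))) \<in> normal_forms k"
| add: "f \<in> normal_forms k \<Longrightarrow> g \<in> normal_forms k \<Longrightarrow> (\<lambda>e. f e + g e) \<in> normal_forms k"

lemma normal_forms_indep: "P \<in> pqp \<Longrightarrow> indep k P \<Longrightarrow> P \<in> normal_forms k"
  using normal_forms.product[OF _ _ int_quasipoly_const[of 1] lower_bound.trivial, of P k] by simp

lemma normal_forms_quasipoly: "int_quasipoly h \<Longrightarrow> (\<lambda>e. h (e k)) \<in> normal_forms k"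
  using normal_forms.product[OF pqp_const[of 1] _ _ lower_bound.trivial, of k h] by (simp add: indep_def)

lemma normal_forms_lower_bound: "lower_bound k B \<Longrightarrow> (\<lambda>e. of_bool (B e (e k))) \<in> normal_forms k"
  using normal_forms.product[OF pqp_const[of 1] _ int_quasipoly_const[of 1], of k B] by (simp add: indep_def)

lemma normal_forms_mult:
  assumes "f \<in> normal_forms k" "g \<in> normal_forms k"
  shows "(\<lambda>e. f e * g e) \<in> normal_forms k"
  using assms
proof (induction arbitrary: g)
  case f: (product P h B)
  show ?case using f(5)
  proof induction
    case g: (product P' h' B')
    obtain C where C: "(\<lambda>e. of_bool (C e)) \<in> pqp" "indep k C"
      "\<And>e x. (B e x \<and> B' e x) = (if C e then B e x else B' e x)"
      using lower_bounds_conj[OF f(4) g(4)] by blast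
    have hh: "int_quasipoly (\<lambda>m. h m * h' m)" using f g int_quasipoly_mult by blast
    have "(\<lambda>e. (P e * P' e * of_bool (C e)) * (h (e k) * h' (e k)) * of_bool (B e (e k)) +
      (P e * P' e * of_bool (\<not> C e)) * (h (e k) * h' (e k)) * of_bool (B' e (e k))) \<in> normal_forms k"
      by (intro normal_forms.add normal_forms.product[where h = "\<lambda>m. h m * h' m"] pqp.mult pqp_not C f g hh)
        (use f g C in \<open>simp_all add: indep_def\<close>)
    moreover have "P e * h (e k) * of_bool (B e (e k)) * (P' e * h' (e k) * of_bool (B' e (e k))) =
      (P e * P' e * of_bool (C e)) * (h (e k) * h' (e k)) * of_bool (B e (e k)) +
      (P e * P' e * of_bool (\<not> C e)) * (h (e k) * h' (e k)) * of_bool (B' e (e k))" for e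
      using C(3)[of e "e k"] by (cases "C e") (auto simp: of_bool_def)
    ultimately show ?case by simp
  next
    case (add g g')
    then show ?case
      using normal_forms.add[OF add.IH] by (simp add: distrib_left)
  qed
next
  case (add f f')
  then show ?case
    using normal_forms.add[of "\<lambda>e. f e * g e" k "\<lambda>e. f' e * g e"] by (simp add: distrib_right)
qed

lemma normal_forms_sum:
  "finite A \<Longrightarrow> (\<And>a. a \<in> A \<Longrightarrow> f a \<in> normal_forms k) \<Longrightarrow> (\<lambda>e. \<Sum>a\<in>A. f a e) \<in> normal_forms k"
  by (induction A rule: finite_induct)
    (auto intro: normal_forms.add normal_forms_indep pqp_const simp: indep_def)

lemma normal_forms_diff:
  "f \<in> normal_forms k \<Longrightarrow> g \<in> normal_forms k \<Longrightarrow> (\<lambda>e. f e - g e) \<in> normal_forms k"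
  using normal_forms.add[of f k "\<lambda>e. (-1) * g e"]
    normal_forms_mult[OF normal_forms_indep[OF pqp_const[of "-1"]], of k g]
  by (simp add: indep_def)

lemma normal_forms_poly_linear:
  assumes "L \<in> linear_forms"
  shows "(\<lambda>e. poly P (of_int (L e))) \<in> normal_forms k"
proof (induction P)
  case 0
  then show ?case by (simp add: normal_forms_indep pqp_const indep_def)
next
  case (pCons a P)
  obtain b L0 where L: "L0 \<in> linear_forms" "indep k L0" "\<And>e. L e = b * e k + L0 e"
    using linear_form_split[OF assms, of k] by blast
  have lin: "(\<lambda>e. of_int (b * e k) + of_int (L0 e) :: real) \<in> normal_forms k"
    using L(2) by (intro normal_forms.add normal_forms_indep pqp.qp[OF L(1)] int_quasipoly_of_int
        normal_forms_quasipoly[where h = "\<lambda>m. of_int (b * m)"] int_quasipoly_scaled)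
      (simp add: indep_def)
  have "(\<lambda>e. a) \<in> normal_forms k" by (intro normal_forms_indep pqp_const) (simp add: indep_def)
  from normal_forms.add[OF this normal_forms_mult[OF lin pCons(2)]]
  have "(\<lambda>e. a + (of_int (b * e k) + of_int (L0 e)) * poly P (of_int (L e))) \<in> normal_forms k" .
  then show ?case by (simp add: L(3))
qed

text \<open>A quasipolynomial of \<open>b x + L\<^sub>0\<close> splits according to the residues of \<open>x\<close> and \<open>L\<^sub>0\<close>, and a half-space is, depending
  on the sign of \<open>b\<close>, a lower bound on \<open>x\<close>, a condition without \<open>x\<close>, or the complement of a lower bound.\<close>

lemma pqp_normal_form:
  assumes "f \<in> pqp"
  shows "f \<in> normal_forms k"
  using assms
proof induction
  case (qp L g)
  obtain b L0 where L: "L0 \<in> linear_forms" "indep k L0" "\<And>e. L e = b * e k + L0 e"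
    using linear_form_split[OF qp(1), of k] by blast
  obtain N p where p: "N > 0" "\<And>m. g m = poly (p (m mod N)) (of_int m)"
    using qp(2) unfolding int_quasipoly_def by blast
  let ?g = "\<lambda>e. \<Sum>s\<in>{0..<N}. \<Sum>t\<in>{0..<N}. of_bool (e k mod N = s) * of_bool (L0 e mod N = t) *
      poly (p ((b * s + t) mod N)) (of_int (L e))"
  have "?g \<in> normal_forms k"
    using L(2) p(1)
    by (intro normal_forms_sum normal_forms_mult normal_forms_poly_linear qp(1) finite_atLeastLessThan_int
        normal_forms_quasipoly[where h = "\<lambda>m. of_bool (m mod N = s)" for s] int_quasipoly_residue
        normal_forms_indep pqp.qp[where g = "\<lambda>m. of_bool (m mod N = s)" for s, OF L(1)])
      (auto simp: indep_def)
  moreover have "g (L e) = ?g e" for e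
  proof -
    define W where "W s t = poly (p ((b * s + t) mod N)) (of_int (L e))" for s t
    have "(\<Sum>t\<in>{0..<N}. of_bool (e k mod N = s) * of_bool (L0 e mod N = t) * W s t)
        = of_bool (e k mod N = s) * W s (L0 e mod N)" for s
    proof -
      have "(\<Sum>t\<in>{0..<N}. of_bool (e k mod N = s) * of_bool (L0 e mod N = t) * W s t)
        = (\<Sum>t\<in>{0..<N}. if t = L0 e mod N then of_bool (e k mod N = s) * W s t else 0)"
        by (intro sum.cong refl) auto
      then show ?thesis using p(1) by simp
    qed
    moreover have "(\<Sum>s\<in>{0..<N}. of_bool (e k mod N = s) * W s (L0 e mod N)) = W (e k mod N) (L0 e mod N)"
    proof -
      have "(\<Sum>s\<in>{0..<N}. of_bool (e k mod N = s) * W s (L0 e mod N))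
        = (\<Sum>s\<in>{0..<N}. if s = e k mod N then W s (L0 e mod N) else 0)"
        by (intro sum.cong refl) auto
      then show ?thesis using p(1) by simp
    qed
    moreover have "(b * (e k mod N) + L0 e mod N) mod N = L e mod N"
      unfolding L(3)[of e] by (metis mod_add_left_eq mod_add_right_eq mod_mult_right_eq)
    ultimately show ?thesis using p(2)[of "L e"] by (simp add: W_def)
  qed
  ultimately show ?case by simp
next
  case (nonneg L)
  obtain b L0 where L: "L0 \<in> linear_forms" "indep k L0" "\<And>e. L e = b * e k + L0 e"
    using linear_form_split[OF nonneg, of k] by blast
  consider "b > 0" | "b = 0" | "b < 0" by linarith
  then show ?case
  proof cases
    case 1
    have "lower_bound k (\<lambda>e x. if False then (-1) * L0 e < b * x else (-1) * L0 e \<le> b * x)"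
      using L 1 by (intro lower_bound.bound linear_forms.scale) (auto simp: indep_def)
    from normal_forms_lower_bound[OF this]
    have "(\<lambda>e. of_bool ((-1) * L0 e \<le> b * e k)) \<in> normal_forms k" by simp
    moreover have "(-1) * L0 e \<le> b * e k \<longleftrightarrow> 0 \<le> L e" for e unfolding L(3) by linarith
    ultimately show ?thesis by (simp only:)
  next
    case 2
    then show ?thesis using normal_forms_indep[OF pqp.nonneg[OF L(1)], of k] L(2,3)
      by (simp add: indep_def)
  next
    case 3
    have "lower_bound k (\<lambda>e x. if True then L0 e < (- b) * x else L0 e \<le> (- b) * x)"
      using L 3 by (intro lower_bound.bound) auto
    from normal_forms_diff[OF normal_forms_indep[OF pqp_const[of 1]] normal_forms_lower_bound[OF this]]
    have "(\<lambda>e. 1 - of_bool (L0 e < - b * e k) :: real) \<in> normal_forms k" by (simp add: indep_def)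
    moreover have "1 - of_bool (L0 e < - b * e k) = (of_bool (0 \<le> L e) :: real)" for e
      by (auto simp: L(3))
    ultimately show ?thesis by simp
  qed
next
  case (add f g)
  then show ?case by (intro normal_forms.add)
next
  case (mult f g)
  then show ?case by (intro normal_forms_mult)
qed

lemma int_le_div_iff:
  fixes b :: int
  assumes "b > 0"
  shows "x \<le> y div b \<longleftrightarrow> b * x \<le> y"
proof
  assume "x \<le> y div b"
  then have "b * x \<le> b * (y div b)" using assms by simp
  also have "\<dots> \<le> y" using mult_div_mod_eq[of b y] pos_mod_sign[OF assms, of y] by linarith
  finally show "b * x \<le> y" .
next
  assume "b * x \<le> y"
  then show "x \<le> y div b" using zdiv_mono1[of "b * x" y b] assms by simp
qed

text \<open>With an antidifference \<open>F\<close> of \<open>h\<close>, the sum is \<open>0\<close>, \<open>F(e m) - F 0\<close> or \<open>F(e m) - F t\<close>, where \<open>t\<close> is the largest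
  integer that violates the bound; homogeneous comparisons decide between these cases.\<close>

lemma sum_lower_bound_pqp:
  assumes "int_quasipoly h" "lower_bound k B" "m \<noteq> k"
  shows "(\<lambda>e. \<Sum>x\<in>{1..e m}. h x * of_bool (B e x)) \<in> pqp"
proof -
  obtain F where F: "int_quasipoly F" "\<And>m. F m - F (m - 1) = h m"
    using int_quasipoly_antidifference[OF assms(1)] by blast
  note tele = sum_telescope_int[of F h, OF F(2)]
  have pos: "(\<lambda>e. of_bool (0 < e m) :: real) \<in> pqp"
    by (intro pqp_less linear_forms.zero linear_forms.var)
  have Fm: "(\<lambda>e. F (e m) - F 0) \<in> pqp"
    by (intro pqp_diff pqp.qp[OF linear_forms.var F(1)] pqp_const)
  from assms(2) show ?thesis
  proof (cases rule: lower_bound.cases)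
    case trivial
    have "(\<Sum>x\<in>{1..e m}. h x * of_bool (B e x)) = of_bool (0 < e m) * (F (e m) - F 0)" for e
    proof (cases "0 < e m")
      case True
      have "{1..e m} = {0<..e m}" by auto
      then show ?thesis using tele[of 0 "e m"] True by (simp add: trivial)
    qed simp
    then show ?thesis using pqp.mult[OF pos Fm] by simp
  next
    case (bound L b s)
    \<comment> \<open>\<open>t\<close> is the largest integer below the bound; \<open>c\<close> accounts for weak bounds\<close>
    define c :: int where "c = (if s then 0 else 1)"
    define t where "t e = (L e - c) div b" for e
    have B: "B e x \<longleftrightarrow> t e < x" for e x
    proof -
      have "B e x \<longleftrightarrow> L e - c < b * x" by (auto simp: bound(1) c_def)
      also have "\<dots> \<longleftrightarrow> t e < x"
        unfolding t_def using int_le_div_iff[OF bound(4), of x "L e - c"] by linarith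
      finally show ?thesis .
    qed
    have L0: "t e \<le> 0" if "L e \<le> 0" for e
    proof -
      have "t e \<le> 0 div b" unfolding t_def using that bound(4)
        by (intro zdiv_mono1) (auto simp: c_def)
      then show ?thesis by simp
    qed
    have L1: "0 \<le> t e" if "0 < L e" for e
      using that bound(4) unfolding t_def c_def by (auto simp: pos_imp_zdiv_nonneg_iff)
    have L2: "t e \<le> x" if "L e \<le> b * x" for e x
    proof -
      have "t e \<le> (b * x) div b" unfolding t_def using that bound(4)
        by (intro zdiv_mono1) (auto simp: c_def)
      then show ?thesis using bound(4) by simp
    qed
    have L3: "x \<le> t e" if "b * x < L e" for e x
    proof -
      have "(b * x) div b \<le> t e" unfolding t_def using that bound(4)
        by (intro zdiv_mono1) (auto simp: c_def)
      then show ?thesis using bound(4) by simp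
    qed
    have "(\<Sum>x\<in>{1..e m}. h x * of_bool (B e x)) = of_bool (0 < e m) * (of_bool (L e \<le> 0) * (F (e m) - F 0) +
      of_bool (0 < L e) * of_bool (L e \<le> b * e m) * (F (e m) - F (t e)))" for e
    proof (cases "0 < e m")
      case True
      have *: "(\<Sum>x\<in>{1..e m}. h x * of_bool (B e x)) = (\<Sum>x\<in>{1..e m} \<inter> {x. t e < x}. h x)"
        by (simp add: B of_bool_def if_distrib sum.inter_restrict cong: if_cong)
      show ?thesis
      proof (cases "L e \<le> 0")
        case le: True
        have "{1..e m} \<inter> {x. t e < x} = {0<..e m}" using L0[OF le] by auto
        then show ?thesis using tele[of 0 "e m"] True le by (simp add: *)
      next
        case gt: False
        show ?thesis
        proof (cases "L e \<le> b * e m")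
          case le: True
          have "{1..e m} \<inter> {x. t e < x} = {t e<..e m}" using L1[of e] gt by auto
          then show ?thesis using tele[of "t e" "e m"] L2[OF le] True gt le by (simp add: *)
        next
          case lt: False
          then have "{1..e m} \<inter> {x. t e < x} = {}" using L3[of "e m" e] by auto
          then show ?thesis using lt gt by (simp only: *) simp
        qed
      qed
    qed simp
    moreover have "(\<lambda>e. of_bool (0 < e m) * (of_bool (L e \<le> 0) * (F (e m) - F 0) +
      of_bool (0 < L e) * of_bool (L e \<le> b * e m) * (F (e m) - F (t e)))) \<in> pqp"
      unfolding t_def using bound
      by (intro pqp.mult pqp.add pos Fm pqp_le pqp_less linear_forms.zero linear_forms.scale linear_forms.var
          pqp_diff pqp.qp[OF linear_forms.var F(1)] pqp.qp[where g = "\<lambda>m. F ((m - c) div b)"]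
          int_quasipoly_div F) auto
    ultimately show ?thesis by simp
  qed
qed

lemma pqp_sum_variable:
  assumes "f \<in> pqp" "m \<noteq> k"
  shows "(\<lambda>e. \<Sum>x\<in>{1..e m}. f (e(k := x))) \<in> pqp"
  using pqp_normal_form[OF assms(1), of k]
proof induction
  case (product P h B)
  have B: "B (e(k := x)) = B e" for e x
    using product(4) by (cases rule: lower_bound.cases) (auto simp: indep_def fun_eq_iff)
  have "(\<Sum>x\<in>{1..e m}. P (e(k := x)) * h ((e(k := x)) k) * of_bool (B (e(k := x)) ((e(k := x)) k)))
      = P e * (\<Sum>x\<in>{1..e m}. h x * of_bool (B e x))" for e
    using product(2) unfolding B indep_def by (simp add: sum_distrib_left mult.assoc del: sum_mult_of_bool_eq)
  then show ?case
    using pqp.mult[OF product(1) sum_lower_bound_pqp[OF product(3,4) assms(2)]] by (simp only:)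
next
  case (add f g)
  then show ?case using pqp.add by (simp add: sum.distrib)
qed

lemma pqp_sum_box:
  assumes "finite V" "f \<in> pqp" "m \<notin> V"
  shows "(\<lambda>e. \<Sum>g\<in>V \<rightarrow>\<^sub>E {1..e m}. f (\<lambda>v. if v \<in> V then g v else e v)) \<in> pqp"
  using assms(1,3)
proof (induction V)
  case empty
  then show ?case using assms(2) by (simp add: PiE_empty_domain)
next
  case (insert v V)
  let ?h = "\<lambda>e. \<Sum>g\<in>V \<rightarrow>\<^sub>E {1..e m}. f (\<lambda>v. if v \<in> V then g v else e v)"
  have "(\<Sum>g\<in>insert v V \<rightarrow>\<^sub>E {1..e m}. f (\<lambda>w. if w \<in> insert v V then g w else e w)) =
    (\<Sum>x\<in>{1..e m}. ?h (e(v := x)))" for e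
  proof -
    have inj: "inj_on (\<lambda>(x, g). g(v := x)) ({1..e m} \<times> (V \<rightarrow>\<^sub>E {1..e m}))"
      using inj_combinator[OF insert(2), of "\<lambda>_. {1..e m}"] .
    have "(\<Sum>g\<in>insert v V \<rightarrow>\<^sub>E {1..e m}. f (\<lambda>w. if w \<in> insert v V then g w else e w)) =
      (\<Sum>(x, g)\<in>{1..e m} \<times> (V \<rightarrow>\<^sub>E {1..e m}). f (\<lambda>w. if w \<in> insert v V then (g(v := x)) w else e w))"
      unfolding PiE_insert_eq
      by (subst sum.reindex[OF inj]) (simp add: o_def case_prod_unfold)
    also have "\<dots> = (\<Sum>(x, g)\<in>{1..e m} \<times> (V \<rightarrow>\<^sub>E {1..e m}). f (\<lambda>w. if w \<in> V then g w else (e(v := x)) w))"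
      using insert(2) by (intro sum.cong refl) (auto intro!: arg_cong[of _ _ f] simp: fun_eq_iff)
    also have "\<dots> = (\<Sum>x\<in>{1..e m}. ?h (e(v := x)))"
      using insert(4) by (subst sum.cartesian_product[symmetric]) auto
    finally show ?thesis .
  qed
  then show ?case using pqp_sum_variable[of ?h m v] insert by simp
qed

lemma pqp_single_variable:
  assumes "f \<in> pqp"
  obtains N p where "N > 0" "\<And>n. n > 0 \<Longrightarrow> f (\<lambda>v. if v = k then n else 0) = poly (p (n mod N)) (of_int n)"
proof -
  let ?e = "\<lambda>n v. if v = k then n else (0::int)"
  have lin: "\<exists>b. \<forall>n. L (?e n) = b * n" if "L \<in> linear_forms" for L
    using that
  proof induction
    case (var v)
    show ?case by (rule exI[of _ "if v = k then 1 else 0"]) auto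
  next
    case (add L L')
    then obtain b b' where "\<forall>n. L (?e n) = b * n" "\<forall>n. L' (?e n) = b' * n" by blast
    then show ?case by (intro exI[of _ "b + b'"]) (auto simp: algebra_simps)
  next
    case (scale L c)
    then obtain b where "\<forall>n. L (?e n) = b * n" by blast
    then show ?case by (intro exI[of _ "c * b"]) auto
  qed auto
  from assms have "\<exists>g. int_quasipoly g \<and> (\<forall>n>0. f (?e n) = g n)"
  proof induction
    case (qp L g)
    obtain b where "\<forall>n. L (?e n) = b * n" using lin[OF qp(1)] by blast
    then show ?case using int_quasipoly_scaled[OF qp(2), of b] by (intro exI[of _ "\<lambda>n. g (b * n)"]) auto
  next
    case (nonneg L)
    obtain b where "\<forall>n. L (?e n) = b * n" using lin[OF nonneg] by blast
    then show ?case using int_quasipoly_const[of "of_bool (0 \<le> b)"]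
      by (intro exI[of _ "\<lambda>n. of_bool (0 \<le> b)"]) (auto simp: zero_le_mult_iff)
  next
    case (add f g)
    then obtain f' g' where "int_quasipoly f' \<and> (\<forall>n>0. f (?e n) = f' n)"
      "int_quasipoly g' \<and> (\<forall>n>0. g (?e n) = g' n)" by blast
    then show ?case by (intro exI[of _ "\<lambda>n. f' n + g' n"]) (auto intro: int_quasipoly_add)
  next
    case (mult f g)
    then obtain f' g' where "int_quasipoly f' \<and> (\<forall>n>0. f (?e n) = f' n)"
      "int_quasipoly g' \<and> (\<forall>n>0. g (?e n) = g' n)" by blast
    then show ?case by (intro exI[of _ "\<lambda>n. f' n * g' n"]) (auto intro: int_quasipoly_mult)
  qed
  then show ?thesis using that unfolding int_quasipoly_def by metis
qed

text \<open>This is Ehrhart's theorem for the cubes \<open>{1..n}\<^bsup>V\<^esup>\<close> cut by a linear subspace. The indicator of the solutions is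
  piecewise quasipolynomial in the variables and the side length \<open>n\<close>, and the variables are summed out one
  after the other. The side length is itself the value of a variable \<open>m\<close>, on which the equations may depend.\<close>

theorem quasipoly_homogeneous_system:
  assumes "finite V" "m \<notin> V" "finite S" "\<And>s. s \<in> S \<Longrightarrow> L s \<in> linear_forms"
  shows "quasipoly (\<lambda>n. real (card {g \<in> V \<rightarrow>\<^sub>E {1..int n}.
    \<forall>s\<in>S. L s (\<lambda>v. if v \<in> V then g v else if v = m then int n else 0) = 0}))"
proof -
  let ?f = "\<lambda>e. \<Prod>s\<in>S. of_bool (L s e = 0) :: real"
  have "?f \<in> pqp" using assms by (intro pqp_prod pqp_eq linear_forms.zero) auto
  from pqp_single_variable[OF pqp_sum_box[OF assms(1) this assms(2)], of m]
  obtain N p where p: "N > 0" "\<And>n. n > 0 \<Longrightarrow>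
    (\<Sum>g\<in>V \<rightarrow>\<^sub>E {1..n}. ?f (\<lambda>v. if v \<in> V then g v else if v = m then n else 0)) = poly (p (n mod N)) (of_int n)"
    by auto
  have fin: "finite (V \<rightarrow>\<^sub>E {1..n})" for n :: int using assms(1) by (intro finite_PiE) auto
  have "?f e = of_bool (\<forall>s\<in>S. L s e = 0)" for e
    using assms(3) by (cases "\<forall>s\<in>S. L s e = 0") (auto intro: prod_zero)
  then have "real (card {g \<in> V \<rightarrow>\<^sub>E {1..n}. \<forall>s\<in>S. L s (\<lambda>v. if v \<in> V then g v else if v = m then n else 0) = 0})
    = (\<Sum>g\<in>V \<rightarrow>\<^sub>E {1..n}. ?f (\<lambda>v. if v \<in> V then g v else if v = m then n else 0))" for n
    using fin by (simp add: Int_def)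
  then have "has_constituents (\<lambda>n. real (card {g \<in> V \<rightarrow>\<^sub>E {1..int n}.
    \<forall>s\<in>S. L s (\<lambda>v. if v \<in> V then g v else if v = m then int n else 0) = 0})) (\<lambda>n. p (int n mod N))"
    using p by (intro has_constituentsI[of "nat N"]) auto
  then show ?thesis unfolding quasipoly_def by blast
qed

section \<open>Subspaces cut out by move equations\<close>

type_synonym equation = "(int \<times> int) \<times> nat \<times> nat"

definition eqs :: "(int \<times> int) set \<Rightarrow> nat set \<Rightarrow> equation set" where
  "eqs M I = {(m, i, j). m \<in> M \<and> i \<in> I \<and> j \<in> I \<and> i < j}"

definition sol :: "nat set \<Rightarrow> equation set \<Rightarrow> config set" where
  "sol I S = {z \<in> config_space I. \<forall>(m, i, j)\<in>S. on_hyperplane m i j z}"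

definition supp :: "equation set \<Rightarrow> nat set" where
  "supp S = (\<Union>(m, i, j)\<in>S. {i, j})"

definition coord :: "nat \<times> bool \<Rightarrow> config \<Rightarrow> real" where
  "coord = (\<lambda>(i, b) z. if b then fst (z i) else snd (z i))"

definition grid :: "nat set \<Rightarrow> nat \<Rightarrow> config set" where
  "grid I n = {z \<in> config_space I. \<forall>c\<in>I \<times> UNIV. coord c z \<in> real_of_int ` {1..int n}}"

definition points :: "nat set \<Rightarrow> config set \<Rightarrow> nat \<Rightarrow> nat" where
  "points I U n = card (U \<inter> grid I n)"

lemma config_eq_iff: "z = w \<longleftrightarrow> (\<forall>c. coord c z = coord c w)"
  by (auto simp: coord_def fun_eq_iff prod_eq_iff split: if_splits)

lemma coord_add [simp]: "coord c (z + w) = coord c z + coord c w"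
  and coord_diff [simp]: "coord c (z - w) = coord c z - coord c w"
  and coord_cscale [simp]: "coord c (cscale r z) = r * coord c z"
  and coord_zero [simp]: "coord c 0 = 0"
  by (auto simp: coord_def cscale_def split: prod.split)

lemma finite_eqs: "finite M \<Longrightarrow> finite I \<Longrightarrow> finite (eqs M I)"
  by (rule finite_subset[of _ "M \<times> I \<times> I"]) (auto simp: eqs_def)

lemma eqs_mono: "I \<subseteq> J \<Longrightarrow> eqs M I \<subseteq> eqs M J"
  by (auto simp: eqs_def)

lemma supp_eqs: "S \<subseteq> eqs M I \<Longrightarrow> supp S \<subseteq> I"
  by (auto simp: supp_def eqs_def)

lemma supp_insert: "supp (insert (m, i, j) S) = {i, j} \<union> supp S"
  by (auto simp: supp_def)

lemma supp_empty [simp]: "supp {} = {}"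
  by (simp add: supp_def)

lemma supp_eq_empty_iff: "supp S = {} \<longleftrightarrow> S = {}"
  by (auto simp: supp_def)

lemma eqs_supp: "S \<subseteq> eqs M I \<Longrightarrow> S \<subseteq> eqs M (supp S)"
  by (fastforce simp: supp_def eqs_def)

lemma finite_supp: "finite S \<Longrightarrow> finite (supp S)"
  by (auto simp: supp_def)

lemma sol_insert: "sol I (insert (m, i, j) S) = {z \<in> sol I S. on_hyperplane m i j z}"
  by (auto simp: sol_def)

lemma sol_empty: "sol I {} = config_space I"
  by (simp add: sol_def)

lemma sol_antimono: "S \<subseteq> T \<Longrightarrow> sol I T \<subseteq> sol I S"
  by (auto simp: sol_def)

lemma sol_subset: "sol I S \<subseteq> config_space I"
  by (auto simp: sol_def)

subsection \<open>Dimension\<close>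

definition defect :: "int \<times> int \<Rightarrow> nat \<Rightarrow> nat \<Rightarrow> config \<Rightarrow> real" where
  "defect m i j z = of_int (snd m) * (fst (z j) - fst (z i)) - of_int (fst m) * (snd (z j) - snd (z i))"

lemma on_hyperplane_defect: "on_hyperplane m i j z \<longleftrightarrow> defect m i j z = 0"
  by (auto simp: on_hyperplane_def defect_def)

lemma defect_add: "defect m i j (z + w) = defect m i j z + defect m i j w"
  by (simp add: defect_def algebra_simps)

lemma defect_cscale: "defect m i j (cscale r z) = r * defect m i j z"
  by (simp add: defect_def cscale_def algebra_simps)

lemma subspace_config_space: "config.subspace (config_space I)"
  by (rule config.subspaceI) (auto simp: config_space_def cscale_def)

lemma subspace_kernel:
  assumes "config.subspace V" "\<And>z w. \<phi> (z + w) = \<phi> z + \<phi> w" "\<And>r z. \<phi> (cscale r z) = r * (\<phi> z :: real)"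
  shows "config.subspace {z \<in> V. \<phi> z = 0}"
proof (rule config.subspaceI)
  have "\<phi> (cscale 0 0) = 0" using assms(3)[of 0 0] by simp
  then show "0 \<in> {z \<in> V. \<phi> z = 0}" using config.subspace_0[OF assms(1)] by simp
qed (use assms in \<open>auto intro: config.subspace_add config.subspace_scale\<close>)

lemma mem_sol_iff:
  "z \<in> sol I S \<longleftrightarrow> z \<in> config_space I \<and> (\<forall>m i j. (m, i, j) \<in> S \<longrightarrow> defect m i j z = 0)"
  unfolding sol_def on_hyperplane_defect mem_Collect_eq by blast

lemma subspace_sol: "config.subspace (sol I S)"
proof (rule config.subspaceI)
  show "0 \<in> sol I S"
    by (simp add: mem_sol_iff defect_def config_space_def)
  show "x + y \<in> sol I S" if "x \<in> sol I S" "y \<in> sol I S" for x y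
    using that by (simp add: mem_sol_iff defect_add config_space_def)
  show "cscale c x \<in> sol I S" if "x \<in> sol I S" for x c
    using that by (simp add: mem_sol_iff defect_cscale config_space_def) (simp add: cscale_def)
qed

text \<open>The space of all configurations has infinite dimension, so finiteness is carried along explicitly.\<close>

definition fin_dim :: "config set \<Rightarrow> bool" where
  "fin_dim V \<longleftrightarrow> (\<exists>B. finite B \<and> V \<subseteq> config.span B)"

lemma fin_dim_subset: "V \<subseteq> W \<Longrightarrow> fin_dim W \<Longrightarrow> fin_dim V"
  unfolding fin_dim_def by blast

lemma fin_dim_basis:
  assumes "fin_dim V"
  obtains B where "finite B" "B \<subseteq> V" "config.independent B" "V \<subseteq> config.span B" "card B = config.dim V"
proof -
  obtain B where B: "B \<subseteq> V" "config.independent B" "V \<subseteq> config.span B" "card B = config.dim V"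
    using config.basis_exists by blast
  moreover have "finite B"
    using assms B(1,2) config.independent_span_bound unfolding fin_dim_def by (metis subset_trans)
  ultimately show ?thesis using that by blast
qed

lemma dim_mono:
  assumes "V \<subseteq> W" "fin_dim W"
  shows "config.dim V \<le> config.dim W"
proof -
  obtain B where "finite B" "W \<subseteq> config.span B" "card B = config.dim W"
    using fin_dim_basis[OF assms(2)] .
  then show ?thesis using config.dim_le_card[of V B] assms(1) by auto
qed

text \<open>A basis of the kernel becomes a basis of \<open>V\<close> when one vector outside the kernel is added. Dimensions of
  solution spaces are computed by cutting with one coordinate or one equation at a time.\<close>

lemma dim_kernel:
  assumes V: "config.subspace V" and \<phi>: "\<And>z w. \<phi> (z + w) = \<phi> z + \<phi> w" "\<And>r z. \<phi> (cscale r z) = r * (\<phi> z :: real)"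
    and fin: "fin_dim {z \<in> V. \<phi> z = 0}" and v: "v \<in> V" "\<phi> v \<noteq> 0"
  shows "config.dim V = Suc (config.dim {z \<in> V. \<phi> z = 0})" "fin_dim V"
proof -
  let ?K = "{z \<in> V. \<phi> z = 0}"
  obtain B where B: "finite B" "B \<subseteq> ?K" "config.independent B" "?K \<subseteq> config.span B" "card B = config.dim ?K"
    using fin_dim_basis[OF fin] .
  have "config.span B \<subseteq> ?K"
    by (rule config.span_minimal[OF B(2) subspace_kernel[OF V \<phi>]])
  then have v': "v \<notin> config.span B" using v by auto
  have span: "V \<subseteq> config.span (insert v B)"
  proof
    fix z assume z: "z \<in> V"
    define k where "k = \<phi> z / \<phi> v"
    have zk: "z - cscale k v = z + cscale (- k) v"
      by (simp add: config_eq_iff)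
    have "\<phi> (z + cscale (- k) v) = 0" unfolding \<phi> k_def using v by simp
    moreover have "z + cscale (- k) v \<in> V"
      by (intro config.subspace_add config.subspace_scale V z v)
    ultimately have "z + cscale (- k) v \<in> config.span B" using B(4) by blast
    with zk show "z \<in> config.span (insert v B)"
      unfolding config.span_breakdown_eq by (intro exI[of _ k]) simp
  qed
  show "config.dim V = Suc (config.dim ?K)"
  proof (rule config.dim_unique[of "insert v B"])
    show "card (insert v B) = Suc (config.dim ?K)"
      using B v' config.span_superset by (metis card_insert_disjoint subsetD)
  qed (use B v v' span config.independent_insertI in auto)
  show "fin_dim V" unfolding fin_dim_def using span B(1) by blast
qed

lemma dim_config_space:
  assumes "finite I"
  shows "config.dim (config_space I) = 2 * card I" "fin_dim (config_space I)"
proof -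
  from assms have "config.dim (config_space I) = 2 * card I \<and> fin_dim (config_space I)"
  proof induction
    case empty
    have e: "config_space {} = {0}" by (auto simp: config_space_def fun_eq_iff)
    have "config.dim {0 :: config} = 0"
      by (rule config.dim_unique[of "{}"]) (auto simp: config.independent_empty)
    then show ?case unfolding e fin_dim_def by (auto intro: exI[of _ "{}"])
  next
    case (insert i I)
    let ?V = "config_space (insert i I)"
    let ?W = "{z \<in> ?V. coord (i, True) z = 0}"
    define ex ey :: config where "ex = (\<lambda>k. if k = i then (1, 0) else 0)" and "ey = (\<lambda>k. if k = i then (0, 1) else 0)"
    have K: "{z \<in> ?W. coord (i, False) z = 0} = config_space I"
      using insert(2) by (auto simp: config_space_def coord_def) (metis prod.collapse zero_prod_def)
    have W: "config.subspace ?W" by (intro subspace_kernel subspace_config_space) auto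
    have "ey \<in> ?W" "coord (i, False) ey \<noteq> 0"
      by (auto simp: ey_def coord_def config_space_def)
    from dim_kernel[OF W coord_add coord_cscale _ this]
    have dW: "config.dim ?W = Suc (config.dim (config_space I))" "fin_dim ?W"
      using insert unfolding K by blast+
    have "ex \<in> ?V" "coord (i, True) ex \<noteq> 0"
      by (auto simp: ex_def coord_def config_space_def)
    from dim_kernel[OF subspace_config_space coord_add coord_cscale dW(2) this]
    have "config.dim ?V = Suc (config.dim ?W)" "fin_dim ?V" .
    moreover note dW
    ultimately show ?case using insert by simp
  qed
  then show "config.dim (config_space I) = 2 * card I" "fin_dim (config_space I)" by auto
qed

lemma fin_dim_sol: "finite I \<Longrightarrow> fin_dim (sol I S)"
  using fin_dim_subset[OF sol_subset dim_config_space(2)] .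

lemma dim_sol_le: "finite I \<Longrightarrow> config.dim (sol I S) \<le> 2 * card I"
  using dim_mono[OF sol_subset dim_config_space(2), of I S] dim_config_space(1)[of I] by simp

lemma dim_sol_insert:
  assumes "finite I" "z \<in> sol I S" "\<not> on_hyperplane m i j z"
  shows "config.dim (sol I S) = Suc (config.dim (sol I (insert (m, i, j) S)))"
proof -
  have e: "sol I (insert (m, i, j) S) = {z \<in> sol I S. defect m i j z = 0}"
    by (simp add: sol_insert on_hyperplane_defect)
  have "fin_dim {z \<in> sol I S. defect m i j z = 0}"
    unfolding e[symmetric] by (rule fin_dim_sol[OF assms(1)])
  moreover have "defect m i j z \<noteq> 0" using assms(3) by (simp add: on_hyperplane_defect)
  ultimately show ?thesis unfolding e
    by (intro dim_kernel(1)[OF subspace_sol defect_add defect_cscale _ assms(2)])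
qed

text \<open>A piece that no equation of \<open>S\<close> mentions can be moved off the line required by a new equation.\<close>

lemma free_piece:
  assumes "m \<noteq> (0, 0)" "i \<noteq> j" "v \<in> {i, j}" "v \<notin> supp S" "v \<in> I"
  obtains z where "z \<in> sol I S" "\<not> on_hyperplane m i j z"
proof -
  define z :: config where "z = (\<lambda>k. if k = v then (of_int (snd m), - of_int (fst m)) else 0)"
  have sol: "z \<in> sol I S"
    using assms unfolding sol_def config_space_def on_hyperplane_def z_def
    by (fastforce simp: supp_def)
  have "real_of_int (snd m) * of_int (snd m) + of_int (fst m) * of_int (fst m) \<noteq> 0"
    using assms(1) by (metis add_nonneg_eq_0_iff mult_eq_0_iff of_int_eq_0_iff prod.collapse zero_le_square)
  moreover have "defect m i j z = (if v = i then -1 else 1) *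
      (real_of_int (snd m) * of_int (snd m) + of_int (fst m) * of_int (fst m))"
    using assms(2,3) unfolding defect_def z_def by (auto simp: algebra_simps)
  ultimately have "defect m i j z \<noteq> 0" by simp
  then have "\<not> on_hyperplane m i j z" unfolding on_hyperplane_defect .
  with sol show ?thesis using that by blast
qed

text \<open>Adding an equation with a new piece lowers the dimension by one and involves at most two new pieces;
  adding one without new pieces changes only the dimension, downwards. For \<open>S\<^sub>0 = {}\<close> this says that
  the codimension is at least half the number of pieces involved.\<close>

lemma excess_mono:
  assumes "finite I" "(0, 0) \<notin> M" "S0 \<subseteq> S" "S \<subseteq> eqs M I" "finite S"
  shows "2 * config.dim (sol I S) + card (supp S) \<le> 2 * config.dim (sol I S0) + card (supp S0)"
proof -
  have fin0: "finite S0" using assms finite_subset by blast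
  have "2 * config.dim (sol I (S0 \<union> T)) + card (supp (S0 \<union> T)) \<le> 2 * config.dim (sol I S0) + card (supp S0)"
    if "finite T" "T \<subseteq> eqs M I" for T
    using that
  proof induction
    case (insert e T)
    obtain m i j where e: "e = (m, i, j)" by (cases e)
    have mem: "m \<in> M" "i \<in> I" "j \<in> I" "i < j" using insert.prems by (auto simp: e eqs_def)
    have fin: "finite (supp (S0 \<union> T))" using fin0 insert by (intro finite_supp) auto
    have ins: "S0 \<union> insert e T = insert (m, i, j) (S0 \<union> T)" by (auto simp: e)
    show ?case
    proof (cases "{i, j} \<subseteq> supp (S0 \<union> T)")
      case True
      then have "supp (S0 \<union> insert e T) = supp (S0 \<union> T)" unfolding ins supp_insert by auto
      moreover have "config.dim (sol I (S0 \<union> insert e T)) \<le> config.dim (sol I (S0 \<union> T))"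
        unfolding ins by (intro dim_mono fin_dim_sol assms sol_antimono) auto
      ultimately show ?thesis using insert by simp
    next
      case False
      then obtain v where v: "v \<in> {i, j}" "v \<notin> supp (S0 \<union> T)" by auto
      obtain z where "z \<in> sol I (S0 \<union> T)" "\<not> on_hyperplane m i j z"
        using free_piece[of m i j v "S0 \<union> T" I] v mem assms(2) by (metis insert_iff less_irrefl singletonD)
      then have "config.dim (sol I (S0 \<union> T)) = Suc (config.dim (sol I (S0 \<union> insert e T)))"
        unfolding ins by (intro dim_sol_insert assms)
      moreover have "card (supp (S0 \<union> insert e T)) \<le> card (supp (S0 \<union> T)) + 2"
      proof -
        have "card (supp (S0 \<union> insert e T)) \<le> card {i, j} + card (supp (S0 \<union> T))"
          unfolding ins supp_insert by (rule card_Un_le)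
        then show ?thesis using mem by simp
      qed
      ultimately show ?thesis using insert by simp
    qed
  qed simp
  from this[of S] show ?thesis using assms by (simp add: Un_absorb1)
qed

lemma dim_sol_supp:
  assumes "finite I" "finite M" "(0, 0) \<notin> M" "S \<subseteq> eqs M I"
  shows "2 * config.dim (sol I S) + card (supp S) \<le> 4 * card I"
  using excess_mono[OF assms(1,3) _ assms(4), of "{}"] finite_subset[OF assms(4) finite_eqs[OF assms(2,1)]]
  by (simp add: sol_empty dim_config_space(1)[OF assms(1)])

text \<open>An equation that mentions a piece free in \<open>S\<close> does not follow from \<open>S\<close>. So the pieces involved in a
  subspace can be read off from any system of equations for it.\<close>

lemma supp_sol_eq:
  assumes "(0, 0) \<notin> M" "S \<subseteq> eqs M I" "T \<subseteq> eqs M I" "sol I S \<subseteq> sol I T"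
  shows "supp T \<subseteq> supp S"
proof
  fix v assume "v \<in> supp T"
  then obtain m i j where e: "(m, i, j) \<in> T" "v \<in> {i, j}" by (auto simp: supp_def)
  then have mem: "m \<in> M" "i \<in> I" "j \<in> I" "i < j" using assms(3) by (auto simp: eqs_def)
  show "v \<in> supp S"
  proof (rule ccontr)
    assume "v \<notin> supp S"
    then obtain z where "z \<in> sol I S" "\<not> on_hyperplane m i j z"
      using free_piece[of m i j v S I] e mem assms(1) by (metis insert_iff less_irrefl singletonD)
    then show False using assms(4) e(1) by (auto simp: sol_def)
  qed
qed

subsection \<open>Counting integer points\<close>

lemma coord_outside: "z \<in> config_space I \<Longrightarrow> fst c \<notin> I \<Longrightarrow> coord c z = 0"
  by (cases c) (simp add: coord_def config_space_def)

lemma grid_coord: "z \<in> grid I n \<Longrightarrow> fst c \<in> I \<Longrightarrow> coord c z \<in> real_of_int ` {1..int n}"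
  by (cases c) (simp add: grid_def)

lemma finite_coords: "finite (real_of_int ` {1..int n})" "card (real_of_int ` {1..int n}) = n"
  by (auto simp: card_image inj_on_def)

lemma finite_grid:
  assumes "finite I"
  shows "finite (grid I n)"
proof (rule finite_imageD)
  let ?R = "real_of_int ` {1..int n}"
  let ?f = "\<lambda>z. \<lambda>c\<in>I \<times> UNIV. coord c z"
  show "finite (?f ` grid I n)"
    by (rule finite_subset[of _ "(I \<times> UNIV) \<rightarrow>\<^sub>E ?R"])
      (auto simp: grid_def intro!: finite_PiE assms split: if_splits)
  show "inj_on ?f (grid I n)"
  proof (rule inj_onI)
    fix z w assume zw: "z \<in> grid I n" "w \<in> grid I n" and eq: "?f z = ?f w"
    have "coord (i, b) z = coord (i, b) w" for i b
    proof (cases "i \<in> I")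
      case True
      then show ?thesis using fun_cong[OF eq, of "(i, b)"] by simp
    next
      case False
      then show ?thesis using zw by (auto simp: grid_def config_space_def coord_def)
    qed
    then show "z = w" unfolding config_eq_iff by auto
  qed
qed

lemma finite_points: "finite I \<Longrightarrow> finite (U \<inter> grid I n)"
  using finite_grid by blast

text \<open>By induction on the dimension: a coordinate that is not constant on the affine space takes at most \<open>n\<close>
  values, and each of them cuts out an affine space of smaller dimension.\<close>

lemma card_affine_grid_le:
  assumes "config.subspace V" "V \<subseteq> config_space I" "finite I"
  shows "card {z \<in> grid I n. z - w \<in> V} \<le> n ^ config.dim V"
  using assms(1,2)
proof (induction "config.dim V" arbitrary: V w rule: less_induct)
  case less
  show ?case
  proof (cases "V = {0}")
    case True
    have "config.dim V = 0" unfolding True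
      by (rule config.dim_unique[of "{}"]) (auto simp: config.independent_empty)
    moreover have "{z \<in> grid I n. z - w \<in> V} \<subseteq> {w}" using True by auto
    then have "card {z \<in> grid I n. z - w \<in> V} \<le> 1"
      using card_mono[of "{w}" "{z \<in> grid I n. z - w \<in> V}"] by simp
    ultimately show ?thesis by simp
  next
    case False
    then obtain v where v: "v \<in> V" "v \<noteq> 0" using config.subspace_0[OF less(2)] by blast
    then obtain c where c: "coord c v \<noteq> 0" by (auto simp: config_eq_iff)
    let ?V0 = "{z \<in> V. coord c z = 0}"
    have fin: "fin_dim ?V0" by (rule fin_dim_subset[OF _ dim_config_space(2)[OF assms(3)]]) (use less(3) in auto)
    have dim: "config.dim V = Suc (config.dim ?V0)"
      by (rule dim_kernel(1)[OF less(2) coord_add coord_cscale fin v(1) c])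
    have cI: "fst c \<in> I" using less(3) v(1) c coord_outside by blast
    let ?A = "\<lambda>a. {z \<in> grid I n. z - w \<in> V \<and> coord c z = a}"
    have slice: "card (?A a) \<le> n ^ config.dim ?V0" for a
    proof (cases "?A a = {}")
      case True
      then show ?thesis by (simp only: card.empty)
    next
      case False
      then obtain z0 where z0: "z0 \<in> ?A a" by blast
      have "?A a \<subseteq> {z \<in> grid I n. z - z0 \<in> ?V0}"
      proof
        fix z assume z: "z \<in> ?A a"
        have "z - w \<in> V" "z0 - w \<in> V" using z z0 by auto
        from config.subspace_diff[OF less(2) this] have "z - z0 \<in> V" by simp
        then show "z \<in> {z \<in> grid I n. z - z0 \<in> ?V0}" using z z0 by simp
      qed
      then have "card (?A a) \<le> card {z \<in> grid I n. z - z0 \<in> ?V0}"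
        by (intro card_mono finite_subset[OF _ finite_grid[OF assms(3), of n]]) auto
      also have "\<dots> \<le> n ^ config.dim ?V0"
        using less(1)[of ?V0 z0] dim subspace_kernel[OF less(2) coord_add[of c] coord_cscale[of c]] less(3) by auto
      finally show ?thesis .
    qed
    have "{z \<in> grid I n. z - w \<in> V} = (\<Union>a\<in>real_of_int ` {1..int n}. ?A a)"
    proof (intro equalityI subsetI)
      fix z assume z: "z \<in> {z \<in> grid I n. z - w \<in> V}"
      then show "z \<in> (\<Union>a\<in>real_of_int ` {1..int n}. ?A a)"
        using grid_coord[OF _ cI, of z n] by (intro UN_I[of "coord c z"]) simp_all
    qed (simp only: UN_iff mem_Collect_eq, blast)
    then have "card {z \<in> grid I n. z - w \<in> V} \<le> (\<Sum>a\<in>real_of_int ` {1..int n}. card (?A a))"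
      by (simp only: card_UN_le[OF finite_coords(1)])
    also have "\<dots> \<le> (\<Sum>a\<in>real_of_int ` {1..int n}. n ^ config.dim ?V0)"
      by (intro sum_mono slice)
    also have "\<dots> = n ^ config.dim V" by (simp add: finite_coords(2) dim)
    finally show ?thesis .
  qed
qed

lemma points_le:
  assumes "config.subspace U" "U \<subseteq> config_space I" "finite I"
  shows "points I U n \<le> n ^ config.dim U"
  using card_affine_grid_le[OF assms, of n 0] by (simp add: points_def Int_def conj_commute)

definition diagonal :: "nat set \<Rightarrow> real \<times> real \<Rightarrow> config" where
  "diagonal I p = (\<lambda>k. if k \<in> I then p else 0)"

lemma diagonal_in_sol: "S \<subseteq> eqs M I \<Longrightarrow> diagonal I p \<in> sol I S"
  by (auto simp: sol_def diagonal_def config_space_def on_hyperplane_def eqs_def)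

lemma grid_mono: "n \<le> n' \<Longrightarrow> grid I n \<subseteq> grid I n'"
  by (fastforce simp: grid_def)

text \<open>Enlarging the board adds points on the faces \<open>x\<^sub>c = n + 1\<close> only, and each face meets \<open>U\<close> in an affine
  space of smaller dimension, because \<open>U\<close> contains a configuration without vanishing coordinates.\<close>

lemma points_Suc_le:
  assumes U: "config.subspace U" "U \<subseteq> config_space I" and "finite I" and diag: "diagonal I (1, 1) \<in> U" and "I \<noteq> {}"
  shows "points I U n \<le> points I U (Suc n)"
    and "points I U (Suc n) \<le> points I U n + 2 * card I * Suc n ^ (config.dim U - 1)"
    and "config.dim U > 0"
proof -
  let ?F = "\<lambda>c. {z \<in> U \<inter> grid I (Suc n). coord c z = real (Suc n)}"
  show "points I U n \<le> points I U (Suc n)"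
    unfolding points_def using grid_mono[of n "Suc n" I]
    by (intro card_mono finite_points assms(3)) auto
  have slice: "config.dim U > 0 \<and> card (?F c) \<le> Suc n ^ (config.dim U - 1)" if c: "c \<in> I \<times> UNIV" for c
  proof -
    let ?V0 = "{z \<in> U. coord c z = 0}"
    have fin: "fin_dim ?V0" by (rule fin_dim_subset[OF _ dim_config_space(2)[OF assms(3)]]) (use U in auto)
    have "coord c (diagonal I (1, 1)) \<noteq> 0" using c by (auto simp: coord_def diagonal_def split: if_splits)
    from dim_kernel(1)[OF U(1) coord_add coord_cscale fin diag this]
    have dim: "config.dim U = Suc (config.dim ?V0)" .
    show ?thesis
    proof (cases "?F c = {}")
      case False
      then obtain z0 where z0: "z0 \<in> ?F c" by blast
      have "?F c \<subseteq> {z \<in> grid I (Suc n). z - z0 \<in> ?V0}"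
        using z0 config.subspace_diff[OF U(1)] by auto
      then have "card (?F c) \<le> card {z \<in> grid I (Suc n). z - z0 \<in> ?V0}"
        by (intro card_mono finite_subset[OF _ finite_grid[OF assms(3), of "Suc n"]]) auto
      also have "\<dots> \<le> Suc n ^ config.dim ?V0"
        using card_affine_grid_le[OF subspace_kernel[OF U(1) coord_add[of c] coord_cscale[of c]] _ assms(3)] U(2) by blast
      finally show ?thesis using dim by simp
    next
      case True
      show ?thesis unfolding True using dim by simp
    qed
  qed
  show "config.dim U > 0" using slice assms(5) by blast
  have "U \<inter> grid I (Suc n) \<subseteq> (U \<inter> grid I n) \<union> (\<Union>c\<in>I \<times> UNIV. ?F c)"
  proof
    fix z assume z: "z \<in> U \<inter> grid I (Suc n)"
    show "z \<in> (U \<inter> grid I n) \<union> (\<Union>c\<in>I \<times> UNIV. ?F c)"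
    proof (cases "\<exists>c\<in>I \<times> UNIV. coord c z = real (Suc n)")
      case False
      have "coord c z \<in> real_of_int ` {1..int n}" if c: "c \<in> I \<times> UNIV" for c
      proof -
        obtain k where k: "coord c z = real_of_int k" "k \<in> {1..int (Suc n)}"
          using z c grid_coord[of z I "Suc n" c] by auto
        moreover have "k \<noteq> int (Suc n)" using False c k(1) by (metis of_int_of_nat_eq)
        ultimately show ?thesis by auto
      qed
      then show ?thesis using z by (auto simp: grid_def)
    qed (use z in blast)
  qed
  then have "points I U (Suc n) \<le> card ((U \<inter> grid I n) \<union> (\<Union>c\<in>I \<times> UNIV. ?F c))"
    unfolding points_def using finite_points[OF assms(3)] assms(3)
    by (intro card_mono) (auto intro: finite_subset[OF _ finite_grid[OF assms(3), of "Suc n"]])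
  also have "\<dots> \<le> points I U n + card (\<Union>c\<in>I \<times> UNIV. ?F c)"
    unfolding points_def by (rule card_Un_le)
  also have "card (\<Union>c\<in>I \<times> UNIV. ?F c) \<le> (\<Sum>c\<in>I \<times> (UNIV :: bool set). card (?F c))"
    using assms(3) by (intro card_UN_le) auto
  also have "\<dots> \<le> (\<Sum>c\<in>I \<times> (UNIV :: bool set). Suc n ^ (config.dim U - 1))"
    using slice by (intro sum_mono) blast
  also have "\<dots> = 2 * card I * Suc n ^ (config.dim U - 1)"
    by (simp add: card_cartesian_product)
  finally show "points I U (Suc n) \<le> points I U n + 2 * card I * Suc n ^ (config.dim U - 1)" by simp
qed

text \<open>Configurations of disjoint sets of pieces without common equations are chosen independently.\<close>

lemma points_product:
  assumes "I \<inter> J = {}" "finite I" "finite J" "supp S \<subseteq> I" "supp T \<subseteq> J"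
  shows "points (I \<union> J) (sol (I \<union> J) (S \<union> T)) n = points I (sol I S) n * points J (sol J T) n"
proof -
  let ?A = "sol I S \<inter> grid I n" and ?B = "sol J T \<inter> grid J n"
  define r :: "nat set \<Rightarrow> config \<Rightarrow> config" where "r K u = (\<lambda>i. if i \<in> K then u i else 0)" for K u
  have S: "i \<in> I \<and> j \<in> I" if "(m, i, j) \<in> S" for m i j using that assms(4) by (auto simp: supp_def)
  have T: "i \<in> J \<and> j \<in> J" if "(m, i, j) \<in> T" for m i j using that assms(5) by (auto simp: supp_def)
  have dis: "i \<in> I \<Longrightarrow> i \<notin> J" "i \<in> J \<Longrightarrow> i \<notin> I" for i using assms(1) by auto
  have cong: "defect m i j z = defect m i j w" if "z i = w i" "z j = w j" for m i j z w
    using that by (simp add: defect_def)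
  have sum: "(z + w) i = z i" if "z \<in> config_space I" "w \<in> config_space J" "i \<in> I" for z w :: config and i
    using that dis by (simp add: config_space_def)
  have sum': "(z + w) i = w i" if "z \<in> config_space I" "w \<in> config_space J" "i \<in> J" for z w :: config and i
    using that dis by (simp add: config_space_def)
  have "bij_betw (\<lambda>(z, w). z + w) (?A \<times> ?B) (sol (I \<union> J) (S \<union> T) \<inter> grid (I \<union> J) n)"
  proof (rule bij_betw_byWitness[where f' = "\<lambda>u. (r I u, r J u)"])
    show "\<forall>a\<in>?A \<times> ?B. (r I (case a of (z, w) \<Rightarrow> z + w), r J (case a of (z, w) \<Rightarrow> z + w)) = a"
    proof
      fix a assume "a \<in> ?A \<times> ?B"
      then obtain z w where a: "a = (z, w)" "z \<in> config_space I" "w \<in> config_space J"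
        by (auto simp: sol_def)
      have "r I (z + w) = z" "r J (z + w) = w"
        using sum[OF a(2,3)] sum'[OF a(2,3)] a(2,3) by (auto simp: r_def config_space_def fun_eq_iff)
      then show "(r I (case a of (z, w) \<Rightarrow> z + w), r J (case a of (z, w) \<Rightarrow> z + w)) = a" using a by simp
    qed
    show "\<forall>u\<in>sol (I \<union> J) (S \<union> T) \<inter> grid (I \<union> J) n. (case (r I u, r J u) of (z, w) \<Rightarrow> z + w) = u"
      using dis by (auto simp: sol_def config_space_def r_def fun_eq_iff)
    show "(\<lambda>(z, w). z + w) ` (?A \<times> ?B) \<subseteq> sol (I \<union> J) (S \<union> T) \<inter> grid (I \<union> J) n"
    proof safe
      fix z w assume zw: "z \<in> sol I S" "z \<in> grid I n" "w \<in> sol J T" "w \<in> grid J n"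
      then have cs: "z \<in> config_space I" "w \<in> config_space J" by (auto simp: sol_def)
      have "defect m i j (z + w) = 0" if "(m, i, j) \<in> S" for m i j
        using zw(1) that S[OF that] cong[of "z + w" i z j m] sum[OF cs] by (metis mem_sol_iff)
      moreover have "defect m i j (z + w) = 0" if "(m, i, j) \<in> T" for m i j
        using zw(3) that T[OF that] cong[of "z + w" i w j m] sum'[OF cs] by (metis mem_sol_iff)
      moreover have "z + w \<in> config_space (I \<union> J)" using cs by (auto simp: config_space_def)
      ultimately show "z + w \<in> sol (I \<union> J) (S \<union> T)" by (auto simp: mem_sol_iff)
      have "coord (i, b) (z + w) \<in> real_of_int ` {1..int n}" if "i \<in> I \<union> J" for i b
      proof (cases "i \<in> I")
        case True
        then have "coord (i, b) (z + w) = coord (i, b) z" using sum[OF cs] by (simp add: coord_def)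
        then show ?thesis using True zw(2) by (auto simp: grid_def)
      next
        case False
        then have "coord (i, b) (z + w) = coord (i, b) w" using sum'[OF cs] that by (simp add: coord_def)
        then show ?thesis using False that zw(4) by (auto simp: grid_def)
      qed
      then show "z + w \<in> grid (I \<union> J) n" using cs by (auto simp: grid_def config_space_def)
    qed
    show "(\<lambda>u. (r I u, r J u)) ` (sol (I \<union> J) (S \<union> T) \<inter> grid (I \<union> J) n) \<subseteq> ?A \<times> ?B"
    proof (rule image_subsetI)
      fix u assume u: "u \<in> sol (I \<union> J) (S \<union> T) \<inter> grid (I \<union> J) n"
      have "defect m i j (r I u) = 0" if "(m, i, j) \<in> S" for m i j
      proof -
        have "u \<in> sol (I \<union> J) (S \<union> T)" using u by blast
        then have "defect m i j u = 0" using that by (simp only: mem_sol_iff) blast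
        then show ?thesis using S[OF that] cong[of "r I u" i u j m] by (simp add: r_def)
      qed
      moreover have "defect m i j (r J u) = 0" if "(m, i, j) \<in> T" for m i j
      proof -
        have "u \<in> sol (I \<union> J) (S \<union> T)" using u by blast
        then have "defect m i j u = 0" using that by (simp only: mem_sol_iff) blast
        then show ?thesis using T[OF that] cong[of "r J u" i u j m] by (simp add: r_def)
      qed
      moreover have "r K u \<in> grid K n" if "K \<subseteq> I \<union> J" for K
      proof -
        have "coord (i, b) (r K u) \<in> real_of_int ` {1..int n}" if "i \<in> K" for i b
        proof -
          have "coord (i, b) (r K u) = coord (i, b) u" using that by (simp add: r_def coord_def)
          then show ?thesis using grid_coord[of u "I \<union> J" n "(i, b)"] u that \<open>K \<subseteq> I \<union> J\<close> by auto
        qed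
        then show ?thesis by (auto simp: grid_def config_space_def r_def)
      qed
      moreover have "r K u \<in> config_space K" for K by (simp add: config_space_def r_def)
      ultimately show "(r I u, r J u) \<in> ?A \<times> ?B" by (auto simp: mem_sol_iff)
    qed
  qed
  then have "card (?A \<times> ?B) = card (sol (I \<union> J) (S \<union> T) \<inter> grid (I \<union> J) n)"
    by (rule bij_betw_same_card)
  then show ?thesis by (simp add: points_def card_cartesian_product)
qed

lemma points_single: "points {i} (config_space {i}) n = n\<^sup>2"
proof -
  let ?R = "real_of_int ` {1..int n}"
  let ?f = "\<lambda>z :: config. z i" and ?g = "\<lambda>p k. if k = i then p else (0 :: real \<times> real)"
  have grid: "z \<in> config_space {i} \<inter> grid {i} n \<longleftrightarrow> z \<in> config_space {i} \<and> z i \<in> ?R \<times> ?R" for z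
    by (auto simp: grid_def coord_def mem_Times_iff all_bool_eq)
  have "bij_betw ?f (config_space {i} \<inter> grid {i} n) (?R \<times> ?R)"
  proof (rule bij_betw_byWitness[where f' = ?g])
    show "\<forall>z\<in>config_space {i} \<inter> grid {i} n. ?g (?f z) = z"
      by (simp add: config_space_def fun_eq_iff)
    show "?f ` (config_space {i} \<inter> grid {i} n) \<subseteq> ?R \<times> ?R"
      unfolding image_subset_iff using grid by blast
    show "?g ` (?R \<times> ?R) \<subseteq> config_space {i} \<inter> grid {i} n"
    proof (intro image_subsetI)
      fix p assume "p \<in> ?R \<times> ?R"
      then show "?g p \<in> config_space {i} \<inter> grid {i} n"
        using grid[of "?g p"] by (simp add: config_space_def)
    qed
  qed simp
  from bij_betw_same_card[OF this] show ?thesis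
    by (simp add: points_def card_cartesian_product finite_coords power2_eq_square)
qed

lemma points_config_space:
  assumes "finite I"
  shows "points I (config_space I) n = n ^ (2 * card I)"
  using assms
proof induction
  case empty
  have "config_space {} \<inter> grid {} n = {0}" by (auto simp: grid_def config_space_def fun_eq_iff)
  then show ?case by (simp add: points_def)
next
  case (insert i I)
  have "points ({i} \<union> I) (sol ({i} \<union> I) ({} \<union> {})) n = n\<^sup>2 * n ^ (2 * card I)"
    using insert by (subst points_product) (auto simp: sol_empty points_single)
  then show ?case using insert by (simp add: sol_empty power_add[symmetric])
qed

lemma points_extend:
  assumes "finite I" "K \<subseteq> I" "supp S \<subseteq> K"
  shows "points I (sol I S) n = points K (sol K S) n * n ^ (2 * (card I - card K))"
proof -
  have fin: "finite K" "finite (I - K)" using assms finite_subset by auto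
  have "points (K \<union> (I - K)) (sol (K \<union> (I - K)) (S \<union> {})) n = points K (sol K S) n * n ^ (2 * card (I - K))"
    using assms fin by (subst points_product) (auto simp: sol_empty points_config_space)
  then show ?thesis using assms fin by (simp add: Un_absorb1 card_Diff_subset)
qed

definition equation_form :: "equation \<Rightarrow> ((nat \<times> bool) option \<Rightarrow> int) \<Rightarrow> int" where
  "equation_form = (\<lambda>(m, i, j) e. snd m * (e (Some (j, True)) - e (Some (i, True)))
     - fst m * (e (Some (j, False)) - e (Some (i, False))))"

lemma equation_form_linear: "equation_form s \<in> linear_forms"
proof -
  obtain m i j where s: "s = (m, i, j)" by (cases s)
  show ?thesis
    unfolding s equation_form_def prod.case
    by (intro linear_forms_diff linear_forms.scale linear_forms.var)
qed

text \<open>The coordinates of the pieces become the variables \<open>Some (i, b)\<close>, and \<open>None\<close> holds the side length.\<close>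

lemma quasipoly_points:
  assumes "finite I" "finite S" "supp S \<subseteq> I"
  shows "quasipoly (\<lambda>n. real (points I (sol I S) n))"
proof -
  define V where "V = Some ` (I \<times> (UNIV :: bool set))"
  define ext where "ext n g v = (if v \<in> V then g v else if v = None then int n else 0)"
    for n and g :: "(nat \<times> bool) option \<Rightarrow> int" and v
  let ?A = "\<lambda>n. {g \<in> V \<rightarrow>\<^sub>E {1..int n}. \<forall>s\<in>S. equation_form s (ext n g) = 0}"
  define \<Phi> :: "((nat \<times> bool) option \<Rightarrow> int) \<Rightarrow> config"
    where "\<Phi> g = (\<lambda>i. if i \<in> I then (of_int (g (Some (i, True))), of_int (g (Some (i, False)))) else 0)" for g
  define \<Psi> :: "config \<Rightarrow> (nat \<times> bool) option \<Rightarrow> int"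
    where "\<Psi> z = (\<lambda>v\<in>V. \<lfloor>coord (the v) z\<rfloor>)" for z
  have S: "i \<in> I \<and> j \<in> I" if "(m, i, j) \<in> S" for m i j using that assms(3) by (auto simp: supp_def)
  have V: "Some (i, b) \<in> V \<longleftrightarrow> i \<in> I" for i b by (auto simp: V_def)
  have coord: "coord (i, b) (\<Phi> g) = of_int (g (Some (i, b)))" if "i \<in> I" for i b g
    using that by (simp add: \<Phi>_def coord_def)
  have form: "defect m i j (\<Phi> g) = of_int (equation_form (m, i, j) (ext n g))" if "(m, i, j) \<in> S" for m i j n g
    using S[OF that] by (simp add: defect_def \<Phi>_def equation_form_def ext_def V)
  have cs: "\<Phi> g \<in> config_space I" for g by (simp add: \<Phi>_def config_space_def)
  have "card (?A n) = points I (sol I S) n" for n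
    unfolding points_def
  proof (rule bij_betw_same_card[of \<Phi>], rule bij_betw_byWitness[where f' = \<Psi>])
    show "\<forall>g\<in>?A n. \<Psi> (\<Phi> g) = g"
    proof
      fix g assume g: "g \<in> ?A n"
      show "\<Psi> (\<Phi> g) = g"
      proof
        fix v show "\<Psi> (\<Phi> g) v = g v"
        proof (cases "v \<in> V")
          case True
          then obtain i b where "v = Some (i, b)" "i \<in> I" by (auto simp: V_def)
          then show ?thesis using coord by (simp add: \<Psi>_def V)
        next
          case False
          then have "g v = undefined" using g by (auto intro: PiE_arb)
          then show ?thesis using False by (simp add: \<Psi>_def)
        qed
      qed
    qed
    show "\<forall>z\<in>sol I S \<inter> grid I n. \<Phi> (\<Psi> z) = z"
    proof
      fix z assume z: "z \<in> sol I S \<inter> grid I n"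
      show "\<Phi> (\<Psi> z) = z"
        unfolding config_eq_iff
      proof
        fix c show "coord c (\<Phi> (\<Psi> z)) = coord c z"
        proof (cases "fst c \<in> I")
          case True
          then obtain k where "coord c z = of_int k" using grid_coord[of z I n c] z by auto
          then show ?thesis using True coord[of "fst c" "snd c" "\<Psi> z"] by (cases c) (simp add: \<Psi>_def V)
        next
          case False
          then show ?thesis using coord_outside z cs by (metis IntD1 sol_subset subsetD)
        qed
      qed
    qed
    show "\<Phi> ` ?A n \<subseteq> sol I S \<inter> grid I n"
    proof (rule image_subsetI)
      fix g assume g: "g \<in> ?A n"
      have "defect m i j (\<Phi> g) = 0" if "(m, i, j) \<in> S" for m i j
      proof -
        have "equation_form (m, i, j) (ext n g) = 0" using g that by blast
        then show ?thesis using form[OF that, of g n] by simp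
      qed
      then have "\<Phi> g \<in> sol I S" using cs by (simp add: mem_sol_iff)
      moreover have "coord c (\<Phi> g) \<in> real_of_int ` {1..int n}" if "c \<in> I \<times> UNIV" for c
      proof -
        obtain i b where c: "c = (i, b)" "i \<in> I" using \<open>c \<in> I \<times> UNIV\<close> by (cases c) auto
        then have "g (Some c) \<in> {1..int n}" using g by (auto simp: V PiE_iff)
        then show ?thesis using coord[OF c(2)] c(1) by simp
      qed
      ultimately show "\<Phi> g \<in> sol I S \<inter> grid I n" using cs by (simp add: grid_def)
    qed
    show "\<Psi> ` (sol I S \<inter> grid I n) \<subseteq> ?A n"
    proof (rule image_subsetI)
      fix z assume z: "z \<in> sol I S \<inter> grid I n"
      have val: "of_int (\<Psi> z (Some (i, b))) = coord (i, b) z \<and> \<Psi> z (Some (i, b)) \<in> {1..int n}" if iI: "i \<in> I" for i b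
      proof -
        obtain k where "coord (i, b) z = of_int k" "k \<in> {1..int n}"
          using grid_coord[of z I n "(i, b)"] z iI by auto
        then show ?thesis using iI by (simp add: \<Psi>_def V)
      qed
      have "\<Psi> z \<in> V \<rightarrow>\<^sub>E {1..int n}"
      proof (rule PiE_I)
        fix v assume "v \<in> V"
        then show "\<Psi> z v \<in> {1..int n}" using val by (auto simp: V_def)
      qed (simp add: \<Psi>_def)
      moreover have "equation_form s (ext n (\<Psi> z)) = 0" if "s \<in> S" for s
      proof -
        obtain m i j where s: "s = (m, i, j)" by (cases s)
        have "defect m i j z = 0" using z that unfolding s by (simp only: Int_iff mem_sol_iff)
        moreover have "\<Phi> (\<Psi> z) = z"
          unfolding config_eq_iff
        proof
          fix c show "coord c (\<Phi> (\<Psi> z)) = coord c z"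
          proof (cases "fst c \<in> I")
            case True
            then show ?thesis using val[of "fst c" "snd c"] coord[of "fst c" "snd c" "\<Psi> z"] by simp
          next
            case False
            then show ?thesis using coord_outside z cs by (metis IntD1 sol_subset subsetD)
          qed
        qed
        ultimately show ?thesis using form[of m i j "\<Psi> z" n] that by (simp add: s)
      qed
      ultimately show "\<Psi> z \<in> ?A n" by blast
    qed
  qed
  moreover have "quasipoly (\<lambda>n. real (card (?A n)))"
    using quasipoly_homogeneous_system[of V None S equation_form] assms(1,2) equation_form_linear
    unfolding ext_def V_def by auto
  ultimately show ?thesis by simp
qed

section \<open>The intersection lattice\<close>

lemma rider_moves_nonzero: "rider_moves M \<Longrightarrow> (0, 0) \<notin> M"
  unfolding rider_moves_def by auto

lemma rider_moves_finite: "rider_moves M \<Longrightarrow> finite M"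
  unfolding rider_moves_def by auto

lemma hyperplane_sol: "hyperplane q m i j = sol {1..q} {(m, i, j)}"
  by (auto simp: hyperplane_def sol_def)

lemma arrangement_eqs: "arrangement M q = (\<lambda>e. sol {1..q} {e}) ` eqs M {1..q}"
  unfolding arrangement_def eqs_def hyperplane_sol by fastforce

lemma sol_Inter: "sol I S = config_space I \<inter> (\<Inter>e\<in>S. sol I {e})"
  by (auto simp: sol_def)

lemma int_lattice_sol: "int_lattice M q = sol {1..q} ` Pow (eqs M {1..q})"
proof -
  have "Pow (arrangement M q) = image (\<lambda>e. sol {1..q} {e}) ` Pow (eqs M {1..q})"
    unfolding arrangement_eqs by (rule image_Pow_surj[OF refl, symmetric])
  then show ?thesis
    unfolding int_lattice_def by (simp add: image_image sol_Inter[symmetric])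
qed

lemma finite_int_lattice: "finite M \<Longrightarrow> finite (int_lattice M q)"
  unfolding int_lattice_sol by (simp add: finite_eqs)

lemma config_space_in_lattice: "config_space {1..q} \<in> int_lattice M q"
  unfolding int_lattice_sol using sol_empty by blast

lemma equations_sol: "equations M q U = {e \<in> eqs M {1..q}. U \<subseteq> sol {1..q} {e}}"
  unfolding equations_def eqs_def hyperplane_sol by fastforce

lemma equations_eqs: "equations M q U \<subseteq> eqs M {1..q}"
  unfolding equations_sol by blast

lemma subset_sol_iff_equations:
  assumes "S \<subseteq> eqs M {1..q}" "U \<subseteq> config_space {1..q}"
  shows "U \<subseteq> sol {1..q} S \<longleftrightarrow> S \<subseteq> equations M q U"
  using assms unfolding equations_sol by (subst sol_Inter) blast

lemma sol_equations:
  assumes "S \<subseteq> eqs M {1..q}"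
  shows "sol {1..q} (equations M q (sol {1..q} S)) = sol {1..q} S" "S \<subseteq> equations M q (sol {1..q} S)"
proof -
  show "S \<subseteq> equations M q (sol {1..q} S)"
    using subset_sol_iff_equations[OF assms sol_subset, of S] by blast
  then show "sol {1..q} (equations M q (sol {1..q} S)) = sol {1..q} S"
    using subset_sol_iff_equations[of "equations M q (sol {1..q} S)" M q "sol {1..q} S", OF equations_eqs sol_subset] sol_antimono
    by (metis order_refl subset_antisym)
qed

lemma pieces_supp: "pieces M q U = supp (equations M q U)"
  by (simp add: pieces_def supp_def)

lemma pieces_sol:
  assumes "(0, 0) \<notin> M" "S \<subseteq> eqs M {1..q}"
  shows "pieces M q (sol {1..q} S) = supp S"
  unfolding pieces_supp
  using supp_sol_eq[OF assms(1,2), of "equations M q (sol {1..q} S)"] equations_eqs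
    supp_sol_eq[OF assms(1) equations_eqs assms(2), of "sol {1..q} S"] sol_equations[OF assms(2)]
  by (metis order_refl subset_antisym)

lemma pieces_subset: "pieces M q U \<subseteq> {1..q}"
  unfolding pieces_supp by (rule supp_eqs[OF equations_eqs])

subsection \<open>The Moebius function as a signed count of spanning sets\<close>

lemma sum_minus_one_power_card_Pow:
  assumes "finite A"
  shows "(\<Sum>S\<in>Pow A. (-1 :: int) ^ card S) = (if A = {} then 1 else 0)"
  using assms
proof induction
  case (insert a A)
  have "inj_on (insert a) (Pow A)" using insert(2) by (auto simp: inj_on_def)
  moreover have "Pow A \<inter> insert a ` Pow A = {}" using insert(2) by auto
  moreover have "card (insert a S) = Suc (card S)" if "S \<in> Pow A" for S
    using that insert by (metis PowD card_insert_disjoint finite_subset subsetD)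
  then have "(\<Sum>S\<in>Pow A. (-1 :: int) ^ card (insert a S)) = (\<Sum>S\<in>Pow A. - ((-1) ^ card S))"
    by (intro sum.cong refl) simp
  ultimately show ?case
    using insert by (simp add: Pow_insert sum.union_disjoint sum.reindex sum_negf)
qed simp

lemma equations_eq_empty_iff:
  assumes "(0, 0) \<notin> M" "U \<in> int_lattice M q"
  shows "equations M q U = {} \<longleftrightarrow> U = config_space {1..q}"
proof -
  obtain S where S: "S \<subseteq> eqs M {1..q}" "U = sol {1..q} S" using assms(2) by (auto simp: int_lattice_sol)
  have "equations M q (sol {1..q} {}) = {}"
    using pieces_sol[OF assms(1), of "{}" q] by (simp add: pieces_supp supp_eq_empty_iff)
  then show ?thesis using sol_equations(1)[OF S(1)] S(2) sol_empty by metis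
qed

text \<open>The signed number of equation sets that cut out \<open>U\<close> satisfies the recursion of the Moebius function: summed
  over all \<open>W \<supseteq> U\<close> it counts, with sign, all subsets of the equations valid on \<open>U\<close>, which gives \<open>0\<close> unless
  there are none.\<close>

lemma moebius_whitney:
  assumes "finite M" "(0, 0) \<notin> M" "U \<in> int_lattice M q"
  shows "moebius (int_lattice M q) (config_space {1..q}) U =
    (\<Sum>S\<in>{S \<in> Pow (eqs M {1..q}). sol {1..q} S = U}. (-1) ^ card S)"
  using assms(3)
proof (induction "card {W \<in> int_lattice M q. U \<subset> W}" arbitrary: U rule: less_induct)
  case less
  let ?L = "int_lattice M q" and ?I = "{1..q}"
  let ?w = "\<lambda>U. \<Sum>S\<in>{S \<in> Pow (eqs M ?I). sol ?I S = U}. (-1 :: int) ^ card S"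
  have finL: "finite ?L" using finite_int_lattice[OF assms(1)] .
  have finE: "finite (eqs M ?I)" using finite_eqs[OF assms(1)] by simp
  have sub: "W \<subseteq> config_space ?I" if "W \<in> ?L" for W
    using that sol_subset unfolding int_lattice_sol by blast
  have "(\<Sum>W\<in>{W \<in> ?L. U \<subseteq> W}. ?w W) = (\<Sum>S\<in>{S \<in> Pow (eqs M ?I). U \<subseteq> sol ?I S}. (-1) ^ card S)"
  proof -
    have "(\<Sum>S\<in>{S \<in> Pow (eqs M ?I). U \<subseteq> sol ?I S}. (-1 :: int) ^ card S) =
      (\<Sum>W\<in>{W \<in> ?L. U \<subseteq> W}. \<Sum>S\<in>{S \<in> {S \<in> Pow (eqs M ?I). U \<subseteq> sol ?I S}. sol ?I S = W}. (-1) ^ card S)"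
      by (rule sum.group[symmetric]) (use finE finL in \<open>auto simp: int_lattice_sol\<close>)
    also have "\<dots> = (\<Sum>W\<in>{W \<in> ?L. U \<subseteq> W}. ?w W)"
      by (intro sum.cong refl) auto
    finally show ?thesis by simp
  qed
  also have "{S \<in> Pow (eqs M ?I). U \<subseteq> sol ?I S} = Pow (equations M q U)"
    using subset_sol_iff_equations[OF _ sub[OF less(2)]] equations_eqs[of M q U] by (auto; blast)
  also have "(\<Sum>S\<in>Pow (equations M q U). (-1 :: int) ^ card S) = (if equations M q U = {} then 1 else 0)"
    by (rule sum_minus_one_power_card_Pow[OF finite_subset[OF equations_eqs finE]])
  also have "equations M q U = {} \<longleftrightarrow> U = config_space ?I"
    by (rule equations_eq_empty_iff[OF assms(2) less(2)])
  finally have total: "(\<Sum>W\<in>{W \<in> ?L. U \<subseteq> W}. ?w W) = (if U = config_space ?I then 1 else 0)" .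
  have split: "{W \<in> ?L. U \<subseteq> W} = insert U {W \<in> ?L. U \<subset> W}" using less(2) by auto
  have "(\<Sum>W\<in>{W \<in> ?L. U \<subset> W}. ?w W) = (\<Sum>W\<in>{W \<in> ?L. U \<subset> W}. moebius ?L (config_space ?I) W)"
  proof (intro sum.cong refl)
    fix W assume W: "W \<in> {W \<in> ?L. U \<subset> W}"
    then have "card {X \<in> ?L. W \<subset> X} < card {X \<in> ?L. U \<subset> X}"
      using finL by (intro psubset_card_mono) auto
    then show "?w W = moebius ?L (config_space ?I) W" using less(1)[of W] W by simp
  qed
  then have w: "?w U = (if U = config_space ?I then 1 else 0) -
      (\<Sum>W\<in>{W \<in> ?L. U \<subset> W}. moebius ?L (config_space ?I) W)"
    using total finL unfolding split by (subst (asm) sum.insert) auto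
  have set: "{W \<in> ?L. U \<subset> W \<and> W \<subseteq> config_space ?I} = {W \<in> ?L. U \<subset> W}" using sub by blast
  show ?case
  proof (cases "U = config_space ?I")
    case True
    then have E: "{W \<in> ?L. U \<subset> W} = {}" using sub by blast
    have "?w U = 1" using w True unfolding E by simp
    then show ?thesis using True finL less(2) by (subst moebius.simps) simp
  next
    case False
    then show ?thesis using w finL less(2) sub[OF less(2)] config_space_in_lattice[of q M]
      by (subst moebius.simps, subst set) simp
  qed
qed

subsection \<open>Inclusion and exclusion\<close>

text \<open>Since \<open>c\<close> and \<open>d\<close> are coprime, an integer vector parallel to \<open>(c, d)\<close> is an integer multiple of it.\<close>

lemma attack_iff:
  assumes "rider_moves M"
  shows "attack M z z' \<longleftrightarrow> (\<exists>m\<in>M. snd m * (fst z' - fst z) = fst m * (snd z' - snd z))"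
proof
  assume "attack M z z'"
  then obtain c d k where m: "(c, d) \<in> M" "z' - z = (k * c, k * d)" unfolding attack_def by blast
  from m(2) have "fst z' - fst z = k * c" "snd z' - snd z = k * d" by (auto simp: prod_eq_iff)
  then show "\<exists>m\<in>M. snd m * (fst z' - fst z) = fst m * (snd z' - snd z)"
    using m(1) by (intro bexI[of _ "(c, d)"]) auto
next
  assume "\<exists>m\<in>M. snd m * (fst z' - fst z) = fst m * (snd z' - snd z)"
  then obtain c d where m: "(c, d) \<in> M" "d * (fst z' - fst z) = c * (snd z' - snd z)" by force
  have cop: "coprime c d" "(c, d) \<noteq> (0, 0)" using assms m(1) unfolding rider_moves_def by auto
  let ?x = "fst z' - fst z" and ?y = "snd z' - snd z"
  have "\<exists>k. ?x = k * c \<and> ?y = k * d"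
  proof (cases "c = 0")
    case True
    then have d: "d \<noteq> 0" "\<bar>d\<bar> = 1" using cop by auto
    then have "?x = 0" using m(2) True by simp
    moreover have "?y = (?y * d) * d" using d(2) by (metis abs_mult_self_eq mult.assoc mult.right_neutral)
    ultimately show ?thesis using True by (intro exI[of _ "?y * d"]) simp
  next
    case False
    have "c dvd d * ?x" using m(2) by simp
    then have "c dvd ?x" using cop(1) by (simp add: coprime_dvd_mult_right_iff)
    then obtain k where k: "?x = c * k" by (elim dvdE)
    then have "c * (d * k) = c * ?y" using m(2) by (simp add: mult_ac)
    then have "?y = d * k" using False by simp
    then show ?thesis using k by (intro exI[of _ k]) (simp add: mult.commute)
  qed
  then obtain k where "z' - z = (k * c, k * d)" by (auto simp: prod_eq_iff)
  then show "attack M z z'" unfolding attack_def using m(1) by blast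
qed

lemma o_count_grid:
  assumes "rider_moves M"
  shows "o_count M q n = card {z \<in> grid {1..q} n. \<forall>(m, i, j)\<in>eqs M {1..q}. \<not> on_hyperplane m i j z}"
proof -
  let ?I = "{1..q}"
  define \<Phi> :: "(nat \<Rightarrow> int \<times> int) \<Rightarrow> config" where
    "\<Phi> z = (\<lambda>i. if i \<in> ?I then (of_int (fst (z i)), of_int (snd (z i))) else 0)" for z
  define \<Psi> :: "config \<Rightarrow> nat \<Rightarrow> int \<times> int" where
    "\<Psi> w = (\<lambda>i\<in>?I. (\<lfloor>fst (w i)\<rfloor>, \<lfloor>snd (w i)\<rfloor>))" for w
  let ?A = "{z \<in> ?I \<rightarrow>\<^sub>E board n. \<forall>i\<in>?I. \<forall>j\<in>?I. i \<noteq> j \<longrightarrow> \<not> attack M (z i) (z j)}"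
  let ?B = "{z \<in> grid ?I n. \<forall>(m, i, j)\<in>eqs M ?I. \<not> on_hyperplane m i j z}"
  have attack: "(\<forall>i\<in>?I. \<forall>j\<in>?I. i \<noteq> j \<longrightarrow> \<not> attack M (z i) (z j)) \<longleftrightarrow>
      (\<forall>(m, i, j)\<in>eqs M ?I. \<not> on_hyperplane m i j (\<Phi> z))" for z
  proof -
    have "a * (x - y) = b * (u - v) \<longleftrightarrow> a * (y - x) = b * (v - u)" for a b x y u v :: int
      by (simp add: algebra_simps) linarith
    then have sym: "attack M (z i) (z j) \<longleftrightarrow> attack M (z j) (z i)" for i j
      unfolding attack_iff[OF assms] by blast
    have "(\<forall>i\<in>?I. \<forall>j\<in>?I. i \<noteq> j \<longrightarrow> \<not> attack M (z i) (z j)) \<longleftrightarrow>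
      (\<forall>i\<in>?I. \<forall>j\<in>?I. i < j \<longrightarrow> \<not> attack M (z i) (z j))"
      using sym by (metis nat_neq_iff)
    also have "\<dots> \<longleftrightarrow> (\<forall>i\<in>?I. \<forall>j\<in>?I. i < j \<longrightarrow> (\<forall>m\<in>M. \<not> on_hyperplane m i j (\<Phi> z)))"
    proof -
      have "attack M (z i) (z j) \<longleftrightarrow> (\<exists>m\<in>M. on_hyperplane m i j (\<Phi> z))" if "i \<in> ?I" "j \<in> ?I" for i j
        using that unfolding attack_iff[OF assms] on_hyperplane_def \<Phi>_def
        by (simp flip: of_int_mult of_int_diff)
      then show ?thesis by blast
    qed
    also have "\<dots> \<longleftrightarrow> (\<forall>(m, i, j)\<in>eqs M ?I. \<not> on_hyperplane m i j (\<Phi> z))"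
      unfolding eqs_def by blast
    finally show ?thesis .
  qed
  have grid: "\<Phi> z \<in> grid ?I n" if "z \<in> ?I \<rightarrow>\<^sub>E board n" for z
  proof -
    have "fst (z i) \<in> {1..int n} \<and> snd (z i) \<in> {1..int n}" if "i \<in> ?I" for i
      using PiE_mem[OF \<open>z \<in> ?I \<rightarrow>\<^sub>E board n\<close> that] by (auto simp: board_def)
    then have "coord (i, b) (\<Phi> z) \<in> real_of_int ` {1..int n}" if "i \<in> ?I" for i b
      using that by (simp add: coord_def \<Phi>_def)
    then show ?thesis by (auto simp: grid_def config_space_def \<Phi>_def)
  qed
  have "bij_betw \<Phi> ?A ?B"
  proof (rule bij_betw_byWitness[where f' = \<Psi>])
    show "\<forall>z\<in>?A. \<Psi> (\<Phi> z) = z"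
    proof
      fix z assume "z \<in> ?A"
      then have z: "z \<in> ?I \<rightarrow>\<^sub>E board n" by blast
      show "\<Psi> (\<Phi> z) = z"
      proof
        fix i show "\<Psi> (\<Phi> z) i = z i"
        proof (cases "i \<in> ?I")
          case False
          then show ?thesis using PiE_arb[OF z False] unfolding \<Psi>_def by (simp only: restrict_def if_False)
        qed (simp add: \<Psi>_def \<Phi>_def)
      qed
    qed
    have inv: "\<Phi> (\<Psi> w) = w \<and> \<Psi> w \<in> ?I \<rightarrow>\<^sub>E board n" if w: "w \<in> grid ?I n" for w
    proof -
      have val: "of_int \<lfloor>fst (w i)\<rfloor> = fst (w i) \<and> \<lfloor>fst (w i)\<rfloor> \<in> {1..int n}"
        "of_int \<lfloor>snd (w i)\<rfloor> = snd (w i) \<and> \<lfloor>snd (w i)\<rfloor> \<in> {1..int n}" if "i \<in> ?I" for i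
        using grid_coord[OF w, of "(i, True)"] grid_coord[OF w, of "(i, False)"] that
        by (auto simp: coord_def)
      have "\<Phi> (\<Psi> w) i = w i" for i
      proof (cases "i \<in> ?I")
        case True
        have "\<Phi> (\<Psi> w) i = (of_int \<lfloor>fst (w i)\<rfloor>, of_int \<lfloor>snd (w i)\<rfloor>)"
          using True by (simp add: \<Phi>_def \<Psi>_def)
        also have "\<dots> = w i" using val[OF True] by (simp only: prod.collapse)
        finally show ?thesis .
      next
        case False
        then have "w i = 0" using w by (auto simp: grid_def config_space_def)
        then show ?thesis using False unfolding \<Phi>_def by (simp only: if_False)
      qed
      moreover have "\<Psi> w \<in> ?I \<rightarrow>\<^sub>E board n"
      proof (rule PiE_I)
        fix i assume "i \<in> ?I"
        then show "\<Psi> w i \<in> board n" using val[of i] by (simp add: \<Psi>_def board_def)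
      next
        fix i assume "i \<notin> ?I"
        then show "\<Psi> w i = undefined" unfolding \<Psi>_def by (simp only: restrict_def if_False)
      qed
      ultimately show ?thesis by blast
    qed
    show "\<forall>w\<in>?B. \<Phi> (\<Psi> w) = w" using inv by blast
    show "\<Phi> ` ?A \<subseteq> ?B" using attack grid by blast
    show "\<Psi> ` ?B \<subseteq> ?A"
    proof (rule image_subsetI)
      fix w assume w: "w \<in> ?B"
      then show "\<Psi> w \<in> ?A" using inv[of w] attack[of "\<Psi> w"] by simp
    qed
  qed
  then show ?thesis unfolding o_count_def by (rule bij_betw_same_card)
qed

text \<open>A configuration is counted with weight \<open>\<Sum>(-1)\<^bsup>|S|\<^esup>\<close> over the sets \<open>S\<close> of equations that hold for it, and this
  weight vanishes unless no equation holds.\<close>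

lemma o_count_inclusion_exclusion:
  assumes "rider_moves M"
  shows "real (o_count M q n) =
    (\<Sum>S\<in>Pow (eqs M {1..q}). (-1) ^ card S * real (points {1..q} (sol {1..q} S) n))"
proof -
  let ?I = "{1..q}"
  have finE: "finite (eqs M ?I)" using finite_eqs[OF rider_moves_finite[OF assms]] by simp
  have finG: "finite (grid ?I n)" using finite_grid by simp
  have "(\<Sum>S\<in>Pow (eqs M ?I). (-1) ^ card S * int (points ?I (sol ?I S) n)) =
    (\<Sum>S\<in>Pow (eqs M ?I). \<Sum>z\<in>grid ?I n. if z \<in> sol ?I S then (-1) ^ card S else 0)"
    using finG by (intro sum.cong refl) (simp add: points_def sum.If_cases Int_commute)
  also have "\<dots> = (\<Sum>z\<in>grid ?I n. \<Sum>S\<in>Pow (eqs M ?I). if z \<in> sol ?I S then (-1) ^ card S else 0)"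
    by (rule sum.swap)
  also have "\<dots> = (\<Sum>z\<in>grid ?I n. if \<forall>(m, i, j)\<in>eqs M ?I. \<not> on_hyperplane m i j z then 1 else 0)"
  proof (intro sum.cong refl)
    fix z assume z: "z \<in> grid ?I n"
    define A where "A = {(m, i, j) \<in> eqs M ?I. on_hyperplane m i j z}"
    have "(\<Sum>S\<in>Pow (eqs M ?I). if z \<in> sol ?I S then (-1 :: int) ^ card S else 0) =
      (\<Sum>S\<in>Pow (eqs M ?I) \<inter> {S. z \<in> sol ?I S}. (-1) ^ card S)"
      using finE by (simp add: sum.If_cases)
    also have "Pow (eqs M ?I) \<inter> {S. z \<in> sol ?I S} = Pow A"
      using z by (fastforce simp: sol_def A_def grid_def)
    also have "(\<Sum>S\<in>Pow A. (-1 :: int) ^ card S) = (if A = {} then 1 else 0)"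
      by (rule sum_minus_one_power_card_Pow, rule finite_subset[OF _ finE]) (auto simp: A_def)
    also have "A = {} \<longleftrightarrow> (\<forall>(m, i, j)\<in>eqs M ?I. \<not> on_hyperplane m i j z)"
      unfolding A_def by blast
    finally show "(\<Sum>S\<in>Pow (eqs M ?I). if z \<in> sol ?I S then (-1 :: int) ^ card S else 0) =
      (if \<forall>(m, i, j)\<in>eqs M ?I. \<not> on_hyperplane m i j z then 1 else 0)" .
  qed
  also have "\<dots> = int (o_count M q n)"
    using finG unfolding o_count_grid[OF assms] by (simp add: sum.If_cases Int_def)
  finally have "real_of_int (int (o_count M q n)) =
      real_of_int (\<Sum>S\<in>Pow (eqs M ?I). (-1) ^ card S * int (points ?I (sol ?I S) n))" by simp
  then show ?thesis by simp
qed

text \<open>Sums weighted by the Moebius function become sums over sets of equations, which are easier to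
  enumerate and to compare for different numbers of pieces.\<close>

lemma sum_over_lattice:
  assumes "finite M" "(0, 0) \<notin> M"
  shows "(\<Sum>U\<in>{U \<in> int_lattice M q. P U}. of_int (moebius (int_lattice M q) (config_space {1..q}) U) * (f U :: real)) =
    (\<Sum>S\<in>{S \<in> Pow (eqs M {1..q}). P (sol {1..q} S)}. (-1) ^ card S * f (sol {1..q} S))"
proof -
  let ?I = "{1..q}"
  have finE: "finite (eqs M ?I)" using finite_eqs[OF assms(1)] by simp
  have finL: "finite (int_lattice M q)" by (rule finite_int_lattice[OF assms(1)])
  have "(\<Sum>S\<in>{S \<in> Pow (eqs M ?I). P (sol ?I S)}. (-1) ^ card S * f (sol ?I S)) =
    (\<Sum>U\<in>{U \<in> int_lattice M q. P U}.
      \<Sum>S\<in>{S \<in> {S \<in> Pow (eqs M ?I). P (sol ?I S)}. sol ?I S = U}. (-1) ^ card S * f (sol ?I S))"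
    by (rule sum.group[symmetric]) (use finE finL in \<open>auto simp: int_lattice_sol\<close>)
  also have "\<dots> = (\<Sum>U\<in>{U \<in> int_lattice M q. P U}. of_int (moebius (int_lattice M q) (config_space ?I) U) * f U)"
  proof (intro sum.cong refl)
    fix U assume U: "U \<in> {U \<in> int_lattice M q. P U}"
    then have e: "{S \<in> {S \<in> Pow (eqs M ?I). P (sol ?I S)}. sol ?I S = U} = {S \<in> Pow (eqs M ?I). sol ?I S = U}"
      by auto
    show "(\<Sum>S\<in>{S \<in> {S \<in> Pow (eqs M ?I). P (sol ?I S)}. sol ?I S = U}. (-1) ^ card S * f (sol ?I S)) =
      of_int (moebius (int_lattice M q) (config_space ?I) U) * f U"
      unfolding e using U by (subst moebius_whitney[OF assms]) (auto simp: sum_distrib_right)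
  qed
  finally show ?thesis by simp
qed

lemma o_count_lattice:
  assumes "rider_moves M"
  shows "real (o_count M q n) = (\<Sum>U\<in>int_lattice M q.
    of_int (moebius (int_lattice M q) (config_space {1..q}) U) * real (points {1..q} U n))"
  using sum_over_lattice[OF rider_moves_finite[OF assms] rider_moves_nonzero[OF assms], where P = "\<lambda>_. True"]
  by (simp add: o_count_inclusion_exclusion[OF assms] Pow_def)

section \<open>The counting quasipolynomials of the subspaces\<close>

lemma essential_part_sol: "essential_part M q U = sol (pieces M q U) (equations M q U)"
  by (simp add: essential_part_def sol_def)

text \<open>The integers strictly between \<open>0\<close> and \<open>n + 1\<close> are the coordinates \<open>1, \<dots>, n\<close> of the board.\<close>

lemma alpha_points: "alpha M q U n = real (points (pieces M q U) (sol (pieces M q U) (equations M q U)) n)"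
proof -
  let ?K = "pieces M q U" and ?E = "equations M q U"
  define r where "r = real n + 1"
  have r: "r > 0" by (simp add: r_def)
  have "z \<in> integer_points \<inter> cscale r ` (open_cube ?K \<inter> sol ?K ?E) \<longleftrightarrow> z \<in> sol ?K ?E \<inter> grid ?K n" for z
  proof
    assume "z \<in> integer_points \<inter> cscale r ` (open_cube ?K \<inter> sol ?K ?E)"
    then obtain w where w: "z = cscale r w" "w \<in> open_cube ?K" "w \<in> sol ?K ?E" and z: "z \<in> integer_points" by blast
    have zs: "z \<in> sol ?K ?E" using w config.subspace_scale[OF subspace_sol] by simp
    have "coord c z \<in> real_of_int ` {1..int n}" if "c \<in> ?K \<times> UNIV" for c
    proof -
      have "coord c z \<in> \<int>" using z
        by (cases c) (auto simp: integer_points_def coord_def mem_Times_iff)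
      then obtain k where k: "coord c z = of_int k" by (elim Ints_cases)
      have "0 < coord c w" "coord c w < 1"
        using w(2) that by (cases c; auto simp: open_cube_def coord_def mem_Times_iff)+
      then have "0 < coord c z" "coord c z < r" using r by (simp_all add: w(1))
      then have "k \<in> {1..int n}" by (simp add: k r_def)
      then show ?thesis using k by simp
    qed
    then show "z \<in> sol ?K ?E \<inter> grid ?K n" using zs by (simp add: grid_def sol_def)
  next
    assume z: "z \<in> sol ?K ?E \<inter> grid ?K n"
    define w where "w = cscale (1 / r) z"
    have zw: "z = cscale r w" using r by (simp add: w_def config_eq_iff)
    have "w \<in> sol ?K ?E" using z config.subspace_scale[OF subspace_sol] by (simp add: w_def)
    moreover have "w i \<in> {0<..<1} \<times> {0<..<1}" if i: "i \<in> ?K" for i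
    proof -
      have "0 < coord (i, b) w \<and> coord (i, b) w < 1" for b
      proof -
        obtain k where "coord (i, b) z = of_int k" "k \<in> {1..int n}"
          using grid_coord[of z ?K n "(i, b)"] z i by auto
        then show ?thesis using r by (simp add: w_def r_def field_simps)
      qed
      from this[of True] this[of False] show ?thesis by (simp add: coord_def mem_Times_iff)
    qed
    ultimately have "w \<in> open_cube ?K \<inter> sol ?K ?E" by (simp add: open_cube_def sol_def)
    moreover have "z \<in> integer_points"
    proof -
      have "coord c z \<in> \<int>" for c
        using grid_coord[of z ?K n c] coord_outside[of z ?K c] z by (cases "fst c \<in> ?K") (auto simp: sol_def)
      from this[of "(i, True)" for i] this[of "(i, False)" for i]
      show ?thesis by (simp add: integer_points_def coord_def mem_Times_iff)
    qed
    ultimately show "z \<in> integer_points \<inter> cscale r ` (open_cube ?K \<inter> sol ?K ?E)" using zw by blast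
  qed
  then have "integer_points \<inter> cscale r ` (open_cube ?K \<inter> sol ?K ?E) = sol ?K ?E \<inter> grid ?K n" by blast
  then show ?thesis by (simp add: alpha_def points_def essential_part_sol r_def)
qed

locale rider_piece =
  fixes M :: "(int \<times> int) set"
  assumes rider: "rider_moves M"
begin

lemma finite_M: "finite M" and nonzero_M: "(0, 0) \<notin> M"
  using rider_moves_finite rider_moves_nonzero rider by auto

lemma finite_eqs_M: "finite I \<Longrightarrow> finite (eqs M I)"
  using finite_eqs finite_M by blast

text \<open>Counting all \<open>q\<close> pieces, and not only those involved in \<open>U\<close>, makes the top exponent \<open>2 q\<close> the same for all \<open>U\<close>.\<close>

abbreviation "N q U n \<equiv> real (points {1..q} U n)"

lemma lattice_cases:
  assumes "U \<in> int_lattice M q"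
  obtains S where "S \<subseteq> eqs M {1..q}" "finite S" "U = sol {1..q} S" "equations M q U = S"
proof -
  obtain S0 where S0: "S0 \<subseteq> eqs M {1..q}" "U = sol {1..q} S0" using assms by (auto simp: int_lattice_sol)
  show ?thesis
    using that[of "equations M q U"] sol_equations(1)[OF S0(1)] S0(2) equations_eqs
      finite_subset[OF equations_eqs finite_eqs_M] by (metis finite_atLeastAtMost)
qed

lemma lattice_subspace:
  assumes "U \<in> int_lattice M q"
  shows "config.subspace U" "U \<subseteq> config_space {1..q}"
  using lattice_cases[OF assms] subspace_sol sol_subset by metis+

lemma dim_codim:
  assumes "U \<in> int_lattice M q"
  shows "config.dim U + codim q U = 2 * q"
proof -
  have "config.dim U \<le> 2 * q"
    using lattice_cases[OF assms] dim_sol_le[of "{1..q}"] by (metis card_atLeastAtMost diff_Suc_1 finite_atLeastAtMost)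
  then show ?thesis by (simp add: codim_def)
qed

lemma N_alpha:
  assumes "U \<in> int_lattice M q"
  shows "N q U n = alpha M q U n * real n ^ (2 * q - 2 * card (pieces M q U))" "card (pieces M q U) \<le> q"
    "quasipoly (N q U)" "quasipoly (alpha M q U)"
proof -
  obtain S where S: "S \<subseteq> eqs M {1..q}" "finite S" "U = sol {1..q} S" "equations M q U = S"
    using lattice_cases[OF assms] .
  show "card (pieces M q U) \<le> q" using card_mono[OF _ pieces_subset[of M q U]] by simp
  show "N q U n = alpha M q U n * real n ^ (2 * q - 2 * card (pieces M q U))"
    using points_extend[OF _ pieces_subset[of M q U], of S n] S
    by (simp add: alpha_points pieces_supp diff_mult_distrib2)
  show "quasipoly (N q U)"
    using quasipoly_points[of "{1..q}" S] S supp_eqs[OF S(1)] by simp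
  have "alpha M q U = (\<lambda>n. real (points (pieces M q U) (sol (pieces M q U) (equations M q U)) n))"
    by (rule ext) (rule alpha_points)
  then show "quasipoly (alpha M q U)"
    using quasipoly_points[of "supp S" S] S finite_supp by (simp add: pieces_supp)
qed

lemma constituents_N_alpha:
  assumes "U \<in> int_lattice M q"
  shows "constituents (N q U) n = constituents (alpha M q U) n * monom 1 (2 * q - 2 * card (pieces M q U))"
  using constituents_mult_power(1)[OF N_alpha(4)[OF assms]]
    constituents_cong[of "N q U" "\<lambda>n. alpha M q U n * real n ^ (2 * q - 2 * card (pieces M q U))"]
    N_alpha(1)[OF assms] by metis

lemma degree_N:
  assumes "U \<in> int_lattice M q"
  shows "degree (constituents (N q U) n) \<le> config.dim U"
proof (rule degree_constituents_le[OF has_constituents_constituents[OF N_alpha(3)[OF assms]]])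
  fix n :: nat
  have "points {1..q} U n \<le> n ^ config.dim U"
    by (rule points_le[OF lattice_subspace[OF assms]]) simp
  then show "\<bar>N q U n\<bar> \<le> 1 * real n ^ config.dim U" by (simp flip: of_nat_power)
qed

lemma qp_coeff_N_eq_0:
  assumes "U \<in> int_lattice M q" "i < codim q U"
  shows "qp_coeff (N q U) (2 * q) i n = 0"
  using degree_N[OF assms(1), of n] dim_codim[OF assms(1)] assms(2)
  by (simp add: qp_coeff_def coeff_eq_0)

lemma qp_coeff_N_leading_const:
  assumes "U \<in> int_lattice M q"
  shows "qp_coeff (N q U) (2 * q) (codim q U) n = qp_coeff (N q U) (2 * q) (codim q U) n'"
proof (cases "q = 0")
  case True
  \<comment> \<open>without pieces there is one configuration, on every board\<close>
  have "U = {0}" using assms True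
    by (auto simp: int_lattice_sol sol_def config_space_def eqs_def fun_eq_iff)
  then have "N q U n = poly 1 (real n)" for n
    using True by (simp add: points_def grid_def config_space_def zero_fun_def[symmetric])
  then have "has_constituents (N q U) (\<lambda>_. 1)"
    using has_constituents_poly[of 1] by simp
  then show ?thesis by (simp add: qp_coeff_def constituents_eq)
next
  case False
  obtain S where S: "S \<subseteq> eqs M {1..q}" "U = sol {1..q} S" using lattice_cases[OF assms] by metis
  have diag: "diagonal {1..q} (1, 1) \<in> U" using diagonal_in_sol[OF S(1)] S(2) by simp
  note Suc_le = points_Suc_le[OF lattice_subspace[OF assms] _ diag]
  obtain D where D: "config.dim U = Suc D" using Suc_le(3) False by (auto simp: gr0_conv_Suc)
  have "coeff (constituents (N q U) n) (Suc D) = coeff (constituents (N q U) n') (Suc D)"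
  proof (rule leading_coeff_constituents_const[OF has_constituents_constituents[OF N_alpha(3)[OF assms]]])
    show "degree (constituents (N q U) n) \<le> Suc D" for n using degree_N[OF assms] D by metis
    show "\<bar>N q U (Suc n) - N q U n\<bar> \<le> real (2 * q) * real (Suc n) ^ D" for n
    proof -
      have "points {1..q} U n \<le> points {1..q} U (Suc n)"
        "points {1..q} U (Suc n) \<le> points {1..q} U n + 2 * q * Suc n ^ D"
        using Suc_le(1,2)[of n] False by (auto simp: D)
      then have "real (points {1..q} U (Suc n)) \<le> real (points {1..q} U n + 2 * q * Suc n ^ D)"
        by (simp only: of_nat_le_iff)
      then show ?thesis using \<open>points {1..q} U n \<le> points {1..q} U (Suc n)\<close> by simp
    qed
  qed
  moreover have "2 * q - codim q U = Suc D" "codim q U \<le> 2 * q" using dim_codim[OF assms] D by auto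
  ultimately show ?thesis by (simp add: qp_coeff_def)
qed

lemma qp_coeff_N_config_space:
  "qp_coeff (N q (config_space {1..q})) (2 * q) i n = (if i = 0 then 1 else 0)"
proof -
  have "N q (config_space {1..q}) n = poly (monom 1 (2 * q)) (real n)" for n
    using points_config_space[of "{1..q}" n] by (simp add: poly_monom)
  then have "has_constituents (N q (config_space {1..q})) (\<lambda>_. monom 1 (2 * q))"
    using has_constituents_poly[of "monom 1 (2 * q)"] by simp
  then show ?thesis by (auto simp: qp_coeff_def constituents_eq coeff_monom)
qed

text \<open>A nontrivial equation involves two pieces, and half the number of pieces is at most the codimension by the
  dimension count for equation sets. The last bound holds because all involved pieces can be moved together.\<close>

lemma pieces_bounds:
  assumes "U \<in> int_lattice M q" "U \<noteq> config_space {1..q}"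
  shows "2 \<le> card (pieces M q U)" "card (pieces M q U) \<le> 2 * codim q U"
    "codim q U + 2 \<le> 2 * card (pieces M q U)"
proof -
  obtain S where S: "S \<subseteq> eqs M {1..q}" "finite S" "U = sol {1..q} S" "equations M q U = S"
    using lattice_cases[OF assms(1)] .
  let ?K = "pieces M q U"
  have K: "?K = supp S" "finite ?K" using S by (auto simp: pieces_supp finite_supp)
  have "S \<noteq> {}" using assms(2) S sol_empty by metis
  then obtain m i j where e: "(m, i, j) \<in> S" by auto
  then have ij: "i < j" "{i, j} \<subseteq> ?K" using S(1) K by (auto simp: eqs_def supp_def)
  then show "2 \<le> card ?K" using card_mono[OF K(2) ij(2)] by simp
  have "2 * config.dim U + card ?K \<le> 4 * q"
    using dim_sol_supp[OF _ finite_M nonzero_M S(1)] K S by simp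
  then show "card ?K \<le> 2 * codim q U" using dim_codim[OF assms(1)] by linarith
  \<comment> \<open>the \<open>2\<^sup>2\<close> positions of coinciding pieces on the board of side \<open>2\<close>, compared with \<open>2\<^bsup>dim U\<^esup>\<close>, show that \<open>dim U\<close> is large enough\<close>
  have "2\<^sup>2 \<le> points ?K (sol ?K S) 2"
  proof -
    let ?R = "real_of_int ` {1..int 2}"
    have "inj_on (diagonal ?K) (?R \<times> ?R)"
      using ij by (auto simp: inj_on_def diagonal_def fun_eq_iff)
    moreover have "diagonal ?K p \<in> sol ?K S \<inter> grid ?K 2" if "p \<in> ?R \<times> ?R" for p
      using that diagonal_in_sol[OF eqs_supp[OF S(1)]] unfolding K
      by (auto simp: grid_def coord_def diagonal_def config_space_def)
    ultimately have "card (?R \<times> ?R) \<le> card (sol ?K S \<inter> grid ?K 2)"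
      using card_inj_on_le[of "diagonal ?K" "?R \<times> ?R"] finite_points[OF K(2)] by blast
    then show ?thesis
      by (simp add: points_def card_cartesian_product card_image inj_on_def power2_eq_square)
  qed
  then have "2\<^sup>2 * 2 ^ (2 * (q - card ?K)) \<le> points {1..q} U 2"
    using points_extend[OF _ pieces_subset[of M q U], of S 2] S K by simp
  also have "\<dots> \<le> 2 ^ config.dim U"
    by (rule points_le[OF lattice_subspace[OF assms(1)]]) simp
  finally have "(2::nat) ^ (2 + 2 * (q - card ?K)) \<le> 2 ^ config.dim U" by (simp only: power_add)
  then have "2 + 2 * (q - card ?K) \<le> config.dim U" by (simp only: power_increasing_iff)
  then show "codim q U + 2 \<le> 2 * card ?K" using dim_codim[OF assms(1)] N_alpha(2)[OF assms(1)] by linarith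
qed

lemma gamma_bar_N:
  assumes "U \<in> int_lattice M q" "codim q U \<le> i"
  shows "gamma_bar M q U (i - codim q U) n = qp_coeff (N q U) (2 * q) i n"
proof -
  let ?k = "card (pieces M q U)"
  \<comment> \<open>so that the truncated difference in the degree of \<open>\<alpha>\<close> is the true one\<close>
  have le: "codim q U \<le> 2 * ?k"
  proof (cases "U = config_space {1..q}")
    case True
    then show ?thesis using dim_config_space(1)[of "{1..q}"] by (simp add: codim_def)
  next
    case False
    then show ?thesis using pieces_bounds(3)[OF assms(1)] by linarith
  qed
  have "qp_coeff (N q U) (2 * ?k + (2 * q - 2 * ?k)) i n = qp_coeff (alpha M q U) (2 * ?k) i n"
    by (rule qp_coeff_mult_power[OF N_alpha(4)[OF assms(1)]]) (rule N_alpha(1)[OF assms(1)])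
  then have "qp_coeff (N q U) (2 * q) i n = qp_coeff (alpha M q U) (2 * ?k) i n"
    using N_alpha(2)[OF assms(1)] by simp
  also have "\<dots> = gamma_bar M q U (i - codim q U) n"
  proof -
    have "i - codim q U \<le> 2 * ?k - codim q U \<longleftrightarrow> i \<le> 2 * ?k" using le assms(2) by arith
    then show ?thesis using le assms(2) by (simp add: gamma_bar_def qp_coeff_def)
  qed
  finally show ?thesis by simp
qed

section \<open>The coefficients of the counting function\<close>

abbreviation "mu q U \<equiv> real_of_int (moebius (int_lattice M q) (config_space {1..q}) U)"

lemma mu_bottom: "mu q (config_space {1..q}) = 1"
  using finite_int_lattice[OF finite_M] config_space_in_lattice by (subst moebius.simps) auto

lemma u_count_sum: "u_count M q n = (\<Sum>U\<in>int_lattice M q. (mu q U / fact q) * N q U n)"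
  by (simp add: u_count_def o_count_lattice[OF rider] sum_divide_distrib)

lemma quasipoly_u_count: "quasipoly (u_count M q)"
  using constituents_sum(2)[OF finite_int_lattice[OF finite_M, of q], of "N q" "\<lambda>U. mu q U / fact q"]
    N_alpha(3) u_count_sum[of q] by (simp cong: quasipoly_cong)

lemma gamma_sum: "fact q * gamma M q i n = (\<Sum>U\<in>int_lattice M q. mu q U * qp_coeff (N q U) (2 * q) i n)"
proof -
  have "u_count M q = (\<lambda>n. \<Sum>U\<in>int_lattice M q. (mu q U / fact q) * N q U n)"
    by (rule ext) (rule u_count_sum)
  then have "gamma M q i n = (\<Sum>U\<in>int_lattice M q. (mu q U / fact q) * qp_coeff (N q U) (2 * q) i n)"
    unfolding gamma_def
    by (simp only: qp_coeff_sum[OF finite_int_lattice[OF finite_M] N_alpha(3)])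
  then show ?thesis by (simp add: sum_distrib_left)
qed

lemma degree_u_count: "degree (constituents (u_count M q) n) \<le> 2 * q"
proof -
  have "u_count M q = (\<lambda>n. \<Sum>U\<in>int_lattice M q. (mu q U / fact q) * N q U n)"
    by (rule ext) (rule u_count_sum)
  then have "constituents (u_count M q) n =
      (\<Sum>U\<in>int_lattice M q. smult (mu q U / fact q) (constituents (N q U) n))"
    by (simp only: constituents_sum(1)[OF finite_int_lattice[OF finite_M] N_alpha(3)])
  moreover have "degree (smult (mu q U / fact q) (constituents (N q U) n)) \<le> 2 * q" if "U \<in> int_lattice M q" for U
    using degree_N[OF that, of n] dim_codim[OF that] degree_smult_le[of "mu q U / fact q" "constituents (N q U) n"]
    by linarith
  ultimately show ?thesis by (simp add: degree_sum_le finite_int_lattice finite_M)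
qed

lemma u_count_expansion:
  assumes "n \<ge> 1"
  shows "u_count M q n = (\<Sum>i\<le>2 * q. gamma M q i n * real n ^ (2 * q - i))"
proof -
  let ?p = "constituents (u_count M q) n"
  have "u_count M q n = poly ?p (real n)"
    using has_constituents_constituents[OF quasipoly_u_count] assms unfolding has_constituents_def by blast
  also have "\<dots> = (\<Sum>i\<le>2 * q. coeff ?p i * real n ^ i)"
    unfolding poly_altdef using degree_u_count[of q n]
    by (intro sum.mono_neutral_left) (auto simp: coeff_eq_0)
  also have "\<dots> = (\<Sum>i\<le>2 * q. coeff ?p (2 * q - i) * real n ^ (2 * q - i))"
    by (rule sum.reindex_bij_witness[of _ "\<lambda>i. 2 * q - i" "\<lambda>i. 2 * q - i"]) auto
  finally show ?thesis by (simp add: gamma_def qp_coeff_def)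
qed

lemma gamma_0: "fact q * gamma M q 0 n = 1"
proof -
  have "fact q * gamma M q 0 n =
      (\<Sum>U\<in>int_lattice M q. if U = config_space {1..q} then 1 else 0)"
    unfolding gamma_sum
  proof (intro sum.cong refl)
    fix U assume U: "U \<in> int_lattice M q"
    show "mu q U * qp_coeff (N q U) (2 * q) 0 n = (if U = config_space {1..q} then 1 else 0)"
    proof (cases "U = config_space {1..q}")
      case False
      then have "0 < codim q U" using pieces_bounds[OF U] by linarith
      then show ?thesis using False qp_coeff_N_eq_0[OF U] by simp
    next
      case True
      show ?thesis unfolding True using mu_bottom qp_coeff_N_config_space[of q 0 n] by simp
    qed
  qed
  then show ?thesis
    using config_space_in_lattice[of q M] finite_int_lattice[OF finite_M] by simp
qed

text \<open>Only subspaces of codimension at most \<open>i\<close> contribute to \<open>\<gamma>\<^sub>i\<close>, and their contributions are coefficients of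
  constituents that repeat after the period of \<open>\<alpha>(U; n)\<close>.\<close>

lemma min_period_gamma:
  "min_period (gamma M q i) dvd
    Lcm ((\<lambda>U. min_period (constituents (alpha M q U))) ` {U \<in> int_lattice M q. codim q U \<le> i})"
proof -
  let ?A = "{U \<in> int_lattice M q. codim q U \<le> i}"
  define T where "T = Lcm ((\<lambda>U. min_period (constituents (alpha M q U))) ` ?A)"
  have finA: "finite ?A" using finite_int_lattice[OF finite_M] by simp
  have per: "min_period (constituents (alpha M q U)) > 0 \<and>
      (\<forall>n. constituents (alpha M q U) (n + min_period (constituents (alpha M q U))) = constituents (alpha M q U) n)"
    if "U \<in> ?A" for U
  proof -
    have "has_constituents (alpha M q U) (constituents (alpha M q U))"
      using that by (intro has_constituents_constituents N_alpha(4)) simp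
    then obtain T where "T > 0" "\<And>n. constituents (alpha M q U) (n + T) = constituents (alpha M q U) n"
      unfolding has_constituents_def by blast
    then show ?thesis using min_period_periodic[of T "constituents (alpha M q U)"] by blast
  qed
  have "T \<noteq> 0" unfolding T_def using per finA
    by (subst Lcm_0_iff) (auto simp: image_iff)
  then have T: "T > 0" by simp
  have "gamma M q i (n + T) = gamma M q i n" for n
  proof -
    have "mu q U * qp_coeff (N q U) (2 * q) i (n + T) = mu q U * qp_coeff (N q U) (2 * q) i n"
      if U: "U \<in> int_lattice M q" for U
    proof (cases "codim q U \<le> i")
      case True
      then have "min_period (constituents (alpha M q U)) dvd T"
        unfolding T_def using U by (intro dvd_Lcm) auto
      then obtain k where "T = k * min_period (constituents (alpha M q U))"
        by (metis dvdE mult.commute)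
      then have "constituents (alpha M q U) (n + T) = constituents (alpha M q U) n"
        using periodic_mult[of "constituents (alpha M q U)" "min_period (constituents (alpha M q U))" n k]
          per[of U] True U by simp
      then show ?thesis unfolding qp_coeff_def constituents_N_alpha[OF U] by simp
    next
      case False
      then show ?thesis using qp_coeff_N_eq_0[OF U] by simp
    qed
    then have "fact q * gamma M q i (n + T) = fact q * gamma M q i n"
      unfolding gamma_sum by (intro sum.cong refl)
    then show ?thesis by simp
  qed
  then have "min_period (gamma M q i) dvd T" by (rule min_period_dvd[OF T])
  then show ?thesis unfolding T_def .
qed

end

section \<open>Relabelling the pieces\<close>

lemma relabel_relabel: "relabel \<sigma> (relabel \<tau> U) = relabel (\<tau> \<circ> \<sigma>) U"
  by (auto simp: relabel_def image_image o_assoc)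

lemma relabel_id: "relabel id U = U"
  by (simp add: relabel_def)

lemma relabel_inv:
  assumes "\<sigma> permutes A"
  shows "relabel (inv \<sigma>) (relabel \<sigma> U) = U" "relabel \<sigma> (relabel (inv \<sigma>) U) = U"
  using permutes_inv_o[OF assms] by (simp_all add: relabel_relabel relabel_id)

lemma relabel_subset_iff:
  assumes "\<sigma> permutes A"
  shows "relabel \<sigma> U \<subseteq> relabel \<sigma> W \<longleftrightarrow> U \<subseteq> W"
proof
  assume "relabel \<sigma> U \<subseteq> relabel \<sigma> W"
  then have "relabel (inv \<sigma>) (relabel \<sigma> U) \<subseteq> relabel (inv \<sigma>) (relabel \<sigma> W)"
    unfolding relabel_def by (rule image_mono)
  then show "U \<subseteq> W" by (simp add: relabel_inv[OF assms])
qed (auto simp: relabel_def)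

text \<open>Equations are stored with \<open>i < j\<close>, so a relabelled equation may have to be turned round.\<close>

definition relabel_equation :: "(nat \<Rightarrow> nat) \<Rightarrow> equation \<Rightarrow> equation" where
  "relabel_equation \<sigma> = (\<lambda>(m, i, j). (m, min (inv \<sigma> i) (inv \<sigma> j), max (inv \<sigma> i) (inv \<sigma> j)))"

lemma on_hyperplane_sym: "on_hyperplane m i j z \<longleftrightarrow> on_hyperplane m j i z"
  unfolding on_hyperplane_def by (simp add: algebra_simps) linarith

lemma on_hyperplane_relabel:
  assumes "\<sigma> permutes A"
  shows "on_hyperplane m i j z \<longleftrightarrow>
    on_hyperplane m (min (inv \<sigma> i) (inv \<sigma> j)) (max (inv \<sigma> i) (inv \<sigma> j)) (z \<circ> \<sigma>)"
proof -
  have "on_hyperplane m i j z \<longleftrightarrow> on_hyperplane m (inv \<sigma> i) (inv \<sigma> j) (z \<circ> \<sigma>)"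
    by (simp add: on_hyperplane_def permutes_inverses[OF assms])
  then show ?thesis
    using on_hyperplane_sym[of m "inv \<sigma> i" "inv \<sigma> j" "z \<circ> \<sigma>"] by (simp add: min_def max_def)
qed

lemma comp_config_space:
  assumes "\<sigma> permutes I"
  shows "z \<circ> \<sigma> \<in> config_space I \<longleftrightarrow> z \<in> config_space I"
proof -
  have "(\<forall>i. i \<notin> I \<longrightarrow> z (\<sigma> i) = 0) \<longleftrightarrow> (\<forall>i. i \<notin> I \<longrightarrow> z i = 0)"
    using permutes_not_in[OF assms] by metis
  then show ?thesis by (simp add: config_space_def)
qed

lemma relabel_sol:
  assumes "\<sigma> permutes I"
  shows "relabel \<sigma> (sol I S) = sol I (relabel_equation \<sigma> ` S)"
proof -
  have iff: "z \<in> sol I S \<longleftrightarrow> z \<circ> \<sigma> \<in> sol I (relabel_equation \<sigma> ` S)" for z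
    unfolding sol_def mem_Collect_eq comp_config_space[OF assms]
    using on_hyperplane_relabel[OF assms] by (simp add: relabel_equation_def case_prod_unfold)
  show ?thesis
  proof (intro equalityI subsetI)
    fix w assume "w \<in> relabel \<sigma> (sol I S)"
    then show "w \<in> sol I (relabel_equation \<sigma> ` S)" using iff by (auto simp: relabel_def)
  next
    fix w assume w: "w \<in> sol I (relabel_equation \<sigma> ` S)"
    have "w = (w \<circ> inv \<sigma>) \<circ> \<sigma>" using permutes_inv_o[OF assms] by (simp add: o_assoc[symmetric])
    then show "w \<in> relabel \<sigma> (sol I S)" using iff[of "w \<circ> inv \<sigma>"] w unfolding relabel_def by auto
  qed
qed

lemma relabel_equation_eqs:
  assumes "\<sigma> permutes I" "S \<subseteq> eqs M I"
  shows "relabel_equation \<sigma> ` S \<subseteq> eqs M I"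
proof (rule image_subsetI)
  fix e assume "e \<in> S"
  then obtain m i j where e: "e = (m, i, j)" "m \<in> M" "i \<in> I" "j \<in> I" "i < j"
    using assms(2) by (auto simp: eqs_def)
  have "inv \<sigma> i \<in> I" "inv \<sigma> j \<in> I" using e permutes_in_image[OF permutes_inv[OF assms(1)]] by auto
  moreover have "inv \<sigma> i \<noteq> inv \<sigma> j" using e permutes_inj[OF permutes_inv[OF assms(1)]] by (auto dest: injD)
  ultimately show "relabel_equation \<sigma> e \<in> eqs M I"
    using e by (simp add: relabel_equation_def eqs_def min_def max_def)
qed

lemma supp_relabel_equation: "supp (relabel_equation \<sigma> ` S) = inv \<sigma> ` supp S"
proof -
  have "(case relabel_equation \<sigma> e of (m, i, j) \<Rightarrow> {i, j}) = inv \<sigma> ` (case e of (m, i, j) \<Rightarrow> {i, j})" for e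
    by (cases e) (auto simp: relabel_equation_def min_def max_def)
  then show ?thesis by (simp add: supp_def image_UN)
qed

lemma relabel_config_space:
  "\<sigma> permutes I \<Longrightarrow> relabel \<sigma> (config_space I) = config_space I"
  using relabel_sol[of \<sigma> I "{}"] by (simp add: sol_empty)

lemma points_relabel:
  assumes "\<sigma> permutes I"
  shows "points I (relabel \<sigma> U) n = points I U n"
proof -
  have grid: "z \<circ> \<sigma> \<in> grid I n \<longleftrightarrow> z \<in> grid I n" for z
  proof -
    have "(\<forall>c\<in>I \<times> UNIV. coord c (z \<circ> \<sigma>) \<in> R) \<longleftrightarrow> (\<forall>c\<in>I \<times> UNIV. coord c z \<in> R)" for R
    proof -
      have c: "coord (i, b) (z \<circ> \<sigma>) = coord (\<sigma> i, b) z" for i b by (simp add: coord_def)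
      have "(\<forall>i\<in>I. P (\<sigma> i)) \<longleftrightarrow> (\<forall>i\<in>I. P i)" for P
        using permutes_image[OF assms] by (metis imageE imageI)
      from this[of "\<lambda>i. \<forall>b. coord (i, b) z \<in> R"] show ?thesis by (simp add: c)
    qed
    then show ?thesis by (simp add: grid_def comp_config_space[OF assms])
  qed
  have inj: "inj (\<lambda>z :: config. z \<circ> \<sigma>)"
    using permutes_surj[OF assms] by (simp add: inj_def fun_eq_iff surj_def) metis
  have "relabel \<sigma> U \<inter> grid I n = (\<lambda>z. z \<circ> \<sigma>) ` (U \<inter> grid I n)"
    using grid by (auto simp: relabel_def)
  then show ?thesis
    unfolding points_def using card_image[OF inj_on_subset[OF inj subset_UNIV]] by metis
qed

global_interpretation config_pair: vector_space_pair cscale cscale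
  by unfold_locales

lemma dim_relabel:
  assumes "\<sigma> permutes I"
  shows "config.dim (relabel \<sigma> U) = config.dim U"
proof -
  let ?f = "\<lambda>z :: config. z \<circ> \<sigma>"
  have lin: "Vector_Spaces.linear cscale cscale ?f"
    by unfold_locales (auto simp: cscale_def fun_eq_iff scaleR_add_right scaleR_add_left)
  have inj: "inj ?f"
    using permutes_surj[OF assms] by (simp add: inj_def fun_eq_iff surj_def) metis
  obtain B where B: "B \<subseteq> U" "config.independent B" "U \<subseteq> config.span B" "card B = config.dim U"
    using config.basis_exists by blast
  show ?thesis
    unfolding relabel_def
  proof (rule config.dim_unique[of "?f ` B"])
    show "config.independent (?f ` B)"
      using config_pair.linear_independent_injective_image[OF lin B(2)] inj_on_subset[OF inj] by blast
    show "?f ` U \<subseteq> config.span (?f ` B)"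
      using B(3) config_pair.linear_span_image[OF lin, of B] by auto
    show "card (?f ` B) = config.dim U"
      using B(4) card_image[OF inj_on_subset[OF inj subset_UNIV]] by metis
  qed (use B in auto)
qed

lemma codim_relabel: "\<sigma> permutes I \<Longrightarrow> codim q (relabel \<sigma> U) = codim q U"
  by (simp add: codim_def dim_relabel)

lemma moebius_automorphism:
  assumes "finite L" and bij: "bij_betw \<Phi> L L"
    and mono: "\<And>U W. U \<in> L \<Longrightarrow> W \<in> L \<Longrightarrow> \<Phi> U \<subseteq> \<Phi> W \<longleftrightarrow> U \<subseteq> W"
    and V: "\<Phi> V = V" "V \<in> L" and "U \<in> L"
  shows "moebius L V (\<Phi> U) = moebius L V U"
  using assms(6)
proof (induction "card {W \<in> L. U \<subset> W}" arbitrary: U rule: less_induct)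
  case less
  have img: "\<Phi> U \<in> L" using bij less(2) by (auto simp: bij_betw_def)
  have sub: "\<Phi> U \<subseteq> V \<longleftrightarrow> U \<subseteq> V" using mono[OF less(2) V(2)] V(1) by simp
  have inj: "inj_on \<Phi> L" using bij by (simp add: bij_betw_def)
  have eq: "\<Phi> U = V \<longleftrightarrow> U = V" using inj less(2) V by (metis inj_onD)
  have psub: "\<Phi> U \<subset> \<Phi> W \<longleftrightarrow> U \<subset> W" if "W \<in> L" for W
    using mono[OF less(2) that] mono[OF that less(2)] by blast
  have set: "{W \<in> L. \<Phi> U \<subset> W \<and> W \<subseteq> V} = \<Phi> ` {W \<in> L. U \<subset> W \<and> W \<subseteq> V}"
  proof (intro equalityI subsetI)
    fix W assume W: "W \<in> {W \<in> L. \<Phi> U \<subset> W \<and> W \<subseteq> V}"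
    then have "W \<in> \<Phi> ` L" using bij by (auto simp: bij_betw_def)
    then obtain W' where "W' \<in> L" "W = \<Phi> W'" by blast
    then show "W \<in> \<Phi> ` {W \<in> L. U \<subset> W \<and> W \<subseteq> V}"
      using W psub[of W'] mono[of W' V] V by auto
  next
    fix W assume "W \<in> \<Phi> ` {W \<in> L. U \<subset> W \<and> W \<subseteq> V}"
    then obtain W' where "W' \<in> L" "W = \<Phi> W'" "U \<subset> W'" "W' \<subseteq> V" by blast
    then show "W \<in> {W \<in> L. \<Phi> U \<subset> W \<and> W \<subseteq> V}"
      using psub[of W'] mono[of W' V] V bij by (auto simp: bij_betw_def)
  qed
  have "(\<Sum>W\<in>{W \<in> L. \<Phi> U \<subset> W \<and> W \<subseteq> V}. moebius L V W) = (\<Sum>W\<in>{W \<in> L. U \<subset> W \<and> W \<subseteq> V}. moebius L V (\<Phi> W))"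
    unfolding set by (rule sum.reindex_cong[OF inj_on_subset[OF inj]]) auto
  also have "\<dots> = (\<Sum>W\<in>{W \<in> L. U \<subset> W \<and> W \<subseteq> V}. moebius L V W)"
  proof (intro sum.cong refl)
    fix W assume W: "W \<in> {W \<in> L. U \<subset> W \<and> W \<subseteq> V}"
    have "card {X \<in> L. W \<subset> X} < card {X \<in> L. U \<subset> X}"
      by (rule psubset_card_mono) (use W assms(1) in auto)
    then show "moebius L V (\<Phi> W) = moebius L V W" using less(1)[of W] W by simp
  qed
  finally show ?case
    using img sub eq less(2) assms(1) V(2) moebius.simps[of L V "\<Phi> U"] moebius.simps[of L V U] by simp
qed

context rider_piece
begin

lemma lattice_relabel:
  assumes "U \<in> int_lattice M q" "\<sigma> permutes {1..q}"
  shows "relabel \<sigma> U \<in> int_lattice M q" "pieces M q (relabel \<sigma> U) = inv \<sigma> ` pieces M q U"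
proof -
  obtain S where S: "S \<subseteq> eqs M {1..q}" "U = sol {1..q} S" using lattice_cases[OF assms(1)] by metis
  have R: "relabel \<sigma> U = sol {1..q} (relabel_equation \<sigma> ` S)" "relabel_equation \<sigma> ` S \<subseteq> eqs M {1..q}"
    using relabel_sol[OF assms(2)] relabel_equation_eqs[OF assms(2) S(1)] S(2) by auto
  show "relabel \<sigma> U \<in> int_lattice M q" using R by (auto simp: int_lattice_sol)
  show "pieces M q (relabel \<sigma> U) = inv \<sigma> ` pieces M q U"
    using R(1) S(2) pieces_sol[OF nonzero_M R(2)] pieces_sol[OF nonzero_M S(1)]
      supp_relabel_equation[of \<sigma> S] by metis
qed

lemma card_pieces_relabel:
  assumes "U \<in> int_lattice M q" "\<sigma> permutes {1..q}"
  shows "card (pieces M q (relabel \<sigma> U)) = card (pieces M q U)"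
  unfolding lattice_relabel(2)[OF assms]
  using card_image[OF inj_on_subset[OF permutes_inj[OF permutes_inv[OF assms(2)]] subset_UNIV]] .

lemma mu_relabel:
  assumes "U \<in> int_lattice M q" "\<sigma> permutes {1..q}"
  shows "mu q (relabel \<sigma> U) = mu q U"
proof -
  have "bij_betw (relabel \<sigma>) (int_lattice M q) (int_lattice M q)"
    by (rule bij_betw_byWitness[where f' = "relabel (inv \<sigma>)"])
      (use relabel_inv[OF assms(2)] lattice_relabel(1) assms(2) permutes_inv[OF assms(2)] in auto)
  then show ?thesis
    using moebius_automorphism[OF finite_int_lattice[OF finite_M] _ relabel_subset_iff[OF assms(2)]
        relabel_config_space[OF assms(2)] config_space_in_lattice assms(1)] by simp
qed

lemma qp_coeff_N_relabel:
  "\<sigma> permutes {1..q} \<Longrightarrow> qp_coeff (N q (relabel \<sigma> U)) D i n = qp_coeff (N q U) D i n"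
  by (simp add: points_relabel)

section \<open>Isomorphism types\<close>

lemma relabel_fixes:
  assumes "U \<in> int_lattice M q" "\<sigma> permutes {1..q}" "\<And>i. i \<in> pieces M q U \<Longrightarrow> \<sigma> i = i"
  shows "relabel \<sigma> U = U"
proof -
  obtain S where S: "S \<subseteq> eqs M {1..q}" "U = sol {1..q} S" "equations M q U = S"
    using lattice_cases[OF assms(1)] by metis
  have "relabel_equation \<sigma> e = e" if "e \<in> S" for e
  proof -
    obtain m i j where e: "e = (m, i, j)" by (cases e)
    have "i \<in> pieces M q U" "j \<in> pieces M q U" "i < j"
      using that S unfolding e by (auto simp: pieces_supp supp_def eqs_def)
    then have "inv \<sigma> i = i" "inv \<sigma> j = j" using assms(3) permutes_inv_eq[OF assms(2)] by auto
    then show ?thesis using \<open>i < j\<close> by (simp add: relabel_equation_def e)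
  qed
  then have "relabel_equation \<sigma> ` S = S" by (simp add: image_def)
  then show ?thesis using relabel_sol[OF assms(2), of S] S(2) by simp
qed

text \<open>A relabelling fixes \<open>U\<close> iff it maps the involved pieces to themselves by an automorphism of \<open>U\<close>; the other
  \<open>q - \<kappa>\<close> pieces are permuted freely.\<close>

lemma card_stabilizer:
  assumes U: "U \<in> int_lattice M q"
  shows "card {\<sigma>. \<sigma> permutes {1..q} \<and> relabel \<sigma> U = U} = card (Aut M q U) * fact (q - card (pieces M q U))"
proof -
  let ?K = "pieces M q U" and ?I = "{1..q}"
  let ?R = "?I - ?K"
  have K: "?K \<subseteq> ?I" "finite ?K" using pieces_subset[of M q U] finite_subset by auto
  have sub: "\<sigma> permutes ?I" if "\<sigma> permutes A" "A \<subseteq> ?I" for \<sigma> A using permutes_subset that by blast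
  have fixR: "relabel b U = U" if "b permutes ?R" for b
    using relabel_fixes[OF U sub[OF that]] permutes_not_in[OF that] by auto
  have "bij_betw (\<lambda>(a, b). a \<circ> b) (Aut M q U \<times> {b. b permutes ?R}) {\<sigma>. \<sigma> permutes ?I \<and> relabel \<sigma> U = U}"
  proof (rule bij_betw_byWitness[where f' = "\<lambda>\<sigma>. (\<lambda>i. if i \<in> ?K then \<sigma> i else i, \<lambda>i. if i \<in> ?K then i else \<sigma> i)"])
    have ab: "(a \<circ> b) i = (if i \<in> ?K then a i else b i)" if "a permutes ?K" "b permutes ?R" for a b i
    proof (cases "i \<in> ?K")
      case True
      then show ?thesis using permutes_not_in[OF that(2), of i] by simp
    next
      case False
      then have "b i \<notin> ?K"
        using permutes_in_image[OF that(2), of i] permutes_not_in[OF that(2), of i] by (cases "i \<in> ?R") auto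
      then show ?thesis using permutes_not_in[OF that(1)] False by simp
    qed
    show "\<forall>p\<in>Aut M q U \<times> {b. b permutes ?R}.
        (\<lambda>i. if i \<in> ?K then (case p of (a, b) \<Rightarrow> a \<circ> b) i else i, \<lambda>i. if i \<in> ?K then i else (case p of (a, b) \<Rightarrow> a \<circ> b) i) = p"
    proof
      fix p assume "p \<in> Aut M q U \<times> {b. b permutes ?R}"
      then obtain a b where p: "p = (a, b)" "a permutes ?K" "b permutes ?R" by (auto simp: Aut_def)
      show "(\<lambda>i. if i \<in> ?K then (case p of (a, b) \<Rightarrow> a \<circ> b) i else i, \<lambda>i. if i \<in> ?K then i else (case p of (a, b) \<Rightarrow> a \<circ> b) i) = p"
        using ab[OF p(2,3)] permutes_not_in[OF p(2)] permutes_not_in[OF p(3)] unfolding p(1) by (auto simp: fun_eq_iff)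
    qed
    show "(\<lambda>(a, b). a \<circ> b) ` (Aut M q U \<times> {b. b permutes ?R}) \<subseteq> {\<sigma>. \<sigma> permutes ?I \<and> relabel \<sigma> U = U}"
    proof (rule image_subsetI)
      fix p assume "p \<in> Aut M q U \<times> {b. b permutes ?R}"
      then obtain a b where p: "p = (a, b)" "a permutes ?K" "relabel a U = U" "b permutes ?R" by (auto simp: Aut_def)
      have "relabel (a \<circ> b) U = U" using fixR[OF p(4)] p(3) relabel_relabel[of b a U] by simp
      then show "(case p of (a, b) \<Rightarrow> a \<circ> b) \<in> {\<sigma>. \<sigma> permutes ?I \<and> relabel \<sigma> U = U}"
        using permutes_compose[OF sub[OF p(4)] sub[OF p(2) K(1)]] unfolding p(1) by auto
    qed
    have inv: "(\<lambda>i. if i \<in> ?K then \<sigma> i else i) permutes ?K \<and> (\<lambda>i. if i \<in> ?K then i else \<sigma> i) permutes ?R"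
      if s: "\<sigma> permutes ?I" "relabel \<sigma> U = U" for \<sigma>
    proof -
      have "inv \<sigma> ` ?K = ?K" using lattice_relabel(2)[OF U s(1)] s(2) by simp
      then have "\<sigma> ` inv \<sigma> ` ?K = \<sigma> ` ?K" by simp
      then have sK: "\<sigma> ` ?K = ?K" by (simp add: image_image permutes_inverses[OF s(1)])
      have inj: "inj \<sigma>" using permutes_inj[OF s(1)] .
      have sR: "\<sigma> ` ?R = ?R" using sK permutes_image[OF s(1)] image_set_diff[OF inj, of ?I ?K] by simp
      have b1: "bij_betw (\<lambda>i. if i \<in> ?K then \<sigma> i else i) ?K ?K"
        using sK inj_on_subset[OF inj, of ?K] by (auto simp: bij_betw_def inj_on_def)
      have b2: "bij_betw (\<lambda>i. if i \<in> ?K then i else \<sigma> i) ?R ?R"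
      proof -
        have "(\<lambda>i. if i \<in> ?K then i else \<sigma> i) ` ?R = \<sigma> ` ?R" by (intro image_cong) auto
        moreover have "inj_on (\<lambda>i. if i \<in> ?K then i else \<sigma> i) ?R"
          using inj by (auto simp: inj_on_def inj_def)
        ultimately show ?thesis using sR by (simp add: bij_betw_def)
      qed
      have out: "(if i \<in> ?K then i else \<sigma> i) = i" if "i \<notin> ?R" for i
        using that permutes_not_in[OF s(1), of i] by auto
      show ?thesis
        using bij_imp_permutes[OF b1] bij_imp_permutes[OF b2 out] by simp
    qed
    have comp: "(\<lambda>i. if i \<in> ?K then \<sigma> i else i) \<circ> (\<lambda>i. if i \<in> ?K then i else \<sigma> i) = \<sigma>"
      if s: "\<sigma> permutes ?I" "relabel \<sigma> U = U" for \<sigma>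
    proof
      fix i
      show "((\<lambda>i. if i \<in> ?K then \<sigma> i else i) \<circ> (\<lambda>i. if i \<in> ?K then i else \<sigma> i)) i = \<sigma> i"
        using ab[OF conjunct1[OF inv[OF s]] conjunct2[OF inv[OF s]], of i] by simp
    qed
    show "\<forall>\<sigma>\<in>{\<sigma>. \<sigma> permutes ?I \<and> relabel \<sigma> U = U}.
        (case (\<lambda>i. if i \<in> ?K then \<sigma> i else i, \<lambda>i. if i \<in> ?K then i else \<sigma> i) of (a, b) \<Rightarrow> a \<circ> b) = \<sigma>"
      using comp by simp
    show "(\<lambda>\<sigma>. (\<lambda>i. if i \<in> ?K then \<sigma> i else i, \<lambda>i. if i \<in> ?K then i else \<sigma> i)) `
        {\<sigma>. \<sigma> permutes ?I \<and> relabel \<sigma> U = U} \<subseteq> Aut M q U \<times> {b. b permutes ?R}"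
    proof (rule image_subsetI)
      fix \<sigma> assume "\<sigma> \<in> {\<sigma>. \<sigma> permutes ?I \<and> relabel \<sigma> U = U}"
      then have s: "\<sigma> permutes ?I" "relabel \<sigma> U = U" by auto
      define a b where "a = (\<lambda>i. if i \<in> ?K then \<sigma> i else i)" and "b = (\<lambda>i. if i \<in> ?K then i else \<sigma> i)"
      have ab: "a permutes ?K" "b permutes ?R" "a \<circ> b = \<sigma>" using inv[OF s] comp[OF s] by (auto simp: a_def b_def)
      have "U = relabel b (relabel a U)" using s(2) ab(3) relabel_relabel[of b a U] by simp
      then have "relabel (inv b) U = relabel a U" by (metis relabel_inv(1)[OF ab(2)])
      then have "relabel a U = U" using fixR[OF permutes_inv[OF ab(2)]] by simp
      then have "(a, b) \<in> Aut M q U \<times> {b. b permutes ?R}" using ab by (simp add: Aut_def)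
      then show "(\<lambda>i. if i \<in> ?K then \<sigma> i else i, \<lambda>i. if i \<in> ?K then i else \<sigma> i) \<in> Aut M q U \<times> {b. b permutes ?R}"
        by (simp only: a_def b_def)
    qed
  qed
  from bij_betw_same_card[OF this] show ?thesis
    using K card_permutations[of ?R "q - card ?K"] by (simp add: card_cartesian_product card_Diff_subset)
qed

text \<open>The orbit-stabilizer theorem for the permutations of all \<open>q\<close> pieces.\<close>

lemma card_type:
  assumes U: "U \<in> int_lattice M q"
  shows "card (iso_rel M q `` {U}) * (card (Aut M q U) * fact (q - card (pieces M q U))) = fact q"
proof -
  let ?P = "{\<sigma>. \<sigma> permutes {1..q}}"
  let ?O = "iso_rel M q `` {U}"
  have O: "?O = (\<lambda>\<sigma>. relabel \<sigma> U) ` ?P"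
    using U lattice_relabel(1)[OF U] by (auto simp: iso_rel_def)
  have finP: "finite ?P" using finite_permutations[of "{1..q}"] by simp
  have fib: "card {\<sigma> \<in> ?P. relabel \<sigma> U = V} = card {\<sigma>. \<sigma> permutes {1..q} \<and> relabel \<sigma> U = U}" if V: "V \<in> ?O" for V
  proof -
    obtain \<tau> where t: "\<tau> permutes {1..q}" "V = relabel \<tau> U" using V unfolding O by blast
    have "bij_betw (\<lambda>\<sigma>. \<sigma> \<circ> inv \<tau>) {\<sigma> \<in> ?P. relabel \<sigma> U = V} {\<sigma>. \<sigma> permutes {1..q} \<and> relabel \<sigma> U = U}"
    proof (rule bij_betw_byWitness[where f' = "\<lambda>\<sigma>. \<sigma> \<circ> \<tau>"])
      show "(\<lambda>\<sigma>. \<sigma> \<circ> inv \<tau>) ` {\<sigma> \<in> ?P. relabel \<sigma> U = V} \<subseteq> {\<sigma>. \<sigma> permutes {1..q} \<and> relabel \<sigma> U = U}"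
      proof (rule image_subsetI)
        fix \<sigma> assume s: "\<sigma> \<in> {\<sigma> \<in> ?P. relabel \<sigma> U = V}"
        have "relabel (\<sigma> \<circ> inv \<tau>) U = relabel (inv \<tau>) (relabel \<tau> U)"
          using s t(2) relabel_relabel[of "inv \<tau>" \<sigma> U] by simp
        then show "\<sigma> \<circ> inv \<tau> \<in> {\<sigma>. \<sigma> permutes {1..q} \<and> relabel \<sigma> U = U}"
          using s permutes_compose[OF permutes_inv[OF t(1)]] by (simp add: relabel_inv[OF t(1)])
      qed
      show "(\<lambda>\<sigma>. \<sigma> \<circ> \<tau>) ` {\<sigma>. \<sigma> permutes {1..q} \<and> relabel \<sigma> U = U} \<subseteq> {\<sigma> \<in> ?P. relabel \<sigma> U = V}"
      proof (rule image_subsetI)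
        fix \<sigma> assume s: "\<sigma> \<in> {\<sigma>. \<sigma> permutes {1..q} \<and> relabel \<sigma> U = U}"
        then have "relabel (\<sigma> \<circ> \<tau>) U = V" using t(2) relabel_relabel[of \<tau> \<sigma> U] by simp
        then show "\<sigma> \<circ> \<tau> \<in> {\<sigma> \<in> ?P. relabel \<sigma> U = V}"
          using s permutes_compose[OF t(1)] by simp
      qed
    qed (use permutes_inv_o[OF t(1)] in \<open>auto simp: o_assoc[symmetric]\<close>)
    then show ?thesis by (rule bij_betw_same_card)
  qed
  have "fact q = card ?P" using card_permutations[of "{1..q}" q] by simp
  also have "\<dots> = (\<Sum>V\<in>?O. card {\<sigma> \<in> ?P. relabel \<sigma> U = V})"
    using sum.group[of ?P ?O "\<lambda>\<sigma>. relabel \<sigma> U" "\<lambda>_. 1 :: nat"] finP by (simp add: O)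
  also have "\<dots> = card ?O * card {\<sigma>. \<sigma> permutes {1..q} \<and> relabel \<sigma> U = U}"
    using fib by simp
  finally show ?thesis using card_stabilizer[OF U] by simp
qed

lemma falling_fact:
  assumes "k \<le> q"
  shows "falling q k * fact (q - k) = fact q"
  using assms
proof (induction k)
  case (Suc k)
  have "fact (q - k) = (real q - real k) * (fact (q - Suc k) :: real)"
    using Suc.prems by (simp add: fact_reduce Suc_diff_Suc of_nat_diff)
  then show ?case using Suc by (simp add: falling_def mult_ac)
qed (simp add: falling_def)

lemma falling_eq_0: "q < k \<Longrightarrow> falling q k = 0"
  unfolding falling_def by (rule prod_zero) auto

lemma equiv_iso_rel: "equiv (int_lattice M q) (iso_rel M q)"
proof (rule equivI)
  show "iso_rel M q \<subseteq> int_lattice M q \<times> int_lattice M q" by (auto simp: iso_rel_def)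
  show "refl_on (int_lattice M q) (iso_rel M q)"
    by (rule refl_onI) (auto simp: iso_rel_def intro!: exI[of _ id] permutes_id simp: relabel_id)
  show "sym (iso_rel M q)"
    by (rule symI) (auto simp: iso_rel_def relabel_inv intro: permutes_inv)
  show "trans (iso_rel M q)"
  proof (rule transI)
    fix U V W assume "(U, V) \<in> iso_rel M q" "(V, W) \<in> iso_rel M q"
    then obtain \<sigma> \<tau> where "U \<in> int_lattice M q" "W \<in> int_lattice M q" "\<sigma> permutes {1..q}" "V = relabel \<sigma> U"
      "\<tau> permutes {1..q}" "W = relabel \<tau> V" by (auto simp: iso_rel_def)
    then show "(U, W) \<in> iso_rel M q"
      using permutes_compose[of \<tau> "{1..q}" \<sigma>] by (auto simp: iso_rel_def relabel_relabel)
  qed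
qed

definition lattice_part :: "nat \<Rightarrow> nat \<Rightarrow> nat \<Rightarrow> config set set" where
  "lattice_part q k \<nu> = {U \<in> int_lattice M q. card (pieces M q U) = k \<and> codim q U = \<nu>}"

text \<open>A type with automorphism group \<open>A\<close> consists of \<open>(q)\<^sub>\<kappa> / |A|\<close> subspaces, so the weights \<open>1 / |A|\<close> turn a sum
  over types into a sum over all subspaces.\<close>

lemma sum_types:
  fixes f :: "config set \<Rightarrow> real"
  assumes inv: "\<And>U \<sigma>. U \<in> int_lattice M q \<Longrightarrow> \<sigma> permutes {1..q} \<Longrightarrow> f (relabel \<sigma> U) = f U"
  shows "falling q k * (\<Sum>t\<in>types M q k \<nu>. f (representative t) / real (card (Aut M q (representative t))))
    = (\<Sum>U\<in>lattice_part q k \<nu>. f U)"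
    and "\<And>t. t \<in> types M q k \<nu> \<Longrightarrow> representative t \<in> lattice_part q k \<nu>"
proof -
  let ?A = "lattice_part q k \<nu>" and ?r = "iso_rel M q"
  have sub: "?A \<subseteq> int_lattice M q" by (auto simp: lattice_part_def)
  have finA: "finite ?A" using finite_subset[OF sub finite_int_lattice[OF finite_M]] .
  have types: "types M q k \<nu> = ?A // ?r" by (simp add: types_def lattice_part_def)
  have cls: "?r `` {U} \<subseteq> ?A" if "U \<in> ?A" for U
    using that card_pieces_relabel codim_relabel by (auto simp: iso_rel_def lattice_part_def)
  have rep: "representative t \<in> ?A \<and> t = ?r `` {representative t}" if t: "t \<in> ?A // ?r" for t
  proof -
    obtain U where U: "U \<in> ?A" "t = ?r `` {U}" using t by (auto elim: quotientE)
    have "U \<in> t" using equiv_class_self[OF equiv_iso_rel] U sub by blast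
    then have r: "representative t \<in> t" unfolding representative_def by (rule someI)
    then have "(U, representative t) \<in> ?r" using U(2) by auto
    then have "?r `` {U} = ?r `` {representative t}" by (rule equiv_class_eq[OF equiv_iso_rel])
    then show ?thesis using r U cls by auto
  qed
  show "\<And>t. t \<in> types M q k \<nu> \<Longrightarrow> representative t \<in> ?A" using rep types by simp
  show "falling q k * (\<Sum>t\<in>types M q k \<nu>. f (representative t) / real (card (Aut M q (representative t)))) = (\<Sum>U\<in>?A. f U)"
  proof (cases "k \<le> q")
    case False
    have "?A = {}" using False N_alpha(2) by (auto simp: lattice_part_def)
    then show ?thesis using falling_eq_0[of q k] False by simp
  next
    case True
    have weight: "falling q k * (f (representative t) / real (card (Aut M q (representative t)))) = (\<Sum>U\<in>t. f U)"
      if t: "t \<in> ?A // ?r" for t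
    proof -
      let ?U = "representative t"
      have U: "?U \<in> int_lattice M q" "card (pieces M q ?U) = k" using rep[OF t] by (auto simp: lattice_part_def)
      have "card t * (card (Aut M q ?U) * fact (q - k)) = (fact q :: nat)"
        using card_type[OF U(1)] rep[OF t] U(2) by simp
      then have "real (card t) * (real (card (Aut M q ?U)) * fact (q - k)) = fact q"
        by (metis of_nat_fact of_nat_mult)
      then have "(real (card t) * real (card (Aut M q ?U))) * fact (q - k) = falling q k * fact (q - k)"
        using falling_fact[OF True] by (simp add: mult_ac)
      then have c: "real (card t) * real (card (Aut M q ?U)) = falling q k" by simp
      have "card (Aut M q ?U) \<noteq> 0"
      proof
        assume "card (Aut M q ?U) = 0"
        then have "falling q k = 0" using c by simp
        then show False using falling_fact[OF True] by simp
      qed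
      then have "falling q k * (f ?U / real (card (Aut M q ?U))) = real (card t) * f ?U"
        unfolding c[symmetric] by simp
      also have "\<dots> = (\<Sum>U\<in>t. f U)"
      proof -
        have "f V = f ?U" if "V \<in> t" for V
        proof -
          have "(?U, V) \<in> ?r" using rep[OF t] that by auto
          then show ?thesis using inv[OF U(1)] by (auto simp: iso_rel_def)
        qed
        then show ?thesis by simp
      qed
      finally show ?thesis .
    qed
    have union: "\<Union>(?A // ?r) = ?A"
    proof (intro equalityI subsetI)
      fix U assume "U \<in> \<Union>(?A // ?r)"
      then show "U \<in> ?A" using cls by (auto elim!: quotientE)
    next
      fix U assume U: "U \<in> ?A"
      then have "U \<in> ?r `` {U}" using equiv_class_self[OF equiv_iso_rel] sub by blast
      then show "U \<in> \<Union>(?A // ?r)" using U quotientI[of U ?A ?r] by blast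
    qed
    have "(\<Sum>U\<in>\<Union>(?A // ?r). f U) = (\<Sum>t\<in>?A // ?r. \<Sum>U\<in>t. f U)"
    proof (rule sum.Union_disjoint[unfolded o_def])
      show "\<forall>t\<in>?A // ?r. finite t" using rep cls finA finite_subset by metis
      show "\<forall>s\<in>?A // ?r. \<forall>t\<in>?A // ?r. s \<noteq> t \<longrightarrow> s \<inter> t = {}"
      proof (intro ballI impI)
        fix s t assume "s \<in> ?A // ?r" "t \<in> ?A // ?r" "s \<noteq> t"
        moreover have "?A // ?r \<subseteq> int_lattice M q // ?r" using sub by (auto simp: quotient_def)
        ultimately show "s \<inter> t = {}" using quotient_disj[OF equiv_iso_rel, of s q t] by blast
      qed
    qed
    then show ?thesis using weight by (simp add: types union sum_distrib_left)
  qed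
qed

section \<open>The coefficients of the falling factorials\<close>

definition contribution :: "nat \<Rightarrow> nat \<Rightarrow> nat \<Rightarrow> config set \<Rightarrow> real" where
  "contribution q i n U = mu q U * qp_coeff (N q U) (2 * q) i n"

lemma contribution_relabel:
  "U \<in> int_lattice M q \<Longrightarrow> \<sigma> permutes {1..q} \<Longrightarrow> contribution q i n (relabel \<sigma> U) = contribution q i n U"
  unfolding contribution_def by (simp only: mu_relabel qp_coeff_N_relabel)

text \<open>The range of \<open>\<nu>\<close> omits no subspace with \<open>\<kappa>\<close> pieces that matters: codimensions below \<open>\<kappa> / 2\<close> or above \<open>2 \<kappa> - 2\<close> do
  not occur, and for \<open>\<nu> > i\<close> the degree is too small to contribute.\<close>

lemma theta_bar_lattice:
  assumes "2 \<le> k"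
  shows "falling q k * theta_bar M q i k n
    = (\<Sum>U\<in>{U \<in> int_lattice M q. card (pieces M q U) = k}. contribution q i n U)"
proof -
  let ?R = "{nat \<lceil>real k / 2\<rceil>..min i (2 * k - 2)}"
  let ?L = "{U \<in> int_lattice M q. card (pieces M q U) = k}"
  have finL: "finite (int_lattice M q)" by (rule finite_int_lattice[OF finite_M])
  note st = sum_types[of q "contribution q i n", OF contribution_relabel]
  have "theta_bar M q i k n = (\<Sum>\<nu>\<in>?R. \<Sum>t\<in>types M q k \<nu>.
      contribution q i n (representative t) / real (card (Aut M q (representative t))))"
    unfolding theta_bar_def Let_def
  proof (intro sum.cong refl)
    fix \<nu> t assume nu: "\<nu> \<in> ?R" and t: "t \<in> types M q k \<nu>"
    let ?U = "representative t"
    have U: "?U \<in> int_lattice M q" "codim q ?U = \<nu>" using st(2)[OF _ _ t] by (auto simp: lattice_part_def)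
    have "gamma_bar M q ?U (i - \<nu>) n = qp_coeff (N q ?U) (2 * q) i n"
      using gamma_bar_N[OF U(1), of i n] U(2) nu by simp
    then show "mu q ?U * (1 / real (card (Aut M q ?U))) * gamma_bar M q ?U (i - \<nu>) n =
        contribution q i n ?U / real (card (Aut M q ?U))"
      by (simp only: contribution_def) simp
  qed
  then have "falling q k * theta_bar M q i k n = (\<Sum>\<nu>\<in>?R. \<Sum>U\<in>lattice_part q k \<nu>. contribution q i n U)"
    by (simp only: sum_distrib_left[of "falling q k" _ ?R] st(1))
  also have "\<dots> = (\<Sum>\<nu>\<in>?R. \<Sum>U\<in>{U \<in> {U \<in> ?L. codim q U \<in> ?R}. codim q U = \<nu>}. contribution q i n U)"
    by (intro sum.cong refl) (auto simp: lattice_part_def)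
  also have "\<dots> = (\<Sum>U\<in>{U \<in> ?L. codim q U \<in> ?R}. contribution q i n U)"
    by (rule sum.group) (use finL in auto)
  also have "\<dots> = (\<Sum>U\<in>?L. contribution q i n U)"
  proof (rule sum.mono_neutral_left)
    show "\<forall>U\<in>?L - {U \<in> ?L. codim q U \<in> ?R}. contribution q i n U = 0"
    proof
      fix U assume U: "U \<in> ?L - {U \<in> ?L. codim q U \<in> ?R}"
      then have L: "U \<in> int_lattice M q" "card (pieces M q U) = k" by auto
      have "U \<noteq> config_space {1..q}"
      proof
        assume "U = config_space {1..q}"
        then have "pieces M q U = {}" using pieces_sol[OF nonzero_M, of "{}" q] by (simp add: sol_empty)
        then show False using L(2) assms by simp
      qed
      from pieces_bounds[OF L(1) this] L(2)
      have b: "k \<le> 2 * codim q U" "codim q U + 2 \<le> 2 * k" by auto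
      have "real k / 2 \<le> real_of_int (int (codim q U))" using b(1) by simp
      then have "nat \<lceil>real k / 2\<rceil> \<le> codim q U" by (metis ceiling_le_iff nat_int nat_mono)
      then have "i < codim q U" using U b(2) by auto
      then show "contribution q i n U = 0"
        using qp_coeff_N_eq_0[OF L(1)] unfolding contribution_def by simp
    qed
  qed (use finL in auto)
  finally show ?thesis .
qed

lemma gamma_theta_bar:
  assumes "i \<ge> 1"
  shows "fact q * gamma M q i n = (\<Sum>k = 2..2 * i. falling q k * theta_bar M q i k n)"
proof -
  let ?L = "int_lattice M q" and ?c = "\<lambda>U. card (pieces M q U)"
  have finL: "finite ?L" by (rule finite_int_lattice[OF finite_M])
  have "(\<Sum>k = 2..2 * i. falling q k * theta_bar M q i k n)
      = (\<Sum>k = 2..2 * i. \<Sum>U\<in>{U \<in> ?L. ?c U = k}. contribution q i n U)"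
    by (intro sum.cong refl theta_bar_lattice) simp
  also have "\<dots> = (\<Sum>k = 2..2 * i. \<Sum>U\<in>{U \<in> {U \<in> ?L. ?c U \<in> {2..2 * i}}. ?c U = k}. contribution q i n U)"
    by (intro sum.cong refl) auto
  also have "\<dots> = (\<Sum>U\<in>{U \<in> ?L. ?c U \<in> {2..2 * i}}. contribution q i n U)"
    by (rule sum.group) (use finL in auto)
  also have "\<dots> = (\<Sum>U\<in>?L. contribution q i n U)"
  proof (rule sum.mono_neutral_left)
    show "\<forall>U\<in>?L - {U \<in> ?L. ?c U \<in> {2..2 * i}}. contribution q i n U = 0"
    proof
      fix U assume U: "U \<in> ?L - {U \<in> ?L. ?c U \<in> {2..2 * i}}"
      show "contribution q i n U = 0"
      proof (cases "U = config_space {1..q}")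
        case True
        show ?thesis unfolding contribution_def True qp_coeff_N_config_space using assms by simp
      next
        case False
        have "2 \<le> ?c U" "?c U \<le> 2 * codim q U" using pieces_bounds[of U q] U False by auto
        then have "i < codim q U" using U by auto
        then show ?thesis using qp_coeff_N_eq_0[of U q i] U unfolding contribution_def by simp
      qed
    qed
  qed (use finL in auto)
  finally show ?thesis unfolding contribution_def gamma_sum by simp
qed

text \<open>The sum over the systems of equations that involve all of the pieces \<open>1, \<dots>, k\<close>. It does not refer to the
  total number \<open>q\<close> of pieces, which is why the coefficients of the falling factorials do not depend on \<open>q\<close>.\<close>

definition spanning_sum :: "nat \<Rightarrow> nat \<Rightarrow> nat \<Rightarrow> real" where
  "spanning_sum k i n = (\<Sum>S\<in>{S \<in> Pow (eqs M {1..k}). supp S = {1..k}}.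
     (-1) ^ card S * qp_coeff (\<lambda>n. real (points {1..k} (sol {1..k} S) n)) (2 * k) i n)"

lemma contribution_spanning:
  assumes "k \<le> q"
  shows "(\<Sum>U\<in>{U \<in> int_lattice M q. pieces M q U = {1..k}}. contribution q i n U) = spanning_sum k i n"
proof -
  have sets: "{S \<in> Pow (eqs M {1..q}). pieces M q (sol {1..q} S) = {1..k}}
      = {S \<in> Pow (eqs M {1..k}). supp S = {1..k}}"
  proof (intro equalityI subsetI)
    fix S assume "S \<in> {S \<in> Pow (eqs M {1..q}). pieces M q (sol {1..q} S) = {1..k}}"
    then have S: "S \<subseteq> eqs M {1..q}" "supp S = {1..k}" using pieces_sol[OF nonzero_M, of S q] by auto
    then show "S \<in> {S \<in> Pow (eqs M {1..k}). supp S = {1..k}}" using eqs_supp[OF S(1)] by simp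
  next
    fix S assume S: "S \<in> {S \<in> Pow (eqs M {1..k}). supp S = {1..k}}"
    then have "S \<subseteq> eqs M {1..q}" using eqs_mono[of "{1..k}" "{1..q}" M] assms by auto
    then show "S \<in> {S \<in> Pow (eqs M {1..q}). pieces M q (sol {1..q} S) = {1..k}}"
      using pieces_sol[OF nonzero_M, of S q] S by simp
  qed
  have "(\<Sum>U\<in>{U \<in> int_lattice M q. pieces M q U = {1..k}}. contribution q i n U) =
    (\<Sum>S\<in>{S \<in> Pow (eqs M {1..q}). pieces M q (sol {1..q} S) = {1..k}}.
      (-1) ^ card S * qp_coeff (N q (sol {1..q} S)) (2 * q) i n)"
    unfolding contribution_def
    by (rule sum_over_lattice[OF finite_M nonzero_M,
          where P = "\<lambda>U. pieces M q U = {1..k}" and f = "\<lambda>U. qp_coeff (N q U) (2 * q) i n"])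
  also have "\<dots> = spanning_sum k i n"
    unfolding sets spanning_sum_def
  proof (intro sum.cong refl)
    fix S assume S: "S \<in> {S \<in> Pow (eqs M {1..k}). supp S = {1..k}}"
    then have fin: "finite S" using finite_subset[OF _ finite_eqs_M[of "{1..k}"]] by auto
    have "qp_coeff (N q (sol {1..q} S)) (2 * k + 2 * (q - k)) i n =
        qp_coeff (\<lambda>n. real (points {1..k} (sol {1..k} S) n)) (2 * k) i n"
    proof (rule qp_coeff_mult_power)
      show "quasipoly (\<lambda>n. real (points {1..k} (sol {1..k} S) n))"
        using S fin by (intro quasipoly_points) auto
      fix n :: nat
      show "N q (sol {1..q} S) n = real (points {1..k} (sol {1..k} S) n) * real n ^ (2 * (q - k))"
        using points_extend[of "{1..q}" "{1..k}" S n] S assms by simp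
    qed
    moreover have "2 * k + 2 * (q - k) = 2 * q" using assms by simp
    ultimately show "(-1) ^ card S * qp_coeff (N q (sol {1..q} S)) (2 * q) i n =
        (-1) ^ card S * qp_coeff (\<lambda>n. real (points {1..k} (sol {1..k} S) n)) (2 * k) i n"
      by (simp only:)
  qed
  finally show ?thesis .
qed

lemma ex_permutation_image:
  assumes "K \<subseteq> {1..q}" "card K = k"
  obtains \<sigma> where "\<sigma> permutes {1..q}" "\<sigma> ` {1..k} = K" "inv \<sigma> ` K = {1..k}"
proof -
  have fin: "finite K" "finite ({1..q} - K)" using assms(1) finite_subset by auto
  have k: "k \<le> q" using card_mono[OF _ assms(1)] assms(2) by simp
  obtain f where f: "bij_betw f {1..k} K" using finite_same_card_bij[of "{1..k}" K] fin assms by auto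
  have "card ({1..q} - {1..k}) = card ({1..q} - K)"
    using assms k fin by (simp add: card_Diff_subset)
  then obtain g where g: "bij_betw g ({1..q} - {1..k}) ({1..q} - K)"
    using finite_same_card_bij[of "{1..q} - {1..k}" "{1..q} - K"] by auto
  define \<sigma> where "\<sigma> i = (if i \<in> {1..k} then f i else if i \<in> {1..q} then g i else i)" for i
  have "bij_betw \<sigma> {1..k} K" using f by (rule bij_betw_cong[THEN iffD1, rotated]) (simp add: \<sigma>_def)
  moreover have "bij_betw \<sigma> ({1..q} - {1..k}) ({1..q} - K)"
    using g by (rule bij_betw_cong[THEN iffD1, rotated]) (auto simp: \<sigma>_def)
  ultimately have "bij_betw \<sigma> ({1..k} \<union> ({1..q} - {1..k})) (K \<union> ({1..q} - K))"
    by (rule bij_betw_combine) auto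
  moreover have "{1..k} \<union> ({1..q} - {1..k}) = {1..q}" "K \<union> ({1..q} - K) = {1..q}" using k assms(1) by auto
  ultimately have "bij_betw \<sigma> {1..q} {1..q}" by simp
  then have p: "\<sigma> permutes {1..q}" by (rule bij_imp_permutes) (use k in \<open>auto simp: \<sigma>_def\<close>)
  moreover have "\<sigma> ` {1..k} = K" using \<open>bij_betw \<sigma> {1..k} K\<close> by (simp add: bij_betw_def)
  moreover from this have "inv \<sigma> ` K = {1..k}"
    using permutes_inverses[OF p] by (metis (no_types, lifting) image_cong image_ident image_image)
  ultimately show ?thesis using that by blast
qed

lemma contribution_pieces:
  assumes "K \<subseteq> {1..q}" "card K = k"
  shows "(\<Sum>U\<in>{U \<in> int_lattice M q. pieces M q U = K}. contribution q i n U) = spanning_sum k i n"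
proof -
  obtain \<sigma> where s: "\<sigma> permutes {1..q}" "\<sigma> ` {1..k} = K" "inv \<sigma> ` K = {1..k}"
    using ex_permutation_image[OF assms] .
  have k: "k \<le> q" using card_mono[OF _ assms(1)] assms(2) by simp
  have "(\<Sum>U\<in>{U \<in> int_lattice M q. pieces M q U = K}. contribution q i n U)
      = (\<Sum>U\<in>{U \<in> int_lattice M q. pieces M q U = {1..k}}. contribution q i n U)"
  proof (rule sum.reindex_bij_witness[of _ "relabel (inv \<sigma>)" "relabel \<sigma>"])
    fix U assume U: "U \<in> {U \<in> int_lattice M q. pieces M q U = K}"
    then show "relabel (inv \<sigma>) (relabel \<sigma> U) = U" by (simp add: relabel_inv[OF s(1)])
    show "relabel \<sigma> U \<in> {U \<in> int_lattice M q. pieces M q U = {1..k}}"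
      using U lattice_relabel[of U q \<sigma>] s by simp
    show "contribution q i n (relabel \<sigma> U) = contribution q i n U"
      using U contribution_relabel[OF _ s(1)] by simp
  next
    fix U assume U: "U \<in> {U \<in> int_lattice M q. pieces M q U = {1..k}}"
    then show "relabel \<sigma> (relabel (inv \<sigma>) U) = U" by (simp add: relabel_inv[OF s(1)])
    show "relabel (inv \<sigma>) U \<in> {U \<in> int_lattice M q. pieces M q U = K}"
      using U lattice_relabel[of U q "inv \<sigma>"] s permutes_inv[OF s(1)] permutes_inv_inv[OF s(1)] by simp
  qed
  then show ?thesis using contribution_spanning[OF k] by simp
qed

text \<open>All \<open>k\<close>-element sets of pieces contribute alike because a permutation carries any of them to \<open>{1..k}\<close>; there are
  \<open>(q)\<^sub>k / k!\<close> of them.\<close>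

lemma theta_bar_spanning:
  assumes "2 \<le> k" "k \<le> q"
  shows "fact k * theta_bar M q i k n = spanning_sum k i n"
proof -
  let ?L = "int_lattice M q"
  have finL: "finite ?L" by (rule finite_int_lattice[OF finite_M])
  have "falling q k * theta_bar M q i k n = (\<Sum>U\<in>{U \<in> ?L. card (pieces M q U) = k}. contribution q i n U)"
    by (rule theta_bar_lattice[OF assms(1)])
  also have "\<dots> = (\<Sum>K\<in>{K. K \<subseteq> {1..q} \<and> card K = k}.
      \<Sum>U\<in>{U \<in> {U \<in> ?L. card (pieces M q U) = k}. pieces M q U = K}. contribution q i n U)"
    by (rule sum.group[symmetric]) (use finL pieces_subset in auto)
  also have "\<dots> = (\<Sum>K\<in>{K. K \<subseteq> {1..q} \<and> card K = k}. spanning_sum k i n)"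
  proof (intro sum.cong refl)
    fix K assume K: "K \<in> {K. K \<subseteq> {1..q} \<and> card K = k}"
    then have e: "{U \<in> {U \<in> ?L. card (pieces M q U) = k}. pieces M q U = K} = {U \<in> ?L. pieces M q U = K}"
      by auto
    show "(\<Sum>U\<in>{U \<in> {U \<in> ?L. card (pieces M q U) = k}. pieces M q U = K}. contribution q i n U) = spanning_sum k i n"
      unfolding e using contribution_pieces[of K q k] K by simp
  qed
  also have "\<dots> = real (q choose k) * spanning_sum k i n"
    using n_subsets[of "{1..q}" k] by simp
  finally have 1: "falling q k * theta_bar M q i k n = real (q choose k) * spanning_sum k i n" .
  have "real (q choose k) * fact k * fact (q - k) = fact q"
    using arg_cong[OF binomial_fact_lemma[OF assms(2)], of real] by (simp add: mult_ac)
  then have "(real (q choose k) * fact k) * fact (q - k) = falling q k * fact (q - k)"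
    using falling_fact[OF assms(2)] by simp
  then have "real (q choose k) * fact k = falling q k" by simp
  then have "real (q choose k) * (fact k * theta_bar M q i k n) = real (q choose k) * spanning_sum k i n"
    using 1 by (simp add: mult.assoc[symmetric])
  moreover have "real (q choose k) \<noteq> 0" using assms(2) by simp
  ultimately show ?thesis by simp
qed

lemma theta_bar_stable:
  assumes "i \<ge> 1" "k \<le> q"
  shows "theta_bar M q i k n = theta_bar M k i k n"
proof -
  consider "k = 0" | "k = 1" | "2 \<le> k" by linarith
  then show ?thesis
  proof cases
    case 1
    \<comment> \<open>only the whole space involves no pieces; there \<open>\<alpha>\<close> is constant, and its coefficient at \<open>i \<ge> 1\<close> is \<open>0\<close>\<close>
    have "theta_bar M r i 0 n = 0" for r
      unfolding theta_bar_def
    proof (intro sum.neutral ballI)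
      fix \<nu> t assume "\<nu> \<in> {nat \<lceil>real 0 / 2\<rceil>..min i (2 * 0 - 2)}" and t: "t \<in> types M r 0 \<nu>"
      then have nu: "\<nu> = 0" by simp
      have "representative t \<in> lattice_part r 0 \<nu>"
        using sum_types(2)[of r "\<lambda>_. 0", OF _ t] by simp
      then have "gamma_bar M r (representative t) (i - \<nu>) n = 0"
        using assms(1) nu by (simp add: lattice_part_def gamma_bar_def qp_coeff_def)
      then show "(let U = representative t in mu r U * (1 / real (card (Aut M r U))) * gamma_bar M r U (i - \<nu>) n) = 0"
        by simp
    qed
    then show ?thesis by (simp add: 1)
  next
    case 2
    \<comment> \<open>the range of codimensions is empty\<close>
    have "nat \<lceil>real 1 / 2\<rceil> = 1" by (simp add: ceiling_eq_iff nat_eq_iff)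
    then show ?thesis by (simp add: 2 theta_bar_def)
  next
    case 3
    have "fact k * theta_bar M q i k n = fact k * theta_bar M k i k n"
      using theta_bar_spanning[OF 3 assms(2)] theta_bar_spanning[OF 3 order_refl] by simp
    then show ?thesis by simp
  qed
qed

lemma theta_bar_periodic:
  assumes "2 \<le> k"
  shows "\<exists>T>0. \<forall>n. theta_bar M k i k (n + T) = theta_bar M k i k n"
proof -
  let ?L = "int_lattice M k"
  have "\<forall>U\<in>?L. \<exists>T>0. \<forall>n. constituents (N k U) (n + T) = constituents (N k U) n"
  proof
    fix U assume "U \<in> ?L"
    then have "has_constituents (N k U) (constituents (N k U))"
      by (intro has_constituents_constituents N_alpha(3))
    then show "\<exists>T>0. \<forall>n. constituents (N k U) (n + T) = constituents (N k U) n"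
      unfolding has_constituents_def by blast
  qed
  from common_period[OF finite_int_lattice[OF finite_M] this]
  obtain T where T: "T > 0" "\<And>U n. U \<in> ?L \<Longrightarrow> constituents (N k U) (n + T) = constituents (N k U) n"
    by blast
  have "falling k k * theta_bar M k i k (n + T) = falling k k * theta_bar M k i k n" for n
    unfolding theta_bar_lattice[OF assms]
    by (intro sum.cong refl) (simp only: contribution_def qp_coeff_def T(2) mem_Collect_eq)
  moreover have "falling k k \<noteq> 0" using falling_fact[of k k] by auto
  ultimately show ?thesis using T(1) by auto
qed

text \<open>With three pieces the codimension is at least two, so only leading coefficients enter \<open>\<gamma>\<^sub>2\<close> here.\<close>

lemma theta_bar_3_const: "falling q 3 * theta_bar M q 2 3 n = falling q 3 * theta_bar M q 2 3 n'"
proof -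
  have "contribution q 2 n U = contribution q 2 n' U"
    if U: "U \<in> {U \<in> int_lattice M q. card (pieces M q U) = 3}" for U
  proof (cases "2 < codim q U")
    case True
    then show ?thesis using qp_coeff_N_eq_0[of U q 2] U unfolding contribution_def by simp
  next
    case False
    have "U \<noteq> config_space {1..q}"
    proof
      assume "U = config_space {1..q}"
      then have "pieces M q U = {}" using pieces_sol[OF nonzero_M, of "{}" q] by (simp add: sol_empty)
      then show False using U by simp
    qed
    then have "codim q U = 2" using False pieces_bounds(2)[of U q] U by auto
    then show ?thesis using qp_coeff_N_leading_const[of U q n n'] U unfolding contribution_def by simp
  qed
  then have "(\<Sum>U\<in>{U \<in> int_lattice M q. card (pieces M q U) = 3}. contribution q 2 n U)
      = (\<Sum>U\<in>{U \<in> int_lattice M q. card (pieces M q U) = 3}. contribution q 2 n' U)"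
    by (rule sum.cong[OF refl])
  then show ?thesis using theta_bar_lattice[of 3 q 2] by simp
qed

end

section \<open>Two pieces on a line\<close>

lemma card_shifted_interval:
  "card {x \<in> {1..int n}. x + a \<in> {1..int n}} = nat (int n - \<bar>a\<bar>)"
proof -
  have "{x \<in> {1..int n}. x + a \<in> {1..int n}} = {max 1 (1 - a)..min (int n) (int n - a)}" by auto
  then show ?thesis by (simp add: max_def min_def)
qed

lemma sum_symmetric_interval:
  "(\<Sum>k\<in>{- int n..int n}. g (nat \<bar>k\<bar>)) = g 0 + 2 * (\<Sum>k\<in>{1..n}. g k :: real)"
proof (induction n)
  case (Suc n)
  have "{- int (Suc n)..int (Suc n)} = insert (int (Suc n)) (insert (- int (Suc n)) {- int n..int n})" by auto
  then have "(\<Sum>k\<in>{- int (Suc n)..int (Suc n)}. g (nat \<bar>k\<bar>)) =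
      2 * g (Suc n) + (\<Sum>k\<in>{- int n..int n}. g (nat \<bar>k\<bar>))"
    by (simp add: nat_add_distrib)
  then show ?case using Suc by simp
qed simp

lemma sum_line_pairs:
  fixes n c d :: real
  shows "(\<Sum>k\<in>{1..Q}. (n - real k * c) * (n - real k * d)) =
    real Q * n\<^sup>2 - n * (c + d) * real Q * (real Q + 1) / 2 + c * d * real Q * (real Q + 1) * (2 * real Q + 1) / 6"
  by (induction Q) (simp_all add: field_simps power2_eq_square)

text \<open>The summands of \<open>a10\<close>, \<open>a12\<close> and \<open>a13\<close>: the coefficients of \<open>n\<^sup>3\<close>, \<open>n\<close> and \<open>1\<close> in the number of ordered pairs of
  positions on a common line of direction \<open>m\<close>.\<close>

definition a10_term :: "int \<times> int \<Rightarrow> real" where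
  "a10_term m = of_int (3 * d_hat m - c_hat m) / of_int (3 * (d_hat m)\<^sup>2)"

definition a12_term :: "int \<times> int \<Rightarrow> nat \<Rightarrow> real" where
  "a12_term m n = of_int (c_hat m * (d_hat m)\<^sup>2 + 3 * (d_hat m - c_hat m) * n_bar m n * (d_hat m - n_bar m n))
       / of_int (3 * (d_hat m)\<^sup>2)"

definition a13_term :: "int \<times> int \<Rightarrow> nat \<Rightarrow> real" where
  "a13_term m n = - (of_int (c_hat m) / of_int (3 * (d_hat m)\<^sup>2)
     * of_int (n_bar m n * (d_hat m - n_bar m n) * (d_hat m - 2 * n_bar m n)))"

lemma line_pairs_closed_form:
  fixes c d Q r n :: real
  assumes "d \<noteq> 0" "n = d * Q + r"
  shows "n\<^sup>2 + 2 * (Q * n\<^sup>2 - n * (c + d) * Q * (Q + 1) / 2 + c * d * Q * (Q + 1) * (2 * Q + 1) / 6) =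
    (3 * d - c) / (3 * d\<^sup>2) * n ^ 3 + (c * d\<^sup>2 + 3 * (d - c) * r * (d - r)) / (3 * d\<^sup>2) * n
      - c / (3 * d\<^sup>2) * (r * (d - r) * (d - 2 * r))"
proof -
  have "3 * d\<^sup>2 * (n\<^sup>2 + 2 * (Q * n\<^sup>2 - n * (c + d) * Q * (Q + 1) / 2 + c * d * Q * (Q + 1) * (2 * Q + 1) / 6)) =
    (3 * d - c) * n ^ 3 + (c * d\<^sup>2 + 3 * (d - c) * r * (d - r)) * n - c * (r * (d - r) * (d - 2 * r))"
    unfolding assms(2) by (simp add: field_simps power2_eq_square power3_eq_cube)
  moreover have "3 * d\<^sup>2 \<noteq> 0" using assms(1) by simp
  ultimately show ?thesis
    by (simp add: divide_simps)
qed

context rider_piece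
begin

lemma hat_bounds:
  assumes "m \<in> M"
  shows "1 \<le> d_hat m" "0 \<le> c_hat m" "c_hat m \<le> d_hat m"
proof -
  have "m \<noteq> (0, 0)" using assms nonzero_M by auto
  then have "fst m \<noteq> 0 \<or> snd m \<noteq> 0" by (cases m) auto
  then show "1 \<le> d_hat m" by (auto simp: d_hat_def)
  show "0 \<le> c_hat m" "c_hat m \<le> d_hat m" by (auto simp: d_hat_def c_hat_def)
qed

text \<open>The second position is the first one shifted by \<open>k\<close> times the move, which leaves \<open>n - |k c|\<close> choices for one
  coordinate and \<open>n - |k d|\<close> for the other.\<close>

lemma points_pair_sum:
  assumes m: "m \<in> M" and ij: "i \<noteq> j"
  shows "points {i, j} (sol {i, j} {(m, i, j)}) n =
    (\<Sum>k\<in>{- int n..int n}. nat (int n - \<bar>k * fst m\<bar>) * nat (int n - \<bar>k * snd m\<bar>))"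
proof -
  obtain c d where cd: "m = (c, d)" by (cases m)
  have nz: "c \<noteq> 0 \<or> d \<noteq> 0" using m nonzero_M cd by auto
  let ?X = "\<lambda>a. {x \<in> {1..int n}. x + a \<in> {1..int n}}"
  let ?P = "SIGMA k:{- int n..int n}. ?X (k * c) \<times> ?X (k * d)"
  define \<Phi> :: "int \<times> int \<times> int \<Rightarrow> config" where
    "\<Phi> = (\<lambda>(k, x, y) l. if l = i then (of_int x, of_int y) else if l = j then (of_int (x + k * c), of_int (y + k * d)) else 0)"
  have inj: "inj_on \<Phi> ?P"
  proof (rule inj_onI)
    fix p p' assume "\<Phi> p = \<Phi> p'"
    moreover obtain k x y where p: "p = (k, x, y)" by (cases p)
    moreover obtain k' x' y' where p': "p' = (k', x', y')" by (cases p')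
    ultimately have "\<Phi> (k, x, y) i = \<Phi> (k', x', y') i" "\<Phi> (k, x, y) j = \<Phi> (k', x', y') j" by auto
    then have "x = x'" "y = y'" "k * c = k' * c" "k * d = k' * d"
      using ij by (simp_all add: \<Phi>_def flip: of_int_mult of_int_add)
    then show "p = p'" using nz p p' by auto
  qed
  have img: "\<Phi> ` ?P = sol {i, j} {(m, i, j)} \<inter> grid {i, j} n"
  proof (intro equalityI subsetI)
    fix z assume "z \<in> \<Phi> ` ?P"
    then obtain k x y where z: "z = \<Phi> (k, x, y)" and xy: "x \<in> {1..int n}" "x + k * c \<in> {1..int n}"
      "y \<in> {1..int n}" "y + k * d \<in> {1..int n}" by auto
    have vals: "z i = (of_int x, of_int y)" "z j = (of_int (x + k * c), of_int (y + k * d))"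
      using ij by (simp_all add: z \<Phi>_def)
    have "z \<in> config_space {i, j}" by (simp add: config_space_def z \<Phi>_def)
    moreover have "on_hyperplane m i j z"
      by (simp add: on_hyperplane_def vals cd)
    moreover have "coord (l, b) z \<in> real_of_int ` {1..int n}" if "l \<in> {i, j}" for l b
      using that vals xy by (cases "l = i"; cases b) (auto simp: coord_def simp del: of_int_add of_int_mult)
    ultimately show "z \<in> sol {i, j} {(m, i, j)} \<inter> grid {i, j} n" by (auto simp: sol_def grid_def)
  next
    fix z assume z: "z \<in> sol {i, j} {(m, i, j)} \<inter> grid {i, j} n"
    have "\<exists>a. coord (l, b) z = of_int a \<and> a \<in> {1..int n}" if "l \<in> {i, j}" for l b
      using grid_coord[of z "{i, j}" n "(l, b)"] z that by auto
    then obtain x y x' y' where v: "coord (i, True) z = of_int x" "x \<in> {1..int n}" "coord (i, False) z = of_int y" "y \<in> {1..int n}"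
      "coord (j, True) z = of_int x'" "x' \<in> {1..int n}" "coord (j, False) z = of_int y'" "y' \<in> {1..int n}"
      by (metis insertI1 insertI2)
    have zi: "z i = (of_int x, of_int y)" and zj: "z j = (of_int x', of_int y')"
      using v by (simp_all add: coord_def prod_eq_iff)
    have "on_hyperplane m i j z" using z by (auto simp: sol_def)
    then have "real_of_int (d * (x' - x)) = real_of_int (c * (y' - y))"
      by (simp add: on_hyperplane_def zi zj cd)
    then have eq: "d * (x' - x) = c * (y' - y)" by (simp only: of_int_eq_iff)
    have "rider_moves {m}" using rider m by (auto simp: rider_moves_def)
    from attack_iff[OF this, of "(x, y)" "(x', y')"] have "attack {m} (x, y) (x', y')" using eq by (simp add: cd)
    then obtain k where k: "x' - x = k * c" "y' - y = k * d" by (auto simp: attack_def cd)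
    have "\<bar>k\<bar> \<le> int n"
    proof -
      have "\<bar>k * c\<bar> \<le> int n" "\<bar>k * d\<bar> \<le> int n" using v unfolding k[symmetric] by auto
      moreover have "\<bar>k\<bar> * 1 \<le> \<bar>k\<bar> * \<bar>c\<bar> \<or> \<bar>k\<bar> * 1 \<le> \<bar>k\<bar> * \<bar>d\<bar>"
        using nz by (metis abs_ge_zero mult_left_mono zero_less_abs_iff zless_imp_add1_zle add_0)
      ultimately show ?thesis by (auto simp: abs_mult)
    qed
    moreover have "x + k * c = x'" "y + k * d = y'" using k by auto
    ultimately have "(k, x, y) \<in> ?P" using v by auto
    moreover have "\<Phi> (k, x, y) = z"
    proof
      fix l
      have "z l = 0" if "l \<noteq> i" "l \<noteq> j" using z that by (auto simp: grid_def config_space_def)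
      then show "\<Phi> (k, x, y) l = z l"
        using zi zj \<open>x + k * c = x'\<close> \<open>y + k * d = y'\<close> by (simp add: \<Phi>_def del: of_int_add of_int_mult)
    qed
    ultimately show "z \<in> \<Phi> ` ?P" by blast
  qed
  have "points {i, j} (sol {i, j} {(m, i, j)}) n = card ?P"
    by (simp only: points_def img[symmetric] card_image[OF inj])
  also have "\<dots> = (\<Sum>k\<in>{- int n..int n}. nat (int n - \<bar>k * c\<bar>) * nat (int n - \<bar>k * d\<bar>))"
  proof -
    have "finite (?X a)" for a by (rule finite_subset[of _ "{1..int n}"]) auto
    then have "card ?P = (\<Sum>k\<in>{- int n..int n}. card (?X (k * c) \<times> ?X (k * d)))"
      by (intro card_SigmaI ballI finite_cartesian_product) auto
    then show ?thesis by (simp only: card_cartesian_product card_shifted_interval)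
  qed
  finally show ?thesis by (simp add: cd)
qed

text \<open>Only the shifts with \<open>|k| \<le> n div d\<close>, where \<open>d\<close> is the larger of the two steps, fit on the board; summing the
  quadratic polynomial \<open>(n - k c) (n - k d)\<close> over them gives the explicit constituents.\<close>

lemma has_constituents_pair:
  assumes m: "m \<in> M" and ij: "i \<noteq> j"
  shows "has_constituents (\<lambda>n. real (points {i, j} (sol {i, j} {(m, i, j)}) n))
    (\<lambda>n. [:a13_term m n, a12_term m n, 0, a10_term m:])"
proof (rule has_constituentsI)
  let ?C = "c_hat m" and ?D = "d_hat m"
  note hb = hat_bounds[OF m]
  show "0 < nat ?D" using hb by simp
  have "n_bar m (n + nat ?D) = n_bar m n" for n using hb by (simp add: n_bar_def)
  then show "[:a13_term m (n + nat ?D), a12_term m (n + nat ?D), 0, a10_term m:] =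
      [:a13_term m n, a12_term m n, 0, a10_term m:]" for n
    by (simp add: a13_term_def a12_term_def)
  fix n :: nat
  define g where "g k = real (nat (int n - int k * ?C)) * real (nat (int n - int k * ?D))" for k :: nat
  have sym: "nat (int n - \<bar>k * fst m\<bar>) * nat (int n - \<bar>k * snd m\<bar>) =
      nat (int n - \<bar>k\<bar> * ?C) * nat (int n - \<bar>k\<bar> * ?D)" for k
    by (cases "\<bar>fst m\<bar> \<le> \<bar>snd m\<bar>") (simp_all add: c_hat_def d_hat_def abs_mult min_def max_def mult.commute)
  have "real (points {i, j} (sol {i, j} {(m, i, j)}) n) = (\<Sum>k\<in>{- int n..int n}. g (nat \<bar>k\<bar>))"
    unfolding points_pair_sum[OF m ij] sym by (simp add: g_def)
  also have "\<dots> = g 0 + 2 * (\<Sum>k\<in>{1..n}. g k)" by (rule sum_symmetric_interval)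
  also have "(\<Sum>k\<in>{1..n}. g k) = (\<Sum>k\<in>{1..n div nat ?D}. g k)"
  proof (rule sum.mono_neutral_right)
    show "{1..n div nat ?D} \<subseteq> {1..n}" using div_le_dividend[of n "nat ?D"] by auto
    show "\<forall>k\<in>{1..n} - {1..n div nat ?D}. g k = 0"
    proof
      fix k assume "k \<in> {1..n} - {1..n div nat ?D}"
      then have "n div nat ?D < k" by auto
      then have "n < k * nat ?D" using hb by (simp add: div_less_iff_less_mult)
      then have "int n < int k * ?D" using hb by (metis int_nat_eq of_nat_less_iff of_nat_mult order_trans zero_le_one)
      then show "g k = 0" by (simp add: g_def)
    qed
  qed simp
  also have "\<dots> = (\<Sum>k\<in>{1..n div nat ?D}. (real n - real k * of_int ?C) * (real n - real k * of_int ?D))"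
  proof (intro sum.cong refl)
    fix k assume k: "k \<in> {1..n div nat ?D}"
    have "k * nat ?D \<le> (n div nat ?D) * nat ?D" using k by (intro mult_right_mono) auto
    also have "\<dots> \<le> n" by simp
    finally have "int (k * nat ?D) \<le> int n" by (simp only: of_nat_le_iff)
    then have D: "int k * ?D \<le> int n" using hb by simp
    moreover have "int k * ?C \<le> int k * ?D" using hb by (intro mult_left_mono) auto
    ultimately have C: "int k * ?C \<le> int n" by linarith
    have "real (nat (int n - int k * b)) = real n - real k * of_int b" if "int k * b \<le> int n" for b
      using that by (subst of_nat_nat) simp_all
    then show "g k = (real n - real k * of_int ?C) * (real n - real k * of_int ?D)"
      using C D by (simp add: g_def)
  qed
  also have "g 0 = (real n)\<^sup>2" by (simp add: g_def power2_eq_square)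
  also note sum_line_pairs
  also have "(real n)\<^sup>2 + 2 * (real (n div nat ?D) * (real n)\<^sup>2
      - real n * (of_int ?C + of_int ?D) * real (n div nat ?D) * (real (n div nat ?D) + 1) / 2
      + of_int ?C * of_int ?D * real (n div nat ?D) * (real (n div nat ?D) + 1) * (2 * real (n div nat ?D) + 1) / 6)
    = poly [:a13_term m n, a12_term m n, 0, a10_term m:] (real n)"
  proof -
    have "int n = ?D * int (n div nat ?D) + n_bar m n"
      using hb by (simp add: n_bar_def zdiv_int)
    then have n: "real n = of_int ?D * real (n div nat ?D) + of_int (n_bar m n)"
      by (metis of_int_add of_int_mult of_int_of_nat_eq)
    have "real_of_int ?D \<noteq> 0" using hb by simp
    from line_pairs_closed_form[OF this n, of "of_int ?C"]
    show ?thesis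
      by (simp add: a10_term_def a12_term_def a13_term_def power3_eq_cube algebra_simps)
  qed
  finally show "real (points {i, j} (sol {i, j} {(m, i, j)}) n) =
      poly [:a13_term m n, a12_term m n, 0, a10_term m:] (real n)" .
qed

lemma nonparallel: "m \<in> M \<Longrightarrow> m' \<in> M \<Longrightarrow> m \<noteq> m' \<Longrightarrow> fst m * snd m' \<noteq> snd m * fst m'"
  using rider unfolding rider_moves_def by (cases m; cases m') fastforce

lemma points_coincident:
  assumes "T \<subseteq> M" "m \<in> T" "m' \<in> T" "m \<noteq> m'" "i \<noteq> j"
  shows "points {i, j} (sol {i, j} ((\<lambda>m. (m, i, j)) ` T)) n = n\<^sup>2"
proof -
  let ?S = "(\<lambda>m. (m, i, j)) ` T" and ?R = "real_of_int ` {1..int n}"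
  have eq: "z i = z j" if "z \<in> sol {i, j} ?S" for z
  proof -
    have "on_hyperplane m i j z" "on_hyperplane m' i j z" using that assms(2,3) by (auto simp: sol_def)
    then have h: "of_int (snd m) * (fst (z j) - fst (z i)) = of_int (fst m) * (snd (z j) - snd (z i))"
      "of_int (snd m') * (fst (z j) - fst (z i)) = of_int (fst m') * (snd (z j) - snd (z i))"
      by (simp_all add: on_hyperplane_def)
    define a where "a = real_of_int (fst m * snd m' - snd m * fst m')"
    have a: "a \<noteq> 0" unfolding a_def using nonparallel[of m m'] assms by (simp only: of_int_eq_0_iff) auto
    have "a * (fst (z j) - fst (z i)) = of_int (fst m) * (of_int (snd m') * (fst (z j) - fst (z i)))
        - of_int (fst m') * (of_int (snd m) * (fst (z j) - fst (z i)))"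
      by (simp add: a_def algebra_simps)
    also have "\<dots> = 0" unfolding h by (simp add: algebra_simps)
    finally have "fst (z j) - fst (z i) = 0" using a by simp
    moreover have "a * (snd (z j) - snd (z i)) = of_int (snd m') * (of_int (fst m) * (snd (z j) - snd (z i)))
        - of_int (snd m) * (of_int (fst m') * (snd (z j) - snd (z i)))"
      by (simp add: a_def algebra_simps)
    then have "a * (snd (z j) - snd (z i)) = 0" unfolding h[symmetric] by (simp add: algebra_simps)
    then have "snd (z j) - snd (z i) = 0" using a by simp
    ultimately show ?thesis by (simp add: prod_eq_iff)
  qed
  have "bij_betw (\<lambda>z. z i) (sol {i, j} ?S \<inter> grid {i, j} n) (?R \<times> ?R)"
  proof (rule bij_betw_byWitness[where f' = "diagonal {i, j}"])
    show "\<forall>z\<in>sol {i, j} ?S \<inter> grid {i, j} n. diagonal {i, j} (z i) = z"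
    proof
      fix z assume z: "z \<in> sol {i, j} ?S \<inter> grid {i, j} n"
      have "z l = 0" if "l \<notin> {i, j}" for l using z that by (auto simp: grid_def config_space_def)
      moreover have "z i = z j" using z eq by blast
      ultimately show "diagonal {i, j} (z i) = z" by (auto simp: diagonal_def fun_eq_iff)
    qed
    show "(\<lambda>z. z i) ` (sol {i, j} ?S \<inter> grid {i, j} n) \<subseteq> ?R \<times> ?R"
    proof (rule image_subsetI)
      fix z assume "z \<in> sol {i, j} ?S \<inter> grid {i, j} n"
      then have "coord (i, True) z \<in> ?R" "coord (i, False) z \<in> ?R"
        using grid_coord[of z "{i, j}" n] by auto
      then show "z i \<in> ?R \<times> ?R" by (simp add: coord_def mem_Times_iff)
    qed
    show "diagonal {i, j} ` (?R \<times> ?R) \<subseteq> sol {i, j} ?S \<inter> grid {i, j} n"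
    proof (rule image_subsetI)
      fix p assume p: "p \<in> ?R \<times> ?R"
      have "diagonal {i, j} p \<in> sol {i, j} ?S"
        by (auto simp: sol_def config_space_def diagonal_def on_hyperplane_def)
      moreover have "coord (l, b) (diagonal {i, j} p) \<in> ?R" if "l \<in> {i, j}" for l b
        using that p by (auto simp: coord_def diagonal_def mem_Times_iff)
      ultimately show "diagonal {i, j} p \<in> sol {i, j} ?S \<inter> grid {i, j} n"
        by (simp add: grid_def sol_def)
    qed
  qed (simp add: diagonal_def)
  from bij_betw_same_card[OF this] show ?thesis
    by (simp add: points_def card_cartesian_product finite_coords power2_eq_square)
qed

text \<open>A single equation leaves two pieces on a line, and any two of them force the pieces to coincide. The latter
  case has sign sum \<open>|M| - 1\<close>, since the signs of all subsets of \<open>M\<close> cancel.\<close>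

lemma spanning_sum_2:
  "spanning_sum 2 i n = (if i = 2 then 1 else 0) * (real (card M) - 1)
     - (\<Sum>m\<in>M. if i \<le> 4 then coeff [:a13_term m n, a12_term m n, 0, a10_term m:] (4 - i) else 0)"
proof -
  let ?f = "\<lambda>T. (\<lambda>m. (m, 1 :: nat, 2 :: nat)) ` T"
  define G where "G T = qp_coeff (\<lambda>n. real (points {1, 2} (sol {1, 2} (?f T)) n)) 4 i n" for T
  define w :: real where "w = (if i = 2 then 1 else 0)"
  have I: "{1..2::nat} = {1, 2}" by auto
  have E: "eqs M {1, 2} = ?f M" by (auto simp: eqs_def)
  have sets: "{S \<in> Pow (eqs M {1, 2}). supp S = {1, 2}} = ?f ` (Pow M - {{}})"
  proof (intro equalityI subsetI)
    fix S assume "S \<in> {S \<in> Pow (eqs M {1, 2}). supp S = {1, 2}}"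
    then have S: "S \<subseteq> ?f M" "S \<noteq> {}" using E by auto
    then obtain T where "T \<subseteq> M" "S = ?f T" by (auto simp: subset_image_iff)
    then show "S \<in> ?f ` (Pow M - {{}})" using S(2) by auto
  next
    fix S assume "S \<in> ?f ` (Pow M - {{}})"
    then obtain T where "T \<subseteq> M" "T \<noteq> {}" "S = ?f T" by auto
    then show "S \<in> {S \<in> Pow (eqs M {1, 2}). supp S = {1, 2}}" using E by (auto simp: supp_def)
  qed
  have inj: "inj_on ?f (Pow M - {{}})" by (rule inj_onI) (auto simp: inj_image_eq_iff inj_def)
  have card: "card (?f T) = card T" for T by (rule card_image) (auto simp: inj_on_def)
  have "spanning_sum 2 i n = (\<Sum>T\<in>Pow M - {{}}. (-1) ^ card T * G T)"
    unfolding spanning_sum_def I sets by (subst sum.reindex[OF inj]) (simp only: o_def card G_def, simp)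
  also have "\<dots> = (\<Sum>T\<in>Pow M - {{}}. (-1) ^ card T * w - (if card T = 1 then G T - w else 0))"
  proof (intro sum.cong refl)
    fix T assume T: "T \<in> Pow M - {{}}"
    show "(-1) ^ card T * G T = (-1) ^ card T * w - (if card T = 1 then G T - w else 0)"
    proof (cases "card T = 1")
      case False
      have "finite T" using T finite_subset[OF _ finite_M] by auto
      then have "card T \<noteq> 0" using T by auto
      then have "2 \<le> card T" using False by linarith
      then obtain m m' where "m \<in> T" "m' \<in> T" "m \<noteq> m'" by (auto simp: card_le_Suc_iff numeral_2_eq_2)
      then have "real (points {1, 2} (sol {1, 2} (?f T)) n) = poly (monom 1 2) (real n)" for n
        using points_coincident[of T m m' 1 2 n] T by (simp add: poly_monom)
      then have "has_constituents (\<lambda>n. real (points {1, 2} (sol {1, 2} (?f T)) n)) (\<lambda>_. monom 1 2)"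
        using has_constituents_poly[of "monom 1 2"] by simp
      then have "G T = w"
        unfolding G_def qp_coeff_def w_def by (auto simp: constituents_eq coeff_monom)
      then show ?thesis using False by simp
    qed simp
  qed
  also have "\<dots> = w * (\<Sum>T\<in>Pow M - {{}}. (-1) ^ card T) - (\<Sum>T\<in>Pow M - {{}}. if card T = 1 then G T - w else 0)"
    by (simp add: sum_subtractf sum_distrib_left mult.commute)
  also have "(\<Sum>T\<in>Pow M - {{}}. (-1 :: real) ^ card T) = -1"
  proof -
    have "M \<noteq> {}" using rider by (auto simp: rider_moves_def)
    then have "(\<Sum>T\<in>Pow M. (-1 :: int) ^ card T) = 0" using sum_minus_one_power_card_Pow[OF finite_M] by simp
    then have "real_of_int (\<Sum>T\<in>Pow M. (-1) ^ card T) = 0" by simp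
    then have "(\<Sum>T\<in>Pow M. (-1 :: real) ^ card T) = 0" by simp
    then show ?thesis using finite_M by (simp add: sum_diff1)
  qed
  also have "(\<Sum>T\<in>Pow M - {{}}. if card T = 1 then G T - w else 0) = (\<Sum>m\<in>M. G {m} - w)"
  proof -
    have "(\<Sum>T\<in>Pow M - {{}}. if card T = 1 then G T - w else 0) = (\<Sum>T\<in>(\<lambda>m. {m}) ` M. G T - w)"
      by (rule sum.mono_neutral_cong_right) (use finite_M in \<open>auto simp: card_1_singleton_iff\<close>)
    also have "\<dots> = (\<Sum>m\<in>M. G {m} - w)" by (subst sum.reindex) auto
    finally show ?thesis .
  qed
  also have "(\<Sum>m\<in>M. G {m} - w) = (\<Sum>m\<in>M. if i \<le> 4 then coeff [:a13_term m n, a12_term m n, 0, a10_term m:] (4 - i) else 0)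
      - w * real (card M)"
  proof -
    have "G {m} = (if i \<le> 4 then coeff [:a13_term m n, a12_term m n, 0, a10_term m:] (4 - i) else 0)"
      if "m \<in> M" for m
      unfolding G_def qp_coeff_def using constituents_eq[OF has_constituents_pair[OF that, of 1 2]] by simp
    then show ?thesis by (simp add: sum_subtractf)
  qed
  finally show ?thesis by (simp add: w_def algebra_simps)
qed

lemma theta_bar_2:
  assumes "i \<ge> 1" "2 \<le> q"
  shows "theta_bar M q i 2 n =
    (if i = 1 then - a10 M / 2
     else if i = 2 then (real (card M) - 1) / 2
     else if i = 3 then - a12 M n / 2
     else if i = 4 then - a13 M n / 2
     else 0)"
proof -
  have sums: "(\<Sum>m\<in>M. a10_term m) = a10 M" "(\<Sum>m\<in>M. a12_term m n) = a12 M n" "(\<Sum>m\<in>M. a13_term m n) = a13 M n"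
    by (simp_all only: a10_term_def a10_def a12_term_def a12_def a13_term_def a13_def sum_negf)
  have "2 * theta_bar M q i 2 n = spanning_sum 2 i n"
    using theta_bar_spanning[OF order_refl assms(2)] by (simp add: fact_numeral)
  moreover have "i = 1 \<or> i = 2 \<or> i = 3 \<or> i = 4 \<or> i > 4" using assms(1) by linarith
  ultimately show ?thesis unfolding spanning_sum_2
    by (elim disjE) (simp_all add: sums numeral_eq_Suc)
qed

section \<open>Perfect matchings\<close>

definition matching :: "equation set \<Rightarrow> bool" where
  "matching S \<longleftrightarrow> (\<forall>e\<in>S. \<forall>e'\<in>S. e \<noteq> e' \<longrightarrow> supp {e} \<inter> supp {e'} = {})"

lemma coeff_mult_top:
  fixes p r :: "real poly"
  assumes "degree p \<le> a" "degree r \<le> b"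
  shows "coeff (p * r) (a + b) = coeff p a * coeff r b"
proof -
  have "coeff (p * r) (a + b) = (\<Sum>i\<le>a + b. coeff p i * coeff r (a + b - i))" by (rule coeff_mult)
  also have "\<dots> = (\<Sum>i\<in>{a}. coeff p i * coeff r (a + b - i))"
  proof (rule sum.mono_neutral_right)
    show "\<forall>i\<in>{..a + b} - {a}. coeff p i * coeff r (a + b - i) = 0"
    proof
      fix i assume "i \<in> {..a + b} - {a}"
      then consider "a < i" | "b < a + b - i" by fastforce
      then show "coeff p i * coeff r (a + b - i) = 0"
        using assms by cases (simp_all add: coeff_eq_0)
    qed
  qed auto
  finally show ?thesis by simp
qed

lemma matching_insert:
  assumes "matching (insert e S)" "e \<notin> S"
  shows "matching S" "supp {e} \<inter> supp S = {}"
proof -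
  show "matching S" using assms(1) by (auto simp: matching_def)
  have "supp S = (\<Union>e'\<in>S. supp {e'})" by (auto simp: supp_def)
  then show "supp {e} \<inter> supp S = {}" using assms by (auto simp: matching_def)
qed

text \<open>The pairs of a matching move independently, so constituents and leading coefficients multiply.\<close>

lemma matching_leading_coeff:
  assumes "finite S" "S \<subseteq> eqs M I" "matching S"
  shows "card (supp S) = 2 * card S"
    and "degree (constituents (\<lambda>n. real (points (supp S) (sol (supp S) S) n)) n) \<le> 3 * card S"
    and "coeff (constituents (\<lambda>n. real (points (supp S) (sol (supp S) S) n)) n) (3 * card S) = (\<Prod>e\<in>S. a10_term (fst e))"
proof -
  let ?p = "\<lambda>S. constituents (\<lambda>n. real (points (supp S) (sol (supp S) S) n)) n"
  have "card (supp S) = 2 * card S \<and> degree (?p S) \<le> 3 * card S \<and> coeff (?p S) (3 * card S) = (\<Prod>e\<in>S. a10_term (fst e))"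
    using assms
  proof induction
    case empty
    have "real (points {} (sol {} {}) n) = poly 1 (real n)" for n
      using points_config_space[of "{}" n] by (simp add: sol_empty)
    then have "constituents (\<lambda>n. real (points {} (sol {} {}) n)) = (\<lambda>_. 1)"
      using has_constituents_poly[of 1] by (intro constituents_eq) simp
    then show ?case by simp
  next
    case (insert e S)
    obtain m i j where e: "e = (m, i, j)" by (cases e)
    have mij: "m \<in> M" "i < j" using insert.prems(1) by (auto simp: e eqs_def)
    have se: "supp {e} = {i, j}" by (simp add: supp_def e)
    note ms = matching_insert[OF insert.prems(2) insert.hyps(2)]
    have IH: "card (supp S) = 2 * card S" "degree (?p S) \<le> 3 * card S"
      "coeff (?p S) (3 * card S) = (\<Prod>e\<in>S. a10_term (fst e))"
      using insert.IH[OF _ ms(1)] insert.prems(1) by auto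
    have supp: "supp (insert e S) = {i, j} \<union> supp S" by (simp add: e supp_insert)
    have fin: "finite (supp S)" using insert.hyps(1) by (rule finite_supp)
    have "real (points (supp (insert e S)) (sol (supp (insert e S)) (insert e S)) n) =
        real (points {i, j} (sol {i, j} {(m, i, j)}) n) * real (points (supp S) (sol (supp S) S) n)" for n
    proof -
      have "points ({i, j} \<union> supp S) (sol ({i, j} \<union> supp S) ({e} \<union> S)) n
          = points {i, j} (sol {i, j} {e}) n * points (supp S) (sol (supp S) S) n"
        by (rule points_product) (use ms(2) se fin in auto)
      then show ?thesis unfolding supp by (simp add: e)
    qed
    moreover have "quasipoly (\<lambda>n. real (points (supp S) (sol (supp S) S) n))"
      using insert.hyps(1) fin by (intro quasipoly_points) auto
    ultimately have p: "?p (insert e S) = [:a13_term m n, a12_term m n, 0, a10_term m:] * ?p S"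
      using constituents_eq[OF has_constituents_mult[OF has_constituents_pair[OF mij(1), of i j]
            has_constituents_constituents]] mij(2) by simp
    have d: "degree [:a13_term m n, a12_term m n, 0, a10_term m:] \<le> 3"
      by (simp add: degree_pCons_eq_if)
    have "card (supp (insert e S)) = 2 * card (insert e S)"
      unfolding supp using ms(2) se fin IH(1) mij(2) insert.hyps by (subst card_Un_disjoint) auto
    moreover have "degree (?p (insert e S)) \<le> 3 * card (insert e S)"
      unfolding p using degree_mult_le[of "[:a13_term m n, a12_term m n, 0, a10_term m:]" "?p S"] d IH(2) insert.hyps
      by simp
    moreover have "coeff (?p (insert e S)) (3 + 3 * card S) = a10_term m * (\<Prod>e\<in>S. a10_term (fst e))"
      unfolding p coeff_mult_top[OF d IH(2)] IH(3) by (simp add: numeral_3_eq_3)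
    ultimately show ?case using insert.hyps by (simp add: e)
  qed
  then show "card (supp S) = 2 * card S" "degree (?p S) \<le> 3 * card S"
    "coeff (?p S) (3 * card S) = (\<Prod>e\<in>S. a10_term (fst e))" by auto
qed

text \<open>Two different equations with a common piece lower the dimension by two but involve at most three pieces.
  This excess of twice the codimension over the number of pieces persists when further equations are added.\<close>

lemma dim_not_matching:
  assumes "finite I" "S \<subseteq> eqs M I" "\<not> matching S"
  shows "2 * config.dim (sol I S) + card (supp S) < 4 * card I"
proof -
  obtain e e' where ee: "e \<in> S" "e' \<in> S" "e \<noteq> e'" "supp {e} \<inter> supp {e'} \<noteq> {}"
    using assms(3) unfolding matching_def by blast
  obtain m i j where e: "e = (m, i, j)" by (cases e)
  obtain m' i' j' where e': "e' = (m', i', j')" by (cases e')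
  have mem: "m \<in> M" "i \<in> I" "j \<in> I" "i < j" "m' \<in> M" "i' \<in> I" "j' \<in> I" "i' < j'"
    using ee assms(2) by (auto simp: e e' eqs_def)
  have nz: "m \<noteq> (0, 0)" "m' \<noteq> (0, 0)" using mem nonzero_M by auto
  have s: "supp {e} = {i, j}" "supp {e'} = {i', j'}" by (simp_all add: supp_def e e')
  obtain z where "z \<in> sol I {}" "\<not> on_hyperplane m i j z"
    using free_piece[of m i j i "{}" I] nz mem by auto
  from dim_sol_insert[OF assms(1) this]
  have d1: "2 * card I = Suc (config.dim (sol I {e}))"
    by (simp add: sol_empty dim_config_space(1)[OF assms(1)] e)
  have "\<exists>z. z \<in> sol I {e} \<and> \<not> on_hyperplane m' i' j' z"
  proof (cases "{i', j'} \<subseteq> {i, j}")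
    case False
    then obtain v where "v \<in> {i', j'}" "v \<notin> supp {e}" using s by auto
    then show ?thesis using free_piece[of m' i' j' v "{e}" I] nz mem by (metis insert_iff less_irrefl singletonD)
  next
    case True
    then have ij: "i' = i" "j' = j" using mem by auto
    then have "m \<noteq> m'" using ee(3) by (simp add: e e')
    define z :: config where "z = (\<lambda>k. if k = j then (of_int (fst m), of_int (snd m)) else 0)"
    have "z \<in> sol I {e}" using mem by (auto simp: sol_def e config_space_def z_def on_hyperplane_def)
    moreover have "\<not> on_hyperplane m' i' j' z"
    proof
      assume "on_hyperplane m' i' j' z"
      then have "real_of_int (snd m' * fst m) = real_of_int (fst m' * snd m)"
        using mem by (simp add: on_hyperplane_def z_def ij)
      then have "snd m' * fst m = fst m' * snd m" by (simp only: of_int_eq_iff)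
      then show False using nonparallel[OF mem(1,5) \<open>m \<noteq> m'\<close>] by (simp add: mult.commute)
    qed
    ultimately show ?thesis by blast
  qed
  then obtain z where "z \<in> sol I {e}" "\<not> on_hyperplane m' i' j' z" by blast
  from dim_sol_insert[OF assms(1) this]
  have d2: "config.dim (sol I {e}) = Suc (config.dim (sol I {e', e}))" by (simp add: e')
  have "card (supp {e', e}) \<le> 3"
  proof -
    have u: "supp {e', e} = {i', j'} \<union> {i, j}" using s by (auto simp: supp_def)
    have "card {i', j'} + card {i, j} = card ({i', j'} \<union> {i, j}) + card ({i', j'} \<inter> {i, j})"
      by (rule card_Un_Int) auto
    moreover have "card ({i', j'} \<inter> {i, j}) \<noteq> 0" using ee(4) s by (auto simp: card_eq_0_iff)
    moreover have "card {i', j'} = 2" "card {i, j} = 2" using mem by auto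
    ultimately show ?thesis unfolding u by linarith
  qed
  moreover have "2 * config.dim (sol I S) + card (supp S) \<le> 2 * config.dim (sol I {e', e}) + card (supp {e', e})"
    using excess_mono[OF assms(1) nonzero_M _ assms(2), of "{e', e}"] ee
      finite_subset[OF assms(2) finite_eqs_M[OF assms(1)]] by simp
  ultimately show ?thesis using d1 d2 by linarith
qed

definition perfect_matchings :: "nat set \<Rightarrow> equation set set" where
  "perfect_matchings V = {S \<in> Pow (eqs M V). supp S = V \<and> matching S}"

lemma supp_Diff_matching:
  assumes "matching S" "e \<in> S"
  shows "supp (S - {e}) = supp S - supp {e}"
proof -
  have UN: "supp T = (\<Union>e'\<in>T. supp {e'})" for T by (auto simp: supp_def)
  have "supp {e'} \<inter> supp {e} = {}" if "e' \<in> S - {e}" for e'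
    using assms that unfolding matching_def by blast
  then show ?thesis unfolding UN[of S] UN[of "S - {e}"] using assms(2) by blast
qed

lemma sum_matchings_with_edge:
  assumes e: "e = (m, v, u)" "m \<in> M" "v < u" "v \<in> V" "u \<in> V"
    and fin: "finite V"
  shows "(\<Sum>S\<in>{S \<in> perfect_matchings V. e \<in> S}. \<Prod>e\<in>S. w (fst e)) =
    w m * (\<Sum>S\<in>perfect_matchings (V - {v, u}). \<Prod>e\<in>S. w (fst e) :: real)"
proof -
  have se: "supp {e} = {v, u}" by (simp add: supp_def e)
  have notin: "e \<notin> S" if "S \<in> perfect_matchings (V - {v, u})" for S
  proof
    assume "e \<in> S"
    then have "v \<in> supp S" by (auto simp: supp_def e)
    then show False using that by (auto simp: perfect_matchings_def)
  qed
  have finS: "finite S" if "S \<in> perfect_matchings W" "finite W" for S W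
    using that finite_subset[OF _ finite_eqs_M[of W]] by (auto simp: perfect_matchings_def)
  have "(\<Sum>S\<in>{S \<in> perfect_matchings V. e \<in> S}. \<Prod>e\<in>S. w (fst e)) =
    (\<Sum>S\<in>perfect_matchings (V - {v, u}). w m * (\<Prod>e\<in>S. w (fst e)))"
  proof (rule sum.reindex_bij_witness[of _ "insert e" "\<lambda>S. S - {e}"])
    fix S assume S: "S \<in> {S \<in> perfect_matchings V. e \<in> S}"
    then have S': "S \<subseteq> eqs M V" "supp S = V" "matching S" "e \<in> S" by (auto simp: perfect_matchings_def)
    show "insert e (S - {e}) = S" using S'(4) by auto
    have sd: "supp (S - {e}) = V - {v, u}" using supp_Diff_matching[OF S'(3,4)] S'(2) se by simp
    have "S - {e} \<subseteq> eqs M (supp (S - {e}))" by (rule eqs_supp[of _ _ V]) (use S'(1) in auto)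
    then show "S - {e} \<in> perfect_matchings (V - {v, u})"
      using sd S'(3) by (auto simp: perfect_matchings_def matching_def)
    have "finite S" using finS[of S V] S fin by auto
    then show "w m * (\<Prod>e\<in>S - {e}. w (fst e)) = (\<Prod>e\<in>S. w (fst e))"
      using prod.remove[OF _ S'(4), of "\<lambda>e. w (fst e)"] by (simp add: e)
  next
    fix S assume S: "S \<in> perfect_matchings (V - {v, u})"
    then have S': "S \<subseteq> eqs M (V - {v, u})" "supp S = V - {v, u}" "matching S" by (auto simp: perfect_matchings_def)
    show "insert e S - {e} = S" using notin[OF S] by auto
    have "insert e S \<subseteq> eqs M V" using S'(1) eqs_mono[of "V - {v, u}" V M] e by (auto simp: eqs_def)
    moreover have "supp (insert e S) = V" using S'(2) e by (auto simp: supp_insert)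
    moreover have "matching (insert e S)"
    proof -
      have "supp {e'} \<inter> supp {e} = {}" if "e' \<in> S" for e'
      proof -
        have "supp {e'} \<subseteq> supp S" using that by (auto simp: supp_def)
        then show ?thesis using S'(2) se by auto
      qed
      then show ?thesis using S'(3) unfolding matching_def by blast
    qed
    ultimately show "insert e S \<in> {S \<in> perfect_matchings V. e \<in> S}" by (simp add: perfect_matchings_def)
  qed
  then show ?thesis by (simp add: sum_distrib_left)
qed

text \<open>The smallest piece is matched with one of the other \<open>2 i - 1\<close> pieces by one of the moves, which gives the factor
  \<open>2 i - 1\<close> in the number \<open>(2 i)! / (2\<^sup>i i!)\<close> of perfect matchings and one factor \<open>\<Sum>w\<close>.\<close>

lemma sum_perfect_matchings:
  assumes "finite V" "card V = 2 * i"
  shows "(\<Sum>S\<in>perfect_matchings V. \<Prod>e\<in>S. w (fst e)) * (2 ^ i * fact i) = fact (2 * i) * (\<Sum>m\<in>M. w m :: real) ^ i"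
  using assms
proof (induction i arbitrary: V)
  case 0
  then have "perfect_matchings V = {{}}" by (auto simp: perfect_matchings_def eqs_def matching_def)
  then show ?case by simp
next
  case (Suc i)
  let ?F = "\<lambda>S. \<Prod>e\<in>S. w (fst e)" and ?A = "\<Sum>m\<in>M. w m"
  define v where "v = Min V"
  let ?W = "V - {v}"
  have "V \<noteq> {}" using Suc.prems by auto
  then have v: "v \<in> V" "\<And>u. u \<in> V \<Longrightarrow> v \<le> u" using Suc.prems by (auto simp: v_def)
  have finPM: "finite (perfect_matchings V)"
    using finite_eqs_M[OF Suc.prems(1)] by (auto simp: perfect_matchings_def)
  define g where "g S = (SOME p. (fst p, v, snd p) \<in> S)" for S :: "equation set"
  have ex: "\<exists>p\<in>M \<times> ?W. (fst p, v, snd p) \<in> S" if "S \<in> perfect_matchings V" for S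
  proof -
    have S: "S \<subseteq> eqs M V" "supp S = V" using that by (auto simp: perfect_matchings_def)
    then obtain m a b where mab: "(m, a, b) \<in> S" "v \<in> {a, b}" using v(1) by (auto simp: supp_def)
    then have "m \<in> M" "a \<in> V" "b \<in> V" "a < b" using S(1) by (auto simp: eqs_def)
    then have "a = v" using mab(2) v(2)[of a] by auto
    then show ?thesis using mab(1) \<open>m \<in> M\<close> \<open>b \<in> V\<close> \<open>a < b\<close> by (intro bexI[of _ "(m, b)"]) auto
  qed
  have unique: "p = p'" if "S \<in> perfect_matchings V" "(fst p, v, snd p) \<in> S" "(fst p', v, snd p') \<in> S" for S p p'
  proof (rule ccontr)
    assume "p \<noteq> p'"
    then have neq: "(fst p, v, snd p) \<noteq> (fst p', v, snd p')" by (auto simp: prod_eq_iff)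
    have "matching S" using that(1) by (simp add: perfect_matchings_def)
    from this[unfolded matching_def, rule_format, OF that(2,3) neq]
    have "supp {(fst p, v, snd p)} \<inter> supp {(fst p', v, snd p')} = {}" .
    then show False by (auto simp: supp_def)
  qed
  have g: "(fst (g S), v, snd (g S)) \<in> S" if "S \<in> perfect_matchings V" for S
    unfolding g_def by (rule someI_ex) (use ex[OF that] in blast)
  have cardW: "card ?W = 2 * i + 1" using Suc.prems v(1) by simp
  have const: "(\<Sum>m\<in>M. \<Sum>u\<in>?W. w m * c) = real (2 * i + 1) * ?A * c" for c
    by (simp only: sum_constant cardW sum_distrib_left sum_distrib_right mult_ac)
  have "(\<Sum>S\<in>perfect_matchings V. ?F S) = (\<Sum>p\<in>M \<times> ?W. \<Sum>S\<in>{S \<in> perfect_matchings V. g S = p}. ?F S)"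
  proof (rule sum.group[symmetric])
    show "g ` perfect_matchings V \<subseteq> M \<times> ?W"
    proof (rule image_subsetI)
      fix S assume S: "S \<in> perfect_matchings V"
      obtain p where "p \<in> M \<times> ?W" "(fst p, v, snd p) \<in> S" using ex[OF S] by blast
      then show "g S \<in> M \<times> ?W" using unique[OF S g[OF S]] by metis
    qed
  qed (use finPM finite_M Suc.prems in auto)
  also have "\<dots> = (\<Sum>p\<in>M \<times> ?W. w (fst p) * (fact (2 * i) * ?A ^ i / (2 ^ i * fact i)))"
  proof (intro sum.cong refl)
    fix p assume p: "p \<in> M \<times> ?W"
    have set: "{S \<in> perfect_matchings V. g S = p} = {S \<in> perfect_matchings V. (fst p, v, snd p) \<in> S}"
    proof (intro Collect_cong conj_cong refl)
      fix S assume S: "S \<in> perfect_matchings V"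
      show "g S = p \<longleftrightarrow> (fst p, v, snd p) \<in> S" using g[OF S] unique[OF S g[OF S]] by metis
    qed
    have u: "snd p \<in> V" "v < snd p" "fst p \<in> M" using p v(2)[of "snd p"] by auto
    have card: "card (V - {v, snd p}) = 2 * i"
      using Suc.prems v(1) u by (simp add: card_Diff_subset)
    have "(\<Sum>S\<in>perfect_matchings (V - {v, snd p}). ?F S) * (2 ^ i * fact i) = fact (2 * i) * ?A ^ i"
      by (rule Suc.IH[OF _ card]) (use Suc.prems in simp)
    then have "(\<Sum>S\<in>perfect_matchings (V - {v, snd p}). ?F S) = fact (2 * i) * ?A ^ i / (2 ^ i * fact i)"
      by (simp add: field_simps)
    then show "(\<Sum>S\<in>{S \<in> perfect_matchings V. g S = p}. ?F S) = w (fst p) * (fact (2 * i) * ?A ^ i / (2 ^ i * fact i))"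
      unfolding set using sum_matchings_with_edge[OF refl u(3,2) v(1) u(1) Suc.prems(1), of w] by simp
  qed
  also have "\<dots> = (\<Sum>m\<in>M. \<Sum>u\<in>?W. w m * (fact (2 * i) * ?A ^ i / (2 ^ i * fact i)))"
    by (simp only: sum.cartesian_product case_prod_unfold)
  also have "\<dots> = real (2 * i + 1) * ?A * (fact (2 * i) * ?A ^ i / (2 ^ i * fact i))"
    by (rule const)
  finally have "(\<Sum>S\<in>perfect_matchings V. ?F S) * (2 ^ Suc i * fact (Suc i)) =
      real (2 * i + 1) * ?A * (fact (2 * i) * ?A ^ i / (2 ^ i * fact i)) * (2 * (2 ^ i) * (real (Suc i) * fact i))"
    by simp
  also have "\<dots> = real (2 * i + 2) * (real (2 * i + 1) * fact (2 * i)) * ?A ^ Suc i"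
    by (simp add: field_simps)
  also have "real (2 * i + 2) * (real (2 * i + 1) * fact (2 * i)) = fact (2 * Suc i)" by simp
  finally show ?case .
qed

text \<open>Among the systems of equations that involve \<open>2 i\<close> pieces, only perfect matchings have codimension \<open>i\<close>; all others
  have larger codimension and too small a degree.\<close>

lemma theta_bar_top:
  assumes "i \<ge> 1" "2 * i \<le> q"
  shows "theta_bar M q i (2 * i) n = (- a10 M / 2) ^ i / fact i"
proof -
  let ?V = "{1..2 * i}"
  let ?w = "\<lambda>m. - a10_term m"
  have A: "(\<Sum>m\<in>M. ?w m) = - a10 M" by (simp add: sum_negf a10_term_def a10_def)
  have finE: "finite (eqs M ?V)" using finite_eqs_M by simp
  have "fact (2 * i) * theta_bar M q i (2 * i) n = spanning_sum (2 * i) i n"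
    by (rule theta_bar_spanning) (use assms in auto)
  also have "\<dots> = (\<Sum>S\<in>perfect_matchings ?V. \<Prod>e\<in>S. ?w (fst e))"
    unfolding spanning_sum_def
  proof (rule sum.mono_neutral_cong_right)
    show "\<forall>S\<in>{S \<in> Pow (eqs M ?V). supp S = ?V} - perfect_matchings ?V.
        (-1) ^ card S * qp_coeff (\<lambda>n. real (points ?V (sol ?V S) n)) (2 * (2 * i)) i n = 0"
    proof
      fix S assume "S \<in> {S \<in> Pow (eqs M ?V). supp S = ?V} - perfect_matchings ?V"
      then have S: "S \<subseteq> eqs M ?V" "supp S = ?V" "\<not> matching S" by (auto simp: perfect_matchings_def)
      have U: "sol ?V S \<in> int_lattice M (2 * i)" using S(1) by (auto simp: int_lattice_sol)
      have "2 * config.dim (sol ?V S) + 2 * i < 8 * i"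
        using dim_not_matching[OF _ S(1,3)] S(2) by simp
      then have "i < codim (2 * i) (sol ?V S)" using dim_codim[OF U] by linarith
      from qp_coeff_N_eq_0[OF U this, of n]
      show "(-1) ^ card S * qp_coeff (\<lambda>n. real (points ?V (sol ?V S) n)) (2 * (2 * i)) i n = 0" by simp
    qed
    fix S assume "S \<in> perfect_matchings ?V"
    then have S: "S \<subseteq> eqs M ?V" "supp S = ?V" "matching S" "finite S"
      using finite_subset[OF _ finE] by (auto simp: perfect_matchings_def)
    note top = matching_leading_coeff[OF S(4,1,3)]
    have c: "card S = i" using top(1) S(2) by simp
    have "2 * (2 * i) - i = 3 * card S" using c by simp
    then have "qp_coeff (\<lambda>n. real (points ?V (sol ?V S) n)) (2 * (2 * i)) i n = (\<Prod>e\<in>S. a10_term (fst e))"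
      using top(3)[of n] unfolding qp_coeff_def S(2) by simp
    then show "(-1) ^ card S * qp_coeff (\<lambda>n. real (points ?V (sol ?V S) n)) (2 * (2 * i)) i n = (\<Prod>e\<in>S. ?w (fst e))"
      by (simp add: prod_uminus)
  qed (use finE in \<open>auto simp: perfect_matchings_def\<close>)
  finally have 1: "fact (2 * i) * theta_bar M q i (2 * i) n = (\<Sum>S\<in>perfect_matchings ?V. \<Prod>e\<in>S. ?w (fst e))" .
  have 2: "(\<Sum>S\<in>perfect_matchings ?V. \<Prod>e\<in>S. ?w (fst e)) * (2 ^ i * fact i) = fact (2 * i) * (- a10 M) ^ i"
    by (rule sum_perfect_matchings[of ?V i ?w, unfolded A]) auto
  have "fact (2 * i) * (theta_bar M q i (2 * i) n * (2 ^ i * fact i)) = fact (2 * i) * (- a10 M) ^ i"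
    using 2[folded 1] by (simp only: mult.assoc)
  then have "theta_bar M q i (2 * i) n * (2 ^ i * fact i) = (- a10 M) ^ i" by simp
  then have "theta_bar M q i (2 * i) n = (- a10 M) ^ i / (2 ^ i * fact i)" by (simp add: eq_divide_eq)
  then show ?thesis by (simp only: power_divide divide_divide_eq_left)
qed

lemma a10_pos: "a10 M > 0"
proof -
  have "M \<noteq> {}" using rider by (auto simp: rider_moves_def)
  moreover have "0 < real_of_int (3 * d_hat m - c_hat m) / of_int (3 * (d_hat m)\<^sup>2)" if "m \<in> M" for m
  proof -
    have "0 < 3 * d_hat m - c_hat m" "0 < 3 * (d_hat m)\<^sup>2" using hat_bounds[OF that] by auto
    then show ?thesis by (intro divide_pos_pos) (simp_all only: of_int_0_less_iff)
  qed
  ultimately show ?thesis unfolding a10_def using finite_M by (intro sum_pos)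
qed

definition falling_poly :: "nat \<Rightarrow> real poly" where
  "falling_poly k = (\<Prod>j<k. [:- real j, 1:])"

lemma poly_falling_poly: "poly (falling_poly k) (real q) = falling q k"
  by (simp add: falling_poly_def falling_def poly_prod)

lemma falling_poly_degree: "degree (falling_poly k) = k" "coeff (falling_poly k) k = 1"
proof -
  show d: "degree (falling_poly k) = k"
    unfolding falling_poly_def by (subst degree_prod_eq_sum_degree) auto
  have "lead_coeff (falling_poly k) = 1" unfolding falling_poly_def by (subst lead_coeff_prod) simp
  then show "coeff (falling_poly k) k = 1" by (simp add: d)
qed

text \<open>The coefficients of the falling factorials do not depend on \<open>q\<close>, and the one of \<open>(q)\<^bsub>2i\<^esub>\<close> is not zero because
  \<open>a10\<close> is positive.\<close>

lemma gamma_polynomial_in_q: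
  "\<exists>P :: nat \<Rightarrow> real poly. (\<exists>T>0. \<forall>n. P (n + T) = P n) \<and>
    (\<forall>n. degree (P n) = 2 * i \<and> (\<forall>q. fact q * gamma M q i n = poly (P n) (real q)))"
proof (cases "i = 0")
  case True
  then show ?thesis using gamma_0 by (intro exI[of _ "\<lambda>_. 1"]) (auto intro: exI[of _ 1])
next
  case False
  define P where "P n = (\<Sum>k = 2..2 * i. smult (theta_bar M k i k n) (falling_poly k))" for n
  have "\<forall>k\<in>{2..2 * i}. \<exists>T>0. \<forall>n. theta_bar M k i k (n + T) = theta_bar M k i k n"
    using theta_bar_periodic by auto
  from common_period[OF _ this]
  obtain T where T: "T > 0" "\<And>k n. k \<in> {2..2 * i} \<Longrightarrow> theta_bar M k i k (n + T) = theta_bar M k i k n"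
    by auto
  have "P (n + T) = P n" for n unfolding P_def by (intro sum.cong refl) (simp only: T(2))
  moreover have "degree (P n) = 2 * i" for n
  proof (rule antisym)
    show "degree (P n) \<le> 2 * i"
      unfolding P_def
      by (intro degree_sum_le) (auto intro: order_trans[OF degree_smult_le] simp: falling_poly_degree)
    have "coeff (P n) (2 * i) = (\<Sum>k = 2..2 * i. if k = 2 * i then theta_bar M (2 * i) i (2 * i) n else 0)"
      unfolding P_def coeff_sum
      by (intro sum.cong refl) (auto simp: falling_poly_degree coeff_eq_0)
    also have "\<dots> = (- a10 M / 2) ^ i / fact i"
      using False theta_bar_top[of i "2 * i" n] by simp
    finally have "coeff (P n) (2 * i) \<noteq> 0" using a10_pos by simp
    then show "2 * i \<le> degree (P n)" by (rule le_degree)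
  qed
  moreover have "fact q * gamma M q i n = poly (P n) (real q)" for q n
  proof -
    have "falling q k * theta_bar M q i k n = theta_bar M k i k n * falling q k" for k
      using theta_bar_stable[of i k q n] falling_eq_0[of q k] False by (cases "k \<le> q") auto
    then have "(\<Sum>k = 2..2 * i. falling q k * theta_bar M q i k n)
        = (\<Sum>k = 2..2 * i. theta_bar M k i k n * falling q k)" by (intro sum.cong refl)
    then have "fact q * gamma M q i n = (\<Sum>k = 2..2 * i. theta_bar M k i k n * falling q k)"
      using gamma_theta_bar[of i q n] False by simp
    then show ?thesis by (simp add: P_def poly_sum poly_falling_poly)
  qed
  ultimately show ?thesis using T(1) by blast
qed

lemma gamma_1: "fact q * gamma M q 1 n = - falling q 2 * (a10 M / 2)"
proof -
  have "fact q * gamma M q 1 n = falling q 2 * theta_bar M q 1 2 n"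
    using gamma_theta_bar[of 1 q n] by (simp add: atLeastAtMost_singleton')
  also have "\<dots> = falling q 2 * (- a10 M / 2)"
    using theta_bar_2[of 1 q n] falling_eq_0[of q 2] by (cases "2 \<le> q") auto
  finally show ?thesis by simp
qed

text \<open>For \<open>i = 2\<close> the summands with two and four pieces are explicit constants, and the one with three pieces consists of
  leading coefficients.\<close>

lemma gamma_const:
  assumes "i \<le> 2"
  shows "gamma M q i n = gamma M q i n'"
proof -
  have "fact q * gamma M q i n = fact q * gamma M q i n'"
  proof -
    consider "i = 0" | "i = 1" | "i = 2" using assms by linarith
    then show ?thesis
    proof cases
      case 1
      then show ?thesis using gamma_0 by simp
    next
      case 2
      then show ?thesis using gamma_1 by simp
    next
      case 3
      have r: "{2..4 :: nat} = {2, 3, 4}" by auto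
      have e2: "falling q 2 * theta_bar M q 2 2 n = falling q 2 * theta_bar M q 2 2 n'"
        using theta_bar_2[of 2 q n] theta_bar_2[of 2 q n'] falling_eq_0[of q 2] by (cases "2 \<le> q") auto
      have e4: "falling q 4 * theta_bar M q 2 4 n = falling q 4 * theta_bar M q 2 4 n'"
        using theta_bar_top[of 2 q n] theta_bar_top[of 2 q n'] falling_eq_0[of q 4] by (cases "4 \<le> q") auto
      have expand: "fact q * gamma M q 2 k = falling q 2 * theta_bar M q 2 2 k
          + (falling q 3 * theta_bar M q 2 3 k + falling q 4 * theta_bar M q 2 4 k)" for k
        using gamma_theta_bar[of 2 q k] by (simp add: r)
      show ?thesis
        unfolding 3 expand using e2 e4 theta_bar_3_const[of q n n'] by (simp only:)
    qed
  qed
  then show ?thesis by simp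
qed

end

theorem theorem5p1:
  fixes M :: "(int \<times> int) set"
  assumes "rider_moves M"
  shows
    "(\<forall>q. has_constituents (u_count M q) (constituents (u_count M q)) \<and>
        (\<forall>n\<ge>1. u_count M q n = (\<Sum>i\<le>2 * q. gamma M q i n * real n ^ (2 * q - i))))
     \<and> (\<forall>q. \<forall>i\<le>2. \<forall>n n'. gamma M q i n = gamma M q i n')
     \<and> (\<forall>i. \<exists>P :: nat \<Rightarrow> real poly. (\<exists>T>0. \<forall>n. P (n + T) = P n) \<and>
          (\<forall>n. degree (P n) = 2 * i \<and> (\<forall>q. fact q * gamma M q i n = poly (P n) (real q))))
     \<and> (\<forall>q n. fact q * gamma M q 0 n = 1)
     \<and> (\<forall>q n. fact q * gamma M q 1 n = - falling q 2 * (a10 M / 2))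
     \<and> (\<forall>q n. \<forall>i\<ge>1. fact q * gamma M q i n = (\<Sum>\<kappa> = 2..2 * i. falling q \<kappa> * theta_bar M q i \<kappa> n))
     \<and> (\<forall>q n \<kappa>. \<forall>i\<ge>1. \<kappa> \<le> q \<longrightarrow> theta_bar M q i \<kappa> n = theta_bar M \<kappa> i \<kappa> n)
     \<and> (\<forall>q n. \<forall>i\<ge>1. 2 * i \<le> q \<longrightarrow> theta_bar M q i (2 * i) n = (- a10 M / 2) ^ i / fact i)
     \<and> (\<forall>q n. \<forall>i\<ge>1. 2 \<le> q \<longrightarrow> theta_bar M q i 2 n =
          (if i = 1 then - a10 M / 2
           else if i = 2 then (real (card M) - 1) / 2
           else if i = 3 then - a12 M n / 2
           else if i = 4 then - a13 M n / 2
           else 0))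
     \<and> (\<forall>q i. min_period (gamma M q i) dvd
          Lcm ((\<lambda>U. min_period (constituents (alpha M q U))) ` {U \<in> int_lattice M q. codim q U \<le> i}))"
proof -
  interpret rider_piece M using assms by unfold_locales
  show ?thesis
  proof (intro conjI allI impI)
    show "has_constituents (u_count M q) (constituents (u_count M q))" for q
      by (rule has_constituents_constituents[OF quasipoly_u_count])
    show "\<exists>P :: nat \<Rightarrow> real poly. (\<exists>T>0. \<forall>n. P (n + T) = P n) \<and>
        (\<forall>n. degree (P n) = 2 * i \<and> (\<forall>q. fact q * gamma M q i n = poly (P n) (real q)))" for i
      by (rule gamma_polynomial_in_q)
  qed (fact u_count_expansion gamma_const gamma_0 gamma_1 gamma_theta_bar theta_bar_stable theta_bar_top
      theta_bar_2 min_period_gamma)+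
qed

end
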